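(* Let $(\mathcal{A},\ast_{\mathcal{A}},a_{\mathcal{A}})$ be a left-symmetric algebroid. Then there is a graded Lie bracket $$[\![\cdot,\cdot]\!]_{\mathrm{KV}}:\Gamma(\wedge^k\mathcal{A}\otimes\mathcal{A})\times\Gamma(\wedge^l\mathcal{A}\otimes\mathcal{A})\to\Gamma(\wedge^{k+l}\mathcal{A}\otimes\mathcal{A})$$ on the graded vector space $C^*_{\mathrm{KV}}(\mathcal{A}^* )=\oplus_{k\ge1}C^k_{\mathrm{KV}}(\mathcal{A}^* )$, $C^k_{\mathrm{KV}}(\mathcal{A}^* )=\Gamma(\wedge^{k-1}\mathcal{A}\otimes\mathcal{A})$, given by $$[\![\varphi,\phi]\!]_{\mathrm{KV}}=\Upsilon[\![\Psi(\varphi),\Psi(\phi)]\!],\qquad \varphi\in\Gamma(\wedge^k\mathcal{A}\otimes\mathcal{A}),\ \phi\in\Gamma(\wedge^l\mathcal{A}\otimes\mathcal{A}).$$ Furthermore, $H\in\mathrm{Sym}^2(\mathcal{A})$ is a Koszul--Vinberg structure on the left-symmetric algebroid $\mathcal{A}$ if and only if $H$ is a Maurer--Cartan element of the graded Lie algebra $(C^*_{\mathrm{KV}}(\mathcal{A}^* ),[\![\cdot,\cdot]\!]_{\mathrm{KV}})$. More precisely, for $H\in\mathrm{Sym}^2(\mathcal{A})$, $$[\![H,H]\!]_{\mathrm{KV}}(\alpha_1,\alpha_2,\alpha_3)=2[H,H](\alpha_1,\alpha_2,\alpha_3),\qquad\forall\,\alpha_1,\alpha_2,\alpha_3\in\Gamma(\mathcal{A}^*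 ).$$
   Context: Vector bundles are smooth real vector bundles over a smooth manifold $M$. A left-symmetric algebroid $(\mathcal{A},\ast_{\mathcal{A}},a_{\mathcal{A}})$ is a vector bundle $\mathcal{A}\to M$ with an $\mathbb{R}$-bilinear product $\ast_{\mathcal{A}}$ on $\Gamma(\mathcal{A})$ satisfying $x\ast(y\ast z)-(x\ast y)\ast z=y\ast(x\ast z)-(y\ast x)\ast z$ and a bundle map $a_{\mathcal{A}}:\mathcal{A}\to TM$ with $x\ast_{\mathcal{A}}(fy)=f(x\ast_{\mathcal{A}}y)+a_{\mathcal{A}}(x)(f)y$, $(fx)\ast_{\mathcal{A}}y=f(x\ast_{\mathcal{A}}y)$. Its sub-adjacent Lie algebroid $\mathcal{A}^c$ is $\mathcal{A}$ with bracket $[x,y]_{\mathcal{A}}=x\ast_{\mathcal{A}}y-y\ast_{\mathcal{A}}x$ and anchor $a_{\mathcal{A}}$. For $x\in\Gamma(\mathcal{A})$, $L_x:\Gamma(\mathcal{A}^* )\to\Gamma(\mathcal{A}^* )$ is $\langle L_x\xi,y\rangle=a_{\mathcal{A}}(x)\langle\xi,y\rangle-\langle\xi,x\ast_{\mathcal{A}}y\rangle$; this is a representation of $\mathcal{A}^c$ on $\mathcal{A}^*$. $\mathrm{Sym}^2(\mathcal{A})$ is the set of (sections) $H$ of $\mathcal{A}\otimes\mathcal{A}$ with $H(\alpha,\beta)=H(\beta,\alpha)$; $H^\sharp:\mathcal{A}^*\to\mathcal{A}$ is $\langle H^\sharp(\alpha),\beta\rangle=H(\alpha,\beta)$. Define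 $$\begin{aligned}[][H,H](\alpha_1,\alpha_2,\alpha_3)={}&a_{\mathcal{A}}(H^\sharp(\alpha_1))\langle H^\sharp(\alpha_2),\alpha_3\rangle-a_{\mathcal{A}}(H^\sharp(\alpha_2))\langle H^\sharp(\alpha_1),\alpha_3\rangle+\langle\alpha_1,H^\sharp(\alpha_2)\ast_{\mathcal{A}}H^\sharp(\alpha_3)\rangle\\&-\langle\alpha_2,H^\sharp(\alpha_1)\ast_{\mathcal{A}}H^\sharp(\alpha_3)\rangle-\langle\alpha_3,[H^\sharp(\alpha_1),H^\sharp(\alpha_2)]_{\mathcal{A}}\rangle.\end{aligned}$$ $H$ is a Koszul--Vinberg structure if $[H,H]=0$. Let $\mathcal{C}^k(\mathcal{A}^*,\mathcal{A})=\Gamma(\mathrm{Hom}(\wedge^k\mathcal{A}^*,\mathcal{A}))$, $k\ge0$. For $P\in \mathcal{C}^n(\mathcal{A}^*,\mathcal{A})$, $Q\in \mathcal{C}^m(\mathcal{A}^*,\mathcal{A})$, $$\begin{aligned} [\![P,Q]\!](\alpha_1,\dots,\alpha_{m+n})={}&\sum_{\sigma\in\mathbb{S}_{(m,1,n-1)}} (-1)^\sigma P(L_{Q(\alpha_{\sigma(1)},\dots,\alpha_{\sigma(m)})}\alpha_{\sigma(m+1)},\alpha_{\sigma(m+2)},\dots,\alpha_{\sigma(m+n)})\\ &-(-1)^{mn}\sum_{\sigma\in\mathbb{S}_{(n,1,m-1)}} (-1)^\sigma Q(L_{P(\alpha_{\sigma(1)},\dots,\alpha_{\sigma(n)})}\alpha_{\sigma(n+1)},\alpha_{\sigma(n+2)},\dots,\alpha_{\sigma(m+n)})\\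 &+(-1)^{mn}\sum_{\sigma\in\mathbb{S}_{(n,m)}} (-1)^\sigma [P(\alpha_{\sigma(1)},\dots,\alpha_{\sigma(n)}),Q(\alpha_{\sigma(n+1)},\dots,\alpha_{\sigma(m+n)})]_{\mathcal{A}}, \end{aligned}$$ where $\mathbb{S}_{(i_1,\dots,i_k)}$ is the set of unshuffles (permutations increasing on consecutive blocks of lengths $i_1,\dots,i_k$) and a sum involving a block of length $-1$ is zero. $\Psi:\Gamma(\wedge^k\mathcal{A}\otimes\mathcal{A})\to\mathcal{C}^k(\mathcal{A}^*,\mathcal{A})$ is $\langle\Psi(\varphi)(\alpha_1,\dots,\alpha_k),\alpha_{k+1}\rangle=\varphi(\alpha_1,\dots,\alpha_{k+1})=\langle\varphi,\alpha_1\wedge\cdots\wedge\alpha_k\otimes\alpha_{k+1}\rangle$, and $\Upsilon=\Psi^{-1}$. For the graded Lie algebra structure, $\Gamma(\wedge^k\mathcal{A}\otimes\mathcal{A})=C^{k+1}_{\mathrm{KV}}(\mathcal{A}^* )$ has degree $k$. A Maurer--Cartan element is a degree $1$ element $\theta$ with $[\![\theta,\theta]\!]_{\mathrm{KV}}=0$; $\mathrm{Sym}^2(\mathcal{A})\subset\Gamma(\mathcal{A}\otimes\mathcal{A})=C^2_{\mathrm{KV}}(\mathcal{A}^* )$. *)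

theory Defs
  imports
    "HOL-Analysis.Analysis"
    "HOL-Library.Function_Algebras"
    "HOL-Combinatorics.Permutations"
begin

section \<open>Pointwise vector space structure on functions\<close>

instantiation "fun" :: (type, real_vector) real_vector
begin

definition scaleR_fun :: "real \<Rightarrow> ('a \<Rightarrow> 'b) \<Rightarrow> 'a \<Rightarrow> 'b" where
  "scaleR_fun c f = (\<lambda>x. c *\<^sub>R f x)"

instance
  by standard (auto simp: scaleR_fun_def fun_eq_iff scaleR_add_right scaleR_add_left)

end

definition linear_on :: "'a::real_vector set \<Rightarrow> ('a \<Rightarrow> 'b::real_vector) \<Rightarrow> bool" where
  "linear_on V f \<longleftrightarrow>
     (\<forall>x\<in>V. \<forall>y\<in>V. f (x + y) = f x + f y) \<and> (\<forall>c. \<forall>x\<in>V. f (c *\<^sub>R x) = c *\<^sub>R f x)"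

definition finite_dimensional :: "'a::real_vector itself \<Rightarrow> bool" where
  "finite_dimensional _ \<longleftrightarrow> (\<exists>B::'a set. finite B \<and> span B = UNIV)"


section \<open>Smooth manifolds\<close>

text \<open>
  \<^term>\<open>Ck_on n S f\<close>, for open \<^term>\<open>S\<close> in a finite-dimensional space, says that \<^term>\<open>f\<close> is
  of class \<open>C\<^sup>n\<close> on \<^term>\<open>S\<close>.
\<close>

primrec Ck_on :: "nat \<Rightarrow> 'a::real_normed_vector set \<Rightarrow> ('a \<Rightarrow> 'b::real_normed_vector) \<Rightarrow> bool" where
  "Ck_on 0 S f \<longleftrightarrow> continuous_on S f"
| "Ck_on (Suc n) S f \<longleftrightarrow>
     (\<forall>x\<in>S. f differentiable (at x)) \<and> (\<forall>v. Ck_on n S (\<lambda>x. frechet_derivative f (at x) v))"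

definition smooth_on :: "'a::real_normed_vector set \<Rightarrow> ('a \<Rightarrow> 'b::real_normed_vector) \<Rightarrow> bool" where
  "smooth_on S f \<longleftrightarrow> (\<forall>n. Ck_on n S f)"

text \<open>
  The manifold is the whole type \<open>'m\<close>.  The model space \<open>'e\<close> is a finite-dimensional
  \<^class>\<open>real_inner\<close> space and not a \<^class>\<open>euclidean_space\<close>, because the latter excludes
  dimension \<open>0\<close>; for the same reason the typical fibre \<open>'f\<close> of a bundle below is of class
  \<^class>\<open>real_inner\<close>, so that points as base and bundles of rank \<open>0\<close> are covered.
\<close>

record ('m, 'e) manifold =
  charts :: "('m set \<times> ('m \<Rightarrow> 'e)) set"

definition smooth_manifold ::
  "('m::{t2_space,second_countable_topology}, 'e::real_inner, 'z) manifold_scheme \<Rightarrow> bool" where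
  "smooth_manifold M \<longleftrightarrow>
     finite_dimensional TYPE('e) \<and>
     (\<Union>(U, \<phi>)\<in>charts M. U) = UNIV \<and>
     (\<forall>(U, \<phi>)\<in>charts M. open U \<and> open (\<phi> ` U) \<and> homeomorphism U (\<phi> ` U) \<phi> (inv_into U \<phi>)) \<and>
     (\<forall>(U, \<phi>)\<in>charts M. \<forall>(V, \<psi>)\<in>charts M.
        smooth_on (\<phi> ` (U \<inter> V)) (\<lambda>x. \<psi> (inv_into U \<phi> x)))"

definition mfd_smooth_on ::
  "('m, 'e::real_inner, 'z) manifold_scheme \<Rightarrow> 'm set \<Rightarrow> ('m \<Rightarrow> 'b::real_normed_vector) \<Rightarrow> bool" where
  "mfd_smooth_on M W f \<longleftrightarrow>
     (\<forall>(U, \<phi>)\<in>charts M. smooth_on (\<phi> ` (U \<inter> W)) (\<lambda>x. f (inv_into U \<phi> x)))"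

definition smooth_functions :: "('m, 'e::real_inner, 'z) manifold_scheme \<Rightarrow> ('m \<Rightarrow> real) set" where
  "smooth_functions M = {f. mfd_smooth_on M UNIV f}"

text \<open>
  Tangent vectors are derivations of the algebra of smooth functions, set to \<open>0\<close> on
  non-smooth functions so that the tangent space is a linear subspace of a function space.
\<close>

definition tangent_space ::
  "('m, 'e::real_inner, 'z) manifold_scheme \<Rightarrow> 'm \<Rightarrow> (('m \<Rightarrow> real) \<Rightarrow> real) set" where
  "tangent_space M p = {D.
     linear_on (smooth_functions M) D \<and>
     (\<forall>f\<in>smooth_functions M. \<forall>g\<in>smooth_functions M.
        D (\<lambda>q. f q * g q) = f p * D g + g p * D f) \<and>
     (\<forall>f. f \<notin> smooth_functions M \<longrightarrow> D f = 0)}"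

definition vector_fields ::
  "('m, 'e::real_inner, 'z) manifold_scheme \<Rightarrow> ('m \<Rightarrow> ('m \<Rightarrow> real) \<Rightarrow> real) set" where
  "vector_fields M = {X.
     (\<forall>p. X p \<in> tangent_space M p) \<and>
     (\<forall>f\<in>smooth_functions M. (\<lambda>p. X p f) \<in> smooth_functions M)}"


section \<open>Vector bundles\<close>

text \<open>
  The fibres are linear subspaces of one vector space \<open>'v\<close> without topology.  This is no
  restriction, since any family of vector spaces embeds into its direct sum.  Fibres over
  different points may intersect: the total space is the disjoint union of the fibres.
  A local trivialization \<open>(U, \<Phi>)\<close> consists of an open set and a linear isomorphism
  \<open>\<Phi> p\<close> of the fibre over \<open>p\<close> onto the typical fibre \<open>'f\<close>, for each \<open>p \<in> U\<close>; the smooth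
  structure of the total space is determined by the smoothness of the transition functions.
\<close>

record ('m, 'e, 'v, 'f) vbundle = "('m, 'e) manifold" +
  fibre :: "'m \<Rightarrow> 'v set"
  trivs :: "('m set \<times> ('m \<Rightarrow> 'v \<Rightarrow> 'f)) set"

definition vector_bundle ::
  "('m::{t2_space,second_countable_topology}, 'e::real_inner, 'v::real_vector, 'f::real_inner, 'z)
     vbundle_scheme \<Rightarrow> bool" where
  "vector_bundle A \<longleftrightarrow>
     smooth_manifold A \<and>
     finite_dimensional TYPE('f) \<and>
     (\<forall>p. subspace (fibre A p)) \<and>
     (\<Union>(U, \<Phi>)\<in>trivs A. U) = UNIV \<and>
     (\<forall>(U, \<Phi>)\<in>trivs A. open U \<and>
        (\<forall>p\<in>U. linear_on (fibre A p) (\<Phi> p) \<and> bij_betw (\<Phi> p) (fibre A p) UNIV)) \<and>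
     (\<forall>(U, \<Phi>)\<in>trivs A. \<forall>(V, \<Psi>)\<in>trivs A. \<forall>w.
        mfd_smooth_on A (U \<inter> V) (\<lambda>p. \<Psi> p (inv_into (fibre A p) (\<Phi> p) w)))"

definition sections ::
  "('m, 'e::real_inner, 'v::real_vector, 'f::real_inner, 'z) vbundle_scheme \<Rightarrow> ('m \<Rightarrow> 'v) set" where
  "sections A = {x.
     (\<forall>p. x p \<in> fibre A p) \<and>
     (\<forall>(U, \<Phi>)\<in>trivs A. mfd_smooth_on A U (\<lambda>p. \<Phi> p (x p)))}"

text \<open>
  Linear and multilinear maps on a subspace are set to \<open>0\<close> off their domain, so that two of
  them are equal exactly if they agree on the subspace.
\<close>

definition dual_space :: "'v::real_vector set \<Rightarrow> ('v \<Rightarrow> real) set" where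
  "dual_space V = {\<alpha>. linear_on V \<alpha> \<and> (\<forall>v. v \<notin> V \<longrightarrow> \<alpha> v = 0)}"

definition multilinear_on :: "nat \<Rightarrow> 'a::real_vector set \<Rightarrow> ('a list \<Rightarrow> 'b::real_vector) \<Rightarrow> bool" where
  "multilinear_on n V f \<longleftrightarrow>
     (\<forall>as. length as = n \<and> set as \<subseteq> V \<longrightarrow> (\<forall>i<n. linear_on V (\<lambda>b. f (as[i := b])))) \<and>
     (\<forall>as. \<not> (length as = n \<and> set as \<subseteq> V) \<longrightarrow> f as = 0)"

text \<open>For \<open>k \<le> n\<close>: an \<open>n\<close>-ary function that is alternating in its first \<open>k\<close> arguments.\<close>

definition alternating_on :: "nat \<Rightarrow> nat \<Rightarrow> 'a set \<Rightarrow> ('a list \<Rightarrow> 'b::zero) \<Rightarrow> bool" where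
  "alternating_on n k V f \<longleftrightarrow>
     (\<forall>as i j. length as = n \<and> set as \<subseteq> V \<and> i < j \<and> j < k \<and> as ! i = as ! j \<longrightarrow> f as = 0)"

definition dual_sections ::
  "('m, 'e::real_inner, 'v::real_vector, 'f::real_inner, 'z) vbundle_scheme
     \<Rightarrow> ('m \<Rightarrow> 'v \<Rightarrow> real) set" where
  "dual_sections A = {\<xi>.
     (\<forall>p. \<xi> p \<in> dual_space (fibre A p)) \<and>
     (\<forall>(U, \<Phi>)\<in>trivs A. \<forall>w.
        mfd_smooth_on A U (\<lambda>p. \<xi> p (inv_into (fibre A p) (\<Phi> p) w)))}"

text \<open>The covector at \<open>p\<close> with constant components \<open>w\<close> in the trivialization \<open>\<Phi>\<close>.\<close>

definition const_covector ::
  "('m, 'e, 'v, 'f::real_inner, 'z) vbundle_scheme \<Rightarrow> ('m \<Rightarrow> 'v \<Rightarrow> 'f) \<Rightarrow> 'm \<Rightarrow> 'f \<Rightarrow> 'v \<Rightarrow> real" where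
  "const_covector A \<Phi> p w = (\<lambda>v. if v \<in> fibre A p then w \<bullet> \<Phi> p v else 0)"

text \<open>
  Smooth sections of the bundle of alternating \<open>k\<close>-linear maps from the dual of \<open>A\<close> to \<open>A\<close>.
\<close>

definition hom_sections ::
  "('m, 'e::real_inner, 'v::real_vector, 'f::real_inner, 'z) vbundle_scheme \<Rightarrow> nat
     \<Rightarrow> ('m \<Rightarrow> ('v \<Rightarrow> real) list \<Rightarrow> 'v) set" where
  "hom_sections A k = {P.
     (\<forall>p. multilinear_on k (dual_space (fibre A p)) (P p) \<and>
          alternating_on k k (dual_space (fibre A p)) (P p) \<and>
          range (P p) \<subseteq> fibre A p) \<and>
     (\<forall>(U, \<Phi>)\<in>trivs A. \<forall>ws. length ws = k \<longrightarrow>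
        mfd_smooth_on A U (\<lambda>p. \<Phi> p (P p (map (const_covector A \<Phi> p) ws))))}"

text \<open>
  Smooth sections of \<open>\<Lambda>\<^sup>k A \<otimes> A\<close>.  An element of \<open>\<Lambda>\<^sup>k A\<^sub>p \<otimes> A\<^sub>p\<close> is a \<open>(k + 1)\<close>-linear form on
  the dual of \<open>A\<^sub>p\<close> that is alternating in the first \<open>k\<close> arguments, by way of
  \<open>\<phi>(\<alpha>\<^sub>1, \<dots>, \<alpha>\<^sub>k\<^sub>+\<^sub>1) = \<langle>\<phi>, \<alpha>\<^sub>1 \<and> \<dots> \<and> \<alpha>\<^sub>k \<otimes> \<alpha>\<^sub>k\<^sub>+\<^sub>1\<rangle>\<close>; the fibres are finite-dimensional.
\<close>

definition tensor_sections ::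
  "('m, 'e::real_inner, 'v::real_vector, 'f::real_inner, 'z) vbundle_scheme \<Rightarrow> nat
     \<Rightarrow> ('m \<Rightarrow> ('v \<Rightarrow> real) list \<Rightarrow> real) set" where
  "tensor_sections A k = {\<phi>.
     (\<forall>p. multilinear_on (k + 1) (dual_space (fibre A p)) (\<phi> p) \<and>
          alternating_on (k + 1) k (dual_space (fibre A p)) (\<phi> p)) \<and>
     (\<forall>(U, \<Phi>)\<in>trivs A. \<forall>ws. length ws = k + 1 \<longrightarrow>
        mfd_smooth_on A U (\<lambda>p. \<phi> p (map (const_covector A \<Phi> p) ws)))}"

definition eval_at :: "('m \<Rightarrow> 'w list \<Rightarrow> 'b) \<Rightarrow> ('m \<Rightarrow> 'w) list \<Rightarrow> 'm \<Rightarrow> 'b" where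
  "eval_at T \<alpha>s = (\<lambda>p. T p (map (\<lambda>\<alpha>. \<alpha> p) \<alpha>s))"

definition pairing :: "('m \<Rightarrow> 'v \<Rightarrow> real) \<Rightarrow> ('m \<Rightarrow> 'v) \<Rightarrow> 'm \<Rightarrow> real" where
  "pairing \<xi> x = (\<lambda>p. \<xi> p (x p))"

definition fscale :: "('m \<Rightarrow> real) \<Rightarrow> ('m \<Rightarrow> 'v::real_vector) \<Rightarrow> 'm \<Rightarrow> 'v" where
  "fscale f x = (\<lambda>p. f p *\<^sub>R x p)"

text \<open>The vector that represents an element \<open>F\<close> of the bidual of \<open>V\<close>.\<close>

definition bidual_vector :: "'v::real_vector set \<Rightarrow> (('v \<Rightarrow> real) \<Rightarrow> real) \<Rightarrow> 'v" where
  "bidual_vector V F = (THE v. v \<in> V \<and> (\<forall>\<beta>\<in>dual_space V. \<beta> v = F \<beta>))"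

definition Psi ::
  "('m, 'e, 'v::real_vector, 'f, 'z) vbundle_scheme
     \<Rightarrow> ('m \<Rightarrow> ('v \<Rightarrow> real) list \<Rightarrow> real) \<Rightarrow> 'm \<Rightarrow> ('v \<Rightarrow> real) list \<Rightarrow> 'v" where
  "Psi A \<phi> = (\<lambda>p as. bidual_vector (fibre A p) (\<lambda>\<beta>. \<phi> p (as @ [\<beta>])))"

definition Upsilon ::
  "('m, 'e::real_inner, 'v::real_vector, 'f::real_inner, 'z) vbundle_scheme \<Rightarrow> nat
     \<Rightarrow> ('m \<Rightarrow> ('v \<Rightarrow> real) list \<Rightarrow> 'v) \<Rightarrow> 'm \<Rightarrow> ('v \<Rightarrow> real) list \<Rightarrow> real" where
  "Upsilon A k = inv_into (tensor_sections A k) (Psi A)"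


section \<open>Left-symmetric algebroids\<close>

record ('m, 'e, 'v, 'f) algebroid = "('m, 'e, 'v, 'f) vbundle" +
  product :: "('m \<Rightarrow> 'v) \<Rightarrow> ('m \<Rightarrow> 'v) \<Rightarrow> 'm \<Rightarrow> 'v"
  anchor :: "'m \<Rightarrow> 'v \<Rightarrow> ('m \<Rightarrow> real) \<Rightarrow> real"

definition anchor_act ::
  "('m, 'e, 'v, 'f, 'z) algebroid_scheme \<Rightarrow> ('m \<Rightarrow> 'v) \<Rightarrow> ('m \<Rightarrow> real) \<Rightarrow> 'm \<Rightarrow> real" where
  "anchor_act A x f = (\<lambda>p. anchor A p (x p) f)"

text \<open>
  The conditions on the anchor express that it is a bundle map to the tangent bundle: it maps
  fibres linearly to tangent spaces, and smooth sections to smooth vector fields.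
\<close>

definition left_symmetric_algebroid ::
  "('m::{t2_space,second_countable_topology}, 'e::real_inner, 'v::real_vector, 'f::real_inner, 'z)
     algebroid_scheme \<Rightarrow> bool" where
  "left_symmetric_algebroid A \<longleftrightarrow>
     vector_bundle A \<and>
     (\<forall>p. linear_on (fibre A p) (anchor A p) \<and> anchor A p ` fibre A p \<subseteq> tangent_space A p) \<and>
     (\<forall>x\<in>sections A. (\<lambda>p. anchor A p (x p)) \<in> vector_fields A) \<and>
     (\<forall>x\<in>sections A. \<forall>y\<in>sections A. product A x y \<in> sections A) \<and>
     (\<forall>x\<in>sections A. linear_on (sections A) (\<lambda>y. product A x y)) \<and>
     (\<forall>y\<in>sections A. linear_on (sections A) (\<lambda>x. product A x y)) \<and>
     (\<forall>x\<in>sections A. \<forall>y\<in>sections A. \<forall>z\<in>sections A.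
        product A x (product A y z) - product A (product A x y) z
          = product A y (product A x z) - product A (product A y x) z) \<and>
     (\<forall>x\<in>sections A. \<forall>y\<in>sections A. \<forall>f\<in>smooth_functions A.
        product A x (fscale f y) = fscale f (product A x y) + fscale (anchor_act A x f) y \<and>
        product A (fscale f x) y = fscale f (product A x y))"

definition commutator ::
  "('m, 'e, 'v::real_vector, 'f, 'z) algebroid_scheme
     \<Rightarrow> ('m \<Rightarrow> 'v) \<Rightarrow> ('m \<Rightarrow> 'v) \<Rightarrow> 'm \<Rightarrow> 'v" where
  "commutator A x y = product A x y - product A y x"

text \<open>
  The section \<open>L\<^sub>x \<xi>\<close>.  It exists because the right-hand side is linear in \<open>y\<close> over the smooth
  functions.
\<close>

definition L_rep ::
  "('m, 'e::real_inner, 'v::real_vector, 'f::real_inner, 'z) algebroid_scheme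
     \<Rightarrow> ('m \<Rightarrow> 'v) \<Rightarrow> ('m \<Rightarrow> 'v \<Rightarrow> real) \<Rightarrow> 'm \<Rightarrow> 'v \<Rightarrow> real" where
  "L_rep A x \<xi> = (THE \<eta>. \<eta> \<in> dual_sections A \<and>
     (\<forall>y\<in>sections A. pairing \<eta> y = anchor_act A x (pairing \<xi> y) - pairing \<xi> (product A x y)))"


section \<open>Koszul--Vinberg structures\<close>

definition Sym2 ::
  "('m, 'e::real_inner, 'v::real_vector, 'f::real_inner, 'z) vbundle_scheme
     \<Rightarrow> ('m \<Rightarrow> ('v \<Rightarrow> real) list \<Rightarrow> real) set" where
  "Sym2 A = {H \<in> tensor_sections A 1.
     \<forall>p. \<forall>\<alpha>\<in>dual_space (fibre A p). \<forall>\<beta>\<in>dual_space (fibre A p). H p [\<alpha>, \<beta>] = H p [\<beta>, \<alpha>]}"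

definition sharp ::
  "('m, 'e, 'v::real_vector, 'f, 'z) vbundle_scheme
     \<Rightarrow> ('m \<Rightarrow> ('v \<Rightarrow> real) list \<Rightarrow> real) \<Rightarrow> ('m \<Rightarrow> 'v \<Rightarrow> real) \<Rightarrow> 'm \<Rightarrow> 'v" where
  "sharp A H \<alpha> = (\<lambda>p. bidual_vector (fibre A p) (\<lambda>\<beta>. H p [\<alpha> p, \<beta>]))"

definition HH_bracket ::
  "('m, 'e, 'v::real_vector, 'f, 'z) algebroid_scheme
     \<Rightarrow> ('m \<Rightarrow> ('v \<Rightarrow> real) list \<Rightarrow> real)
     \<Rightarrow> ('m \<Rightarrow> 'v \<Rightarrow> real) \<Rightarrow> ('m \<Rightarrow> 'v \<Rightarrow> real) \<Rightarrow> ('m \<Rightarrow> 'v \<Rightarrow> real) \<Rightarrow> 'm \<Rightarrow> real" where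
  "HH_bracket A H \<alpha>1 \<alpha>2 \<alpha>3 =
     anchor_act A (sharp A H \<alpha>1) (pairing \<alpha>3 (sharp A H \<alpha>2))
     - anchor_act A (sharp A H \<alpha>2) (pairing \<alpha>3 (sharp A H \<alpha>1))
     + pairing \<alpha>1 (product A (sharp A H \<alpha>2) (sharp A H \<alpha>3))
     - pairing \<alpha>2 (product A (sharp A H \<alpha>1) (sharp A H \<alpha>3))
     - pairing \<alpha>3 (commutator A (sharp A H \<alpha>1) (sharp A H \<alpha>2))"

definition Koszul_Vinberg_structure ::
  "('m, 'e::real_inner, 'v::real_vector, 'f::real_inner, 'z) algebroid_scheme
     \<Rightarrow> ('m \<Rightarrow> ('v \<Rightarrow> real) list \<Rightarrow> real) \<Rightarrow> bool" where
  "Koszul_Vinberg_structure A H \<longleftrightarrow> H \<in> Sym2 A \<and>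
     (\<forall>\<alpha>1\<in>dual_sections A. \<forall>\<alpha>2\<in>dual_sections A. \<forall>\<alpha>3\<in>dual_sections A.
        HH_bracket A H \<alpha>1 \<alpha>2 \<alpha>3 = 0)"


section \<open>The bracket\<close>

text \<open>Permutations of \<open>{0, \<dots>, N - 1}\<close>, \<open>N\<close> the sum of the block lengths \<open>is\<close>.\<close>

definition unshuffles :: "nat list \<Rightarrow> (nat \<Rightarrow> nat) set" where
  "unshuffles is = {\<sigma>. \<sigma> permutes {..<sum_list is} \<and>
     (\<forall>j<length is. strict_mono_on {sum_list (take j is)..<sum_list (take (Suc j) is)} \<sigma>)}"

text \<open>
  The first sum in the bracket of \<open>P\<close> of degree \<open>n\<close> and \<open>Q\<close> of degree \<open>m\<close>.  The second sum
  arises from it by interchanging \<open>P\<close> and \<open>Q\<close>.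
\<close>

definition insertion_sum ::
  "('m, 'e::real_inner, 'v::real_vector, 'f::real_inner, 'z) algebroid_scheme \<Rightarrow> nat \<Rightarrow> nat
     \<Rightarrow> ('m \<Rightarrow> ('v \<Rightarrow> real) list \<Rightarrow> 'v) \<Rightarrow> ('m \<Rightarrow> ('v \<Rightarrow> real) list \<Rightarrow> 'v)
     \<Rightarrow> ('m \<Rightarrow> 'v \<Rightarrow> real) list \<Rightarrow> 'm \<Rightarrow> 'v" where
  "insertion_sum A n m P Q \<alpha>s =
     (if n = 0 then 0 else
       (\<Sum>\<sigma>\<in>unshuffles [m, 1, n - 1]. real_of_int (sign \<sigma>) *\<^sub>R
          eval_at P
            (L_rep A (eval_at Q (map (\<lambda>i. \<alpha>s ! \<sigma> i) [0..<m])) (\<alpha>s ! \<sigma> m)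
             # map (\<lambda>i. \<alpha>s ! \<sigma> i) [m + 1..<m + n])))"

definition bracket_formula ::
  "('m, 'e::real_inner, 'v::real_vector, 'f::real_inner, 'z) algebroid_scheme \<Rightarrow> nat \<Rightarrow> nat
     \<Rightarrow> ('m \<Rightarrow> ('v \<Rightarrow> real) list \<Rightarrow> 'v) \<Rightarrow> ('m \<Rightarrow> ('v \<Rightarrow> real) list \<Rightarrow> 'v)
     \<Rightarrow> ('m \<Rightarrow> 'v \<Rightarrow> real) list \<Rightarrow> 'm \<Rightarrow> 'v" where
  "bracket_formula A n m P Q \<alpha>s =
     insertion_sum A n m P Q \<alpha>s
     - (- 1) ^ (m * n) *\<^sub>R insertion_sum A m n Q P \<alpha>s
     + (- 1) ^ (m * n) *\<^sub>R
         (\<Sum>\<sigma>\<in>unshuffles [n, m]. real_of_int (sign \<sigma>) *\<^sub>R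
            commutator A
              (eval_at P (map (\<lambda>i. \<alpha>s ! \<sigma> i) [0..<n]))
              (eval_at Q (map (\<lambda>i. \<alpha>s ! \<sigma> i) [n..<m + n])))"

definition hom_bracket ::
  "('m, 'e::real_inner, 'v::real_vector, 'f::real_inner, 'z) algebroid_scheme \<Rightarrow> nat \<Rightarrow> nat
     \<Rightarrow> ('m \<Rightarrow> ('v \<Rightarrow> real) list \<Rightarrow> 'v) \<Rightarrow> ('m \<Rightarrow> ('v \<Rightarrow> real) list \<Rightarrow> 'v)
     \<Rightarrow> 'm \<Rightarrow> ('v \<Rightarrow> real) list \<Rightarrow> 'v" where
  "hom_bracket A n m P Q = (THE R. R \<in> hom_sections A (n + m) \<and>
     (\<forall>\<alpha>s. set \<alpha>s \<subseteq> dual_sections A \<and> length \<alpha>s = n + m \<longrightarrow>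
        eval_at R \<alpha>s = bracket_formula A n m P Q \<alpha>s))"

definition KV_bracket ::
  "('m, 'e::real_inner, 'v::real_vector, 'f::real_inner, 'z) algebroid_scheme \<Rightarrow> nat \<Rightarrow> nat
     \<Rightarrow> ('m \<Rightarrow> ('v \<Rightarrow> real) list \<Rightarrow> real) \<Rightarrow> ('m \<Rightarrow> ('v \<Rightarrow> real) list \<Rightarrow> real)
     \<Rightarrow> 'm \<Rightarrow> ('v \<Rightarrow> real) list \<Rightarrow> real" where
  "KV_bracket A k l \<phi> \<psi> = Upsilon A (k + l) (hom_bracket A k l (Psi A \<phi>) (Psi A \<psi>))"

text \<open>Only used for \<open>k \<ge> 1\<close>.\<close>

definition C_KV ::
  "('m, 'e::real_inner, 'v::real_vector, 'f::real_inner, 'z) vbundle_scheme \<Rightarrow> nat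
     \<Rightarrow> ('m \<Rightarrow> ('v \<Rightarrow> real) list \<Rightarrow> real) set" where
  "C_KV A k = tensor_sections A (k - 1)"


section \<open>Graded Lie algebras\<close>

text \<open>
  A graded vector space is the family \<open>g\<close> of its homogeneous components, and a bracket of
  degree \<open>0\<close> is given by its restrictions \<open>br k l\<close> to pairs of components.
\<close>

definition graded_Lie_algebra ::
  "(nat \<Rightarrow> 'x::real_vector set) \<Rightarrow> (nat \<Rightarrow> nat \<Rightarrow> 'x \<Rightarrow> 'x \<Rightarrow> 'x) \<Rightarrow> bool" where
  "graded_Lie_algebra g br \<longleftrightarrow>
     (\<forall>k. subspace (g k)) \<and>
     (\<forall>k l. \<forall>x\<in>g k. \<forall>y\<in>g l. br k l x y \<in> g (k + l)) \<and>
     (\<forall>k l. \<forall>x\<in>g k. linear_on (g l) (\<lambda>y. br k l x y)) \<and>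
     (\<forall>k l. \<forall>y\<in>g l. linear_on (g k) (\<lambda>x. br k l x y)) \<and>
     (\<forall>k l. \<forall>x\<in>g k. \<forall>y\<in>g l. br k l x y = - ((- 1) ^ (k * l) *\<^sub>R br l k y x)) \<and>
     (\<forall>k l j. \<forall>x\<in>g k. \<forall>y\<in>g l. \<forall>z\<in>g j.
        br k (l + j) x (br l j y z)
          = br (k + l) j (br k l x y) z + (- 1) ^ (k * l) *\<^sub>R br l (k + j) y (br k j x z))"

definition Maurer_Cartan ::
  "(nat \<Rightarrow> 'x::real_vector set) \<Rightarrow> (nat \<Rightarrow> nat \<Rightarrow> 'x \<Rightarrow> 'x \<Rightarrow> 'x) \<Rightarrow> 'x \<Rightarrow> bool" where
  "Maurer_Cartan g br \<theta> \<longleftrightarrow> \<theta> \<in> g 1 \<and> br 1 1 \<theta> \<theta> = 0"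

end

theory Submission
  imports Defs
begin

text \<open>
  Sections of \<open>\<Lambda>\<^sup>k A \<otimes> A\<close> are alternating cochains on the Lie algebra representation
  \<open>L\<close> of sections of \<open>A\<close> on sections of the dual bundle.  For a Lie algebra \<open>U\<close> acting on \<open>V\<close>,
  a \<open>U\<close>-valued cochain is a function on the odd vector space \<open>V[1]\<close> with values in \<open>U\<close>, hence a section of
  the action Lie algebroid, and the bracket is, up to the order of its arguments, the bracket of this
  algebroid.  The Jacobi identity therefore reduces to the facts that vector fields on \<open>V[1]\<close>
  act as derivations, that their commutator acts as the commutator of the actions, and that \<open>U\<close>
  acts by a representation.  Each of these identities is compatible with contracting all cochains
  involved with a vector, so it follows by induction on the number of arguments; the sums over
  unshuffles satisfy the same recursion.

  The bracket is tensorial although \<open>L\<close> is not: the derivatives of functions along the anchor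
  cancel.  Bump functions and local frames then turn function-linear maps between sections into
  bundle maps, which yields both the sections \<open>L\<^sub>x \<xi>\<close> and the values of the bracket.  For
  symmetric \<open>H\<close>, the identity \<open>\<langle>H\<^sup>\<sharp>(\<alpha>), \<beta>\<rangle> = \<langle>H\<^sup>\<sharp>(\<beta>), \<alpha>\<rangle>\<close> moves \<open>H\<^sup>\<sharp>\<close> off \<open>L\<^sub>x \<xi>\<close> and gives
  \<open>[H, H]\<close> twice.
\<close>

section \<open>Alternating cochains\<close>

text \<open>Two features shape the argument. Cochains are functions on lists of every length, and
  their degree is recorded modulo 2 only. Contraction can therefore raise the degree instead of
  lowering it, no truncated subtraction occurs, and every induction starts at the empty list, where
  a cochain of odd degree vanishes and few signs are left to compare. Exact lengths return only when
  the abstract bracket is compared with the sums over unshuffles. The second feature is that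
  \<open>L\<close> is a representation only if the anchor respects brackets, which is not among the
  axioms. It follows from left symmetry at every point whose fibre is non-zero, and at the remaining
  points every pairing is 0. Moreover \<open>bidual_vector\<close>, \<open>L_rep\<close> and
  \<open>hom_bracket\<close> are introduced by definite description and \<open>Upsilon\<close> as an
  inverse, so nothing is known about their values before existence and uniqueness, or bijectivity of
  \<open>Psi\<close>, are established. This is why reflexivity of the fibres and the passage from
  function-linear maps to bundle maps have to come before any statement on the bracket of
  tensors.\<close>

lemma linear_on_add: "linear_on V f \<Longrightarrow> x \<in> V \<Longrightarrow> y \<in> V \<Longrightarrow> f (x + y) = f x + f y"
  and linear_on_scale: "linear_on V f \<Longrightarrow> x \<in> V \<Longrightarrow> f (c *\<^sub>R x) = c *\<^sub>R f x"
  by (auto simp: linear_on_def)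

lemma linear_on_0: "linear_on V f \<Longrightarrow> subspace V \<Longrightarrow> f 0 = 0"
  using linear_on_scale[of V f 0 0] by (auto simp: subspace_0)

lemma linear_on_lincomb:
  "linear_on V f \<Longrightarrow> subspace V \<Longrightarrow> x \<in> V \<Longrightarrow> y \<in> V \<Longrightarrow> f (x + c *\<^sub>R y) = f x + c *\<^sub>R f y"
  by (simp add: linear_on_add linear_on_scale subspace_scale)

lemma linear_on_sum:
  assumes "linear_on V f" "subspace V" "\<And>i. i \<in> I \<Longrightarrow> x i \<in> V"
  shows "f (\<Sum>i\<in>I. x i) = (\<Sum>i\<in>I. f (x i))"
  using assms(3)
proof (induction I rule: infinite_finite_induct)
  case (insert i I)
  then show ?case
    using assms(1,2) by (simp add: linear_on_add subspace_sum)
qed (use assms(1,2) in \<open>auto simp: linear_on_0\<close>)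

lemma linear_on_diff:
  assumes "linear_on V f" "subspace V" "x \<in> V" "y \<in> V"
  shows "f (x - y) = f x - f y"
proof -
  have "f (x + (-1) *\<^sub>R y) = f x + (-1) *\<^sub>R f y"
    using assms by (simp only: linear_on_add linear_on_scale subspace_scale)
  then show ?thesis by simp
qed

lemma linear_on_cong: "(\<And>x. x \<in> V \<Longrightarrow> f x = g x) \<Longrightarrow> subspace V \<Longrightarrow> linear_on V f \<longleftrightarrow> linear_on V g"
  by (auto simp: linear_on_def subspace_add subspace_scale)

text \<open>Sections form a subspace of a function space, and maps such as \<open>commutator\<close>
  and \<open>L_rep\<close> are controlled only there. Closedness is therefore part of the
  notion.\<close>

definition bilinear_into ::
  "'a::real_vector set \<Rightarrow> 'b::real_vector set \<Rightarrow> 'c::real_vector set \<Rightarrow> ('a \<Rightarrow> 'b \<Rightarrow> 'c) \<Rightarrow> bool" where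
  "bilinear_into U W Z B \<longleftrightarrow>
     (\<forall>x\<in>U. linear_on W (B x)) \<and> (\<forall>y\<in>W. linear_on U (\<lambda>x. B x y)) \<and> (\<forall>x\<in>U. \<forall>y\<in>W. B x y \<in> Z)"

text \<open>
  Summing over all pairs of complementary sublists without fixing their lengths keeps degrees
  out of the recursion: homogeneous cochains vanish on lists of the wrong length.
\<close>

primrec shuffle_sum :: "'a list \<Rightarrow> ('a list \<Rightarrow> 'a list \<Rightarrow> 'b::real_vector) \<Rightarrow> 'b" where
  "shuffle_sum [] = (\<lambda>G. G [] [])"
| "shuffle_sum (a # as) = (\<lambda>G. shuffle_sum as (\<lambda>x. G (a # x))
     + shuffle_sum as (\<lambda>x y. (- 1) ^ length x *\<^sub>R G x (a # y)))"

text \<open>The exterior product along a pairing \<open>B\<close>. One definition serves the bracket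
  of two cochains, the action of one cochain on another, and later the derivative terms that the
  anchor produces.\<close>

definition wedge ::
  "('b \<Rightarrow> 'c \<Rightarrow> 'd::real_vector) \<Rightarrow> ('a list \<Rightarrow> 'b) \<Rightarrow> ('a list \<Rightarrow> 'c) \<Rightarrow> 'a list \<Rightarrow> 'd" where
  "wedge B F G as = shuffle_sum as (\<lambda>x y. B (F x) (G y))"

text \<open>The value of \<open>X\<close> goes into the first slot of \<open>F\<close>, so that
  contraction with a new head costs a single transposition.\<close>

definition ins :: "('a list \<Rightarrow> 'a) \<Rightarrow> ('a list \<Rightarrow> 'b::real_vector) \<Rightarrow> 'a list \<Rightarrow> 'b" where
  "ins X F as = shuffle_sum as (\<lambda>x y. F (X x # y))"

text \<open>A function on lists is determined by its value on the empty list and its contractions;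
  the identities between products and insertions are proved in this way.\<close>

definition contract :: "'a \<Rightarrow> ('a list \<Rightarrow> 'b) \<Rightarrow> 'a list \<Rightarrow> 'b" where
  "contract a F = (\<lambda>as. F (a # as))"

text \<open>Only the parity of the degree \<open>p\<close> matters for the signs.\<close>

definition cochain ::
  "'a::real_vector set \<Rightarrow> 'b::real_vector set \<Rightarrow> nat \<Rightarrow> ('a list \<Rightarrow> 'b) \<Rightarrow> bool" where
  "cochain V W p F \<longleftrightarrow>
     (\<forall>as. set as \<subseteq> V \<longrightarrow> F as \<in> W \<and> (even (length as) \<noteq> even p \<longrightarrow> F as = 0)) \<and>
     (\<forall>bs as. set bs \<subseteq> V \<longrightarrow> set as \<subseteq> V \<longrightarrow> linear_on V (\<lambda>a. F (bs @ a # as))) \<and>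
     (\<forall>bs a as. set bs \<subseteq> V \<longrightarrow> a \<in> V \<longrightarrow> set as \<subseteq> V \<longrightarrow> F (bs @ a # a # as) = 0)"

section \<open>Calculus of shuffle sums\<close>

lemma shuffle_sum_cong:
  assumes "\<And>x y. set x \<subseteq> set as \<Longrightarrow> set y \<subseteq> set as \<Longrightarrow> length x + length y = length as \<Longrightarrow> G x y = H x y"
  shows "shuffle_sum as G = shuffle_sum as H"
  using assms
proof (induction as arbitrary: G H)
  case (Cons a as)
  have 1: "shuffle_sum as (\<lambda>x. G (a # x)) = shuffle_sum as (\<lambda>x. H (a # x))"
    by (rule Cons.IH, rule Cons.prems) auto
  have 2: "shuffle_sum as (\<lambda>x y. (- 1) ^ length x *\<^sub>R G x (a # y))
      = shuffle_sum as (\<lambda>x y. (- 1) ^ length x *\<^sub>R H x (a # y))"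
    by (rule Cons.IH, subst Cons.prems) auto
  show ?case by (simp add: 1 2)
qed simp

lemma shuffle_sum_add:
  "shuffle_sum as (\<lambda>x y. G x y + H x y) = shuffle_sum as G + shuffle_sum as H"
  by (induction as arbitrary: G H) (auto simp: scaleR_add_right algebra_simps)

lemma shuffle_sum_scale:
  "shuffle_sum as (\<lambda>x y. c *\<^sub>R G x y) = c *\<^sub>R shuffle_sum as G"
proof (induction as arbitrary: G)
  case (Cons a as)
  have "shuffle_sum as (\<lambda>x y. (- 1) ^ length x *\<^sub>R c *\<^sub>R G x (a # y))
     = shuffle_sum as (\<lambda>x y. c *\<^sub>R (- 1) ^ length x *\<^sub>R G x (a # y))"
    by (simp add: mult.commute)
  then show ?case
    by (simp only: shuffle_sum.simps Cons.IH scaleR_add_right)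
qed simp

lemma shuffle_sum_0: "shuffle_sum as (\<lambda>x y. 0) = 0"
  using shuffle_sum_scale[of as 0 "\<lambda>x y. 0"] by simp

lemma shuffle_sum_mem:
  assumes "subspace W" "\<And>x y. set x \<subseteq> set as \<Longrightarrow> set y \<subseteq> set as \<Longrightarrow> G x y \<in> W"
  shows "shuffle_sum as G \<in> W"
  using assms(2)
proof (induction as arbitrary: G)
  case (Cons a as)
  have "shuffle_sum as (\<lambda>x. G (a # x)) \<in> W"
    by (rule Cons.IH, rule Cons.prems) auto
  moreover have "shuffle_sum as (\<lambda>x y. (- 1) ^ length x *\<^sub>R G x (a # y)) \<in> W"
    by (rule Cons.IH, rule subspace_scale[OF assms(1)], rule Cons.prems) auto
  ultimately show ?case using assms(1) by (simp add: subspace_add)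
qed simp

lemma shuffle_sum_linear:
  assumes "subspace W" "linear_on W f" "\<And>x y. set x \<subseteq> set as \<Longrightarrow> set y \<subseteq> set as \<Longrightarrow> G x y \<in> W"
  shows "f (shuffle_sum as G) = shuffle_sum as (\<lambda>x y. f (G x y))"
  using assms(3)
proof (induction as arbitrary: G)
  case (Cons a as)
  have m1: "set x \<subseteq> set as \<Longrightarrow> set y \<subseteq> set as \<Longrightarrow> G (a # x) y \<in> W" for x y
    by (rule Cons.prems) auto
  have m2: "set x \<subseteq> set as \<Longrightarrow> set y \<subseteq> set as \<Longrightarrow> G x (a # y) \<in> W" for x y
    by (rule Cons.prems) auto
  have m3: "set x \<subseteq> set as \<Longrightarrow> set y \<subseteq> set as \<Longrightarrow> (- 1) ^ length x *\<^sub>R G x (a # y) \<in> W" for x y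
    by (rule subspace_scale[OF assms(1)], rule m2) auto
  have "f (shuffle_sum (a # as) G) = f (shuffle_sum as (\<lambda>x. G (a # x)))
     + f (shuffle_sum as (\<lambda>x y. (- 1) ^ length x *\<^sub>R G x (a # y)))"
    unfolding shuffle_sum.simps
    by (rule linear_on_add[OF assms(2)]; rule shuffle_sum_mem[OF assms(1)]) (auto intro: m1 m3)
  also have "f (shuffle_sum as (\<lambda>x. G (a # x))) = shuffle_sum as (\<lambda>x y. f (G (a # x) y))"
    by (rule Cons.IH) (rule m1)
  also have "f (shuffle_sum as (\<lambda>x y. (- 1) ^ length x *\<^sub>R G x (a # y)))
     = shuffle_sum as (\<lambda>x y. f ((- 1) ^ length x *\<^sub>R G x (a # y)))"
    by (rule Cons.IH) (rule m3)
  also have "\<dots> = shuffle_sum as (\<lambda>x y. (- 1) ^ length x *\<^sub>R f (G x (a # y)))"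
    by (rule shuffle_sum_cong) (auto intro!: linear_on_scale[OF assms(2)] m2)
  finally show ?case by simp
qed simp

section \<open>Cochains, their products and their insertions\<close>

lemma bilinear_into_left: "bilinear_into U W Z B \<Longrightarrow> y \<in> W \<Longrightarrow> linear_on U (\<lambda>x. B x y)"
  and bilinear_into_right: "bilinear_into U W Z B \<Longrightarrow> x \<in> U \<Longrightarrow> linear_on W (B x)"
  and bilinear_into_mem: "bilinear_into U W Z B \<Longrightarrow> x \<in> U \<Longrightarrow> y \<in> W \<Longrightarrow> B x y \<in> Z"
  by (auto simp: bilinear_into_def)

lemma cochain_mem: "cochain V W p F \<Longrightarrow> set as \<subseteq> V \<Longrightarrow> F as \<in> W"
  and cochain_parity: "cochain V W p F \<Longrightarrow> set as \<subseteq> V \<Longrightarrow> even (length as) \<noteq> even p \<Longrightarrow> F as = 0"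
  and cochain_linear_at:
    "cochain V W p F \<Longrightarrow> set bs \<subseteq> V \<Longrightarrow> set as \<subseteq> V \<Longrightarrow> linear_on V (\<lambda>a. F (bs @ a # as))"
  and cochain_alt_at:
    "cochain V W p F \<Longrightarrow> set bs \<subseteq> V \<Longrightarrow> a \<in> V \<Longrightarrow> set as \<subseteq> V \<Longrightarrow> F (bs @ a # a # as) = 0"
  unfolding cochain_def by blast+

lemma cochain_linear: "cochain V W p F \<Longrightarrow> set as \<subseteq> V \<Longrightarrow> linear_on V (\<lambda>a. F (a # as))"
  using cochain_linear_at[of V W p F "[]"] by simp

lemma cochain_alt: "cochain V W p F \<Longrightarrow> a \<in> V \<Longrightarrow> set as \<subseteq> V \<Longrightarrow> F (a # a # as) = 0"
  using cochain_alt_at[of V W p F "[]"] by simp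

lemma cochain_contract:
  assumes "cochain V W p F" "a \<in> V"
  shows "cochain V W (Suc p) (contract a F)"
  unfolding cochain_def contract_def
proof (intro conjI allI impI)
  fix as assume as: "set as \<subseteq> V"
  show "F (a # as) \<in> W" using cochain_mem[OF assms(1), of "a # as"] as assms(2) by simp
  show "F (a # as) = 0" if "even (length as) \<noteq> even (Suc p)"
    using cochain_parity[OF assms(1), of "a # as"] as assms(2) that by simp
next
  fix bs as :: "'a list" assume s: "set bs \<subseteq> V" "set as \<subseteq> V"
  show "linear_on V (\<lambda>aa. F (a # bs @ aa # as))"
    using cochain_linear_at[OF assms(1), of "a # bs" as] s assms(2) by simp
next
  fix bs aa and as :: "'a list" assume s: "set bs \<subseteq> V" "aa \<in> V" "set as \<subseteq> V"
  show "F (a # bs @ aa # aa # as) = 0"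
    using cochain_alt_at[OF assms(1), of "a # bs" aa as] s assms(2) by simp
qed

text \<open>Polarization: expand the value with \<open>a + b\<close> in both leading slots, which is
  0, and drop the two terms with a repeated entry.\<close>

lemma cochain_swap:
  assumes F: "cochain V W p F" and V: "subspace V" and "a \<in> V" "b \<in> V" "set as \<subseteq> V"
  shows "F (a # b # as) = - F (b # a # as)"
proof -
  have ab: "a + b \<in> V" using assms by (simp add: subspace_add)
  have "0 = F ((a + b) # (a + b) # as)"
    using cochain_alt[OF F ab] assms by simp
  also have "\<dots> = F (a # (a + b) # as) + F (b # (a + b) # as)"
    using linear_on_add[OF cochain_linear[OF F, of "(a + b) # as"], of a b] ab assms by simp
  also have "F (a # (a + b) # as) = F (a # a # as) + F (a # b # as)"
    using linear_on_add[OF cochain_linear_at[OF F, of "[a]" as], of a b] assms by simp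
  also have "F (b # (a + b) # as) = F (b # a # as) + F (b # b # as)"
    using linear_on_add[OF cochain_linear_at[OF F, of "[b]" as], of a b] assms by simp
  finally have "0 = F (a # b # as) + F (b # a # as)"
    using cochain_alt[OF F] assms by simp
  then show ?thesis by (simp add: eq_neg_iff_add_eq_0)
qed

lemma cochain_even_cong: "cochain V W p F \<Longrightarrow> even p = even q \<Longrightarrow> cochain V W q F"
  unfolding cochain_def by auto

lemma cochain_lincomb:
  assumes F: "cochain V W p F" and G: "cochain V W p G" and W: "subspace W"
    and eq: "\<And>as. set as \<subseteq> V \<Longrightarrow> K as = F as + c *\<^sub>R G as" and V: "subspace V"
  shows "cochain V W p K"
  unfolding cochain_def
proof (intro conjI allI impI)
  fix as assume as: "set as \<subseteq> V"
  show "K as \<in> W"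
    using as W cochain_mem[OF F as] cochain_mem[OF G as] by (simp add: eq subspace_add subspace_scale)
  show "K as = 0" if "even (length as) \<noteq> even p"
    using that cochain_parity[OF F as] cochain_parity[OF G as] as by (simp add: eq)
next
  fix bs as assume s: "set bs \<subseteq> V" "set as \<subseteq> V"
  have "linear_on V (\<lambda>a. F (bs @ a # as) + c *\<^sub>R G (bs @ a # as))"
    using cochain_linear_at[OF F s] cochain_linear_at[OF G s]
    by (simp add: linear_on_def algebra_simps)
  then show "linear_on V (\<lambda>a. K (bs @ a # as))"
    by (subst linear_on_cong[OF _ V]) (use s in \<open>auto simp: eq\<close>)
next
  fix bs a as assume s: "set bs \<subseteq> V" "a \<in> V" "set as \<subseteq> V"
  show "K (bs @ a # a # as) = 0"
    using cochain_alt_at[OF F s] cochain_alt_at[OF G s] s by (simp add: eq)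
qed

lemma wedge_cong:
  assumes "\<And>x. set x \<subseteq> V \<Longrightarrow> F x = F' x" "\<And>x. set x \<subseteq> V \<Longrightarrow> G x = G' x" "set as \<subseteq> V"
  shows "wedge B F G as = wedge B F' G' as"
  unfolding wedge_def by (rule shuffle_sum_cong) (use assms in auto)

lemma ins_cong:
  assumes "\<And>x. set x \<subseteq> V \<Longrightarrow> X x = X' x" "\<And>x. set x \<subseteq> V \<Longrightarrow> X x \<in> V"
    "\<And>x. set x \<subseteq> V \<Longrightarrow> F x = F' x" "set as \<subseteq> V"
  shows "ins X F as = ins X' F' as"
  unfolding ins_def
proof (rule shuffle_sum_cong)
  fix x y assume "set x \<subseteq> set as" "set y \<subseteq> set as"
  then have "set x \<subseteq> V" "set y \<subseteq> V" using assms(4) by auto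
  then show "F (X x # y) = F' (X' x # y)"
    using assms(1-3) by (metis insert_subset list.simps(15))
qed

lemma wedge_lincomb_right:
  assumes B: "bilinear_into U W Z B" and W: "subspace W"
    and F: "cochain V U f F" and G: "cochain V W g G" and H: "cochain V W h H"
    and K: "\<And>x. set x \<subseteq> V \<Longrightarrow> K x = G x + c *\<^sub>R H x" and as: "set as \<subseteq> V"
  shows "wedge B F K as = wedge B F G as + c *\<^sub>R wedge B F H as"
  unfolding wedge_def shuffle_sum_scale[symmetric] shuffle_sum_add[symmetric]
proof (rule shuffle_sum_cong)
  fix x y assume "set x \<subseteq> set as" "set y \<subseteq> set as"
  then have *: "set x \<subseteq> V" "set y \<subseteq> V" using as by auto
  show "B (F x) (K y) = B (F x) (G y) + c *\<^sub>R B (F x) (H y)"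
    using linear_on_lincomb[OF bilinear_into_right[OF B cochain_mem[OF F *(1)]] W] * cochain_mem[OF G] cochain_mem[OF H] by (simp add: K)
qed

lemma wedge_lincomb_left:
  assumes B: "bilinear_into U W Z B" and U: "subspace U"
    and F: "cochain V W f F" and G: "cochain V U g G" and H: "cochain V U h H"
    and K: "\<And>x. set x \<subseteq> V \<Longrightarrow> K x = G x + c *\<^sub>R H x" and as: "set as \<subseteq> V"
  shows "wedge B K F as = wedge B G F as + c *\<^sub>R wedge B H F as"
  unfolding wedge_def shuffle_sum_scale[symmetric] shuffle_sum_add[symmetric]
proof (rule shuffle_sum_cong)
  fix x y assume "set x \<subseteq> set as" "set y \<subseteq> set as"
  then have *: "set x \<subseteq> V" "set y \<subseteq> V" using as by auto
  show "B (K x) (F y) = B (G x) (F y) + c *\<^sub>R B (H x) (F y)"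
    using linear_on_lincomb[OF bilinear_into_left[OF B cochain_mem[OF F *(2)]] U] * cochain_mem[OF G] cochain_mem[OF H] by (simp add: K)
qed

lemma ins_lincomb_right:
  assumes X: "cochain V V p X"
    and K: "\<And>x. set x \<subseteq> V \<Longrightarrow> K x = G x + c *\<^sub>R H x" and as: "set as \<subseteq> V"
  shows "ins X K as = ins X G as + c *\<^sub>R ins X H as"
  unfolding ins_def shuffle_sum_scale[symmetric] shuffle_sum_add[symmetric]
proof (rule shuffle_sum_cong)
  fix x y assume "set x \<subseteq> set as" "set y \<subseteq> set as"
  then show "K (X x # y) = G (X x # y) + c *\<^sub>R H (X x # y)"
    using cochain_mem[OF X] as by (intro K) (metis insert_subset list.simps(15) order_trans)
qed

lemma ins_lincomb_left:
  assumes F: "cochain V W f F" and V: "subspace V"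
    and X: "cochain V V p X" and Y: "cochain V V q Y"
    and K: "\<And>x. set x \<subseteq> V \<Longrightarrow> K x = X x + c *\<^sub>R Y x" and as: "set as \<subseteq> V"
  shows "ins K F as = ins X F as + c *\<^sub>R ins Y F as"
  unfolding ins_def shuffle_sum_scale[symmetric] shuffle_sum_add[symmetric]
proof (rule shuffle_sum_cong)
  fix x y assume "set x \<subseteq> set as" "set y \<subseteq> set as"
  then have *: "set x \<subseteq> V" "set y \<subseteq> V" using as by auto
  show "F (K x # y) = F (X x # y) + c *\<^sub>R F (Y x # y)"
    using linear_on_lincomb[OF cochain_linear[OF F *(2)] V] * cochain_mem[OF X] cochain_mem[OF Y] by (simp add: K)
qed

text \<open>Contraction is a graded derivation. A head that goes to the right factor has to pass the
  letters \<open>x\<close> of the left one, which gives the sign \<open>(- 1) ^ length x\<close>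
  inside the sum. As \<open>F x\<close> vanishes unless \<open>length x\<close> has the parity of
  \<open>f\<close>, this sign is constant on the summands that matter and can be taken out.\<close>

lemma wedge_Cons:
  assumes F: "cochain V U f F" and B: "bilinear_into U W Z B" and U: "subspace U"
    and G: "cochain V W g G" and as: "set as \<subseteq> V" and a: "a \<in> V"
  shows "wedge B F G (a # as) = wedge B (contract a F) G as + (- 1) ^ f *\<^sub>R wedge B F (contract a G) as"
proof -
  have "shuffle_sum as (\<lambda>x y. (- 1) ^ length x *\<^sub>R B (F x) (G (a # y)))
     = shuffle_sum as (\<lambda>x y. (- 1) ^ f *\<^sub>R B (F x) (G (a # y)))"
  proof (rule shuffle_sum_cong)
    fix x y assume "set x \<subseteq> set as" "set y \<subseteq> set as"
    then have *: "set x \<subseteq> V" "set y \<subseteq> V" using as by auto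
    show "(- 1) ^ length x *\<^sub>R B (F x) (G (a # y)) = (- 1) ^ f *\<^sub>R B (F x) (G (a # y))"
    proof (cases "even (length x) = even f")
      case True
      then have "(- 1 :: real) ^ length x = (- 1) ^ f" by (simp add: minus_one_power_iff)
      then show ?thesis by simp
    next
      case False
      then have "F x = 0" using cochain_parity[OF F *(1)] by simp
      moreover have "B 0 (G (a # y)) = 0"
        using linear_on_0[OF bilinear_into_left[OF B cochain_mem[OF G, of "a # y"]] U] * a by simp
      ultimately show ?thesis by simp
    qed
  qed
  then show ?thesis by (simp add: wedge_def contract_def shuffle_sum_scale)
qed

text \<open>As for products, with one more sign: in the summands where the head goes to
  \<open>F\<close>, it must be exchanged with the inserted value \<open>X x\<close>.\<close>

lemma ins_Cons:
  assumes X: "cochain V V p X" and F: "cochain V W f F" and V: "subspace V"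
    and as: "set as \<subseteq> V" and a: "a \<in> V"
  shows "ins X F (a # as) = ins (contract a X) F as - (- 1) ^ p *\<^sub>R ins X (contract a F) as"
proof -
  have "shuffle_sum as (\<lambda>x y. (- 1) ^ length x *\<^sub>R F (X x # a # y))
     = shuffle_sum as (\<lambda>x y. (- ((- 1) ^ p)) *\<^sub>R F (a # X x # y))"
  proof (rule shuffle_sum_cong)
    fix x y assume "set x \<subseteq> set as" "set y \<subseteq> set as"
    then have *: "set x \<subseteq> V" "set y \<subseteq> V" using as by auto
    have sw: "F (X x # a # y) = - F (a # X x # y)"
      using cochain_swap[OF F V cochain_mem[OF X *(1)] a *(2)] .
    show "(- 1) ^ length x *\<^sub>R F (X x # a # y) = (- ((- 1) ^ p)) *\<^sub>R F (a # X x # y)"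
    proof (cases "even (length x) = even p")
      case True
      then have "(- 1 :: real) ^ length x = (- 1) ^ p" by (simp add: minus_one_power_iff)
      then show ?thesis using sw by simp
    next
      case False
      then have "X x = 0" using cochain_parity[OF X *(1)] by simp
      moreover have "F (0 # a # y) = 0"
        using linear_on_0[OF cochain_linear[OF F] V, of "a # y"] * a by simp
      ultimately show ?thesis using sw by simp
    qed
  qed
  then have "shuffle_sum as (\<lambda>x y. (- 1) ^ length x *\<^sub>R F (X x # a # y))
     = - ((- 1) ^ p *\<^sub>R shuffle_sum as (\<lambda>x y. F (a # X x # y)))"
    unfolding shuffle_sum_scale by simp
  then show ?thesis by (simp add: ins_def contract_def)
qed

lemma contract_lincomb:
  assumes "cochain V W p F" "a \<in> V" "b \<in> V" "set as \<subseteq> V" "subspace V"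
  shows "contract (a + c *\<^sub>R b) F as = contract a F as + c *\<^sub>R contract b F as"
  unfolding contract_def using linear_on_lincomb[OF cochain_linear[OF assms(1,4)]] assms by simp

lemma linear_onI_lincomb:
  assumes "\<And>a b c. a \<in> V \<Longrightarrow> b \<in> V \<Longrightarrow> f (a + c *\<^sub>R b) = f a + c *\<^sub>R f b" and "subspace V"
  shows "linear_on V f"
proof -
  \<comment> \<open>With both vectors 0 and the scalar -1 the hypothesis reads
    \<open>f 0 = f 0 - f 0\<close>.\<close>
  have 0: "f 0 = 0" using assms(1)[of 0 0 "-1"] assms(2) by (simp add: subspace_0)
  show ?thesis
    unfolding linear_on_def
    using assms(1)[where c = 1] assms(1)[where a = 0] 0 assms(2) by (auto simp: subspace_0)
qed

lemma wedge_mem: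
  assumes "bilinear_into U W Z B" "subspace Z"
    "\<And>x. set x \<subseteq> V \<Longrightarrow> F x \<in> U" "\<And>x. set x \<subseteq> V \<Longrightarrow> G x \<in> W" "set as \<subseteq> V"
  shows "wedge B F G as \<in> Z"
  unfolding wedge_def
  by (rule shuffle_sum_mem[OF assms(2)], rule bilinear_into_mem[OF assms(1)])
    (use assms in auto)

lemma ins_mem:
  assumes X: "\<And>x. set x \<subseteq> V \<Longrightarrow> X x \<in> V"
    and F: "\<And>x. set x \<subseteq> V \<Longrightarrow> F x \<in> W" and "subspace W" "set as \<subseteq> V"
  shows "ins X F as \<in> W"
  unfolding ins_def
proof (rule shuffle_sum_mem[OF assms(3)])
  fix x y assume "set x \<subseteq> set as" "set y \<subseteq> set as"
  then show "F (X x # y) \<in> W" using assms(4) X by (intro F) (auto dest: order_trans)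
qed

text \<open>Linearity and alternation at a position behind \<open>bs\<close> are proved by induction
  on \<open>bs\<close>: \<open>wedge_Cons\<close> moves the first entry of \<open>bs\<close> into
  one of the factors, which stay cochains, until the position in question is in front.\<close>

lemma cochain_wedge:
  assumes B: "bilinear_into U W Z B"
    and sp: "subspace V" "subspace U" "subspace W" "subspace Z"
    and F: "cochain V U f F" and G: "cochain V W g G"
  shows "cochain V Z (f + g) (wedge B F G)"
  unfolding cochain_def
proof (intro conjI allI impI)
  fix as assume as: "set as \<subseteq> V"
  show "wedge B F G as \<in> Z"
    by (rule wedge_mem[OF B sp(4) cochain_mem[OF F] cochain_mem[OF G] as])
  show "wedge B F G as = 0" if ne: "even (length as) \<noteq> even (f + g)"
  proof -
    have "wedge B F G as = shuffle_sum as (\<lambda>x y. 0)"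
      unfolding wedge_def
    proof (rule shuffle_sum_cong)
      \<comment> \<open>The lengths of \<open>x\<close> and \<open>y\<close> add up to a number of
        the wrong parity, so one of the two factors is evaluated on a list of the wrong
        parity.\<close>
      fix x y assume "set x \<subseteq> set as" "set y \<subseteq> set as" "length x + length y = length as"
      then have *: "set x \<subseteq> V" "set y \<subseteq> V" "length as = length x + length y" using as by auto
      then have "even (length x) \<noteq> even f \<or> even (length y) \<noteq> even g" using ne by auto
      then have "F x = 0 \<or> G y = 0" using cochain_parity[OF F *(1)] cochain_parity[OF G *(2)] by blast
      then show "B (F x) (G y) = 0"
        using linear_on_0[OF bilinear_into_left[OF B cochain_mem[OF G *(2)]] sp(2)]
          linear_on_0[OF bilinear_into_right[OF B cochain_mem[OF F *(1)]] sp(3)] by auto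
    qed
    then show ?thesis by (simp add: shuffle_sum_0)
  qed
next
  fix bs as assume s: "set bs \<subseteq> V" "set as \<subseteq> V"
  then show "linear_on V (\<lambda>a. wedge B F G (bs @ a # as))"
    using F G
  proof (induction bs arbitrary: F G f g)
    case Nil
    note F = Nil.prems(3) and G = Nil.prems(4)
    show ?case
    proof (rule linear_onI_lincomb[OF _ sp(1)])
      fix a b c assume ab: "a \<in> V" "b \<in> V"
      then have abc: "a + c *\<^sub>R b \<in> V" using sp by (simp add: subspace_add subspace_scale)
      have 1: "wedge B (contract (a + c *\<^sub>R b) F) G as
         = wedge B (contract a F) G as + c *\<^sub>R wedge B (contract b F) G as"
        by (rule wedge_lincomb_left[OF B sp(2) G
           cochain_contract[OF F ab(1)] cochain_contract[OF F ab(2)]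
           contract_lincomb[OF F ab _ sp(1)] s(2)])
      have 2: "wedge B F (contract (a + c *\<^sub>R b) G) as
         = wedge B F (contract a G) as + c *\<^sub>R wedge B F (contract b G) as"
        by (rule wedge_lincomb_right[OF B sp(3) F
           cochain_contract[OF G ab(1)] cochain_contract[OF G ab(2)]
           contract_lincomb[OF G ab _ sp(1)] s(2)])
      show "wedge B F G ([] @ (a + c *\<^sub>R b) # as)
         = wedge B F G ([] @ a # as) + c *\<^sub>R wedge B F G ([] @ b # as)"
        using ab abc s by (simp add: wedge_Cons[OF F B sp(2) G] 1 2 algebra_simps)
    qed
  next
    case (Cons c bs)
    note F = Cons.prems(3) and G = Cons.prems(4)
    have c: "c \<in> V" and bs: "set bs \<subseteq> V" using Cons.prems(1) by auto
    note 1 = Cons.IH[OF bs s(2) cochain_contract[OF F c] G]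
    note 2 = Cons.IH[OF bs s(2) F cochain_contract[OF G c]]
    have "linear_on V (\<lambda>a. wedge B (contract c F) G (bs @ a # as)
        + (- 1) ^ f *\<^sub>R wedge B F (contract c G) (bs @ a # as))"
      using 1 2 by (simp add: linear_on_def algebra_simps)
    then show ?case
      by (subst linear_on_cong[OF _ sp(1)])
       (use bs s c in \<open>auto simp: wedge_Cons[OF F B sp(2) G]\<close>)
  qed
next
  fix bs a as assume s: "set bs \<subseteq> V" "a \<in> V" "set as \<subseteq> V"
  then show "wedge B F G (bs @ a # a # as) = 0"
    using F G
  proof (induction bs arbitrary: F G f g)
    case Nil
    note F = Nil.prems(4) and G = Nil.prems(5)
    note Fa = cochain_contract[OF F s(2)] and Ga = cochain_contract[OF G s(2)]
    have z: "wedge B (contract a (contract a F)) G as = 0"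
    proof -
      have "wedge B (contract a (contract a F)) G as = wedge B (\<lambda>x. 0) G as"
        by (rule wedge_cong[OF _ refl s(3)]) (use s in \<open>simp add: contract_def cochain_alt[OF F]\<close>)
      also have "\<dots> = shuffle_sum as (\<lambda>x y. 0)"
        unfolding wedge_def
        by (rule shuffle_sum_cong, rule linear_on_0[OF bilinear_into_left[OF B] sp(2)])
          (use cochain_mem[OF G] s in auto)
      finally show ?thesis by (simp add: shuffle_sum_0)
    qed
    have z': "wedge B F (contract a (contract a G)) as = 0"
    proof -
      have "wedge B F (contract a (contract a G)) as = wedge B F (\<lambda>x. 0) as"
        by (rule wedge_cong[OF refl _ s(3)]) (use s in \<open>simp add: contract_def cochain_alt[OF G]\<close>)
      also have "\<dots> = shuffle_sum as (\<lambda>x y. 0)"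
        unfolding wedge_def
        by (rule shuffle_sum_cong, rule linear_on_0[OF bilinear_into_right[OF B] sp(3)])
          (use cochain_mem[OF F] s in auto)
      finally show ?thesis by (simp add: shuffle_sum_0)
    qed
    \<comment> \<open>Contracting twice with \<open>a\<close> gives four terms. In two of them one
      factor is contracted twice and vanishes; the two mixed ones have the signs
      \<open>(- 1) ^ Suc f\<close> and \<open>(- 1) ^ f\<close> and cancel.\<close>
    show ?case
      using s by (simp add: wedge_Cons[OF F B sp(2) G]
          wedge_Cons[OF Fa B sp(2) G]
          wedge_Cons[OF F B sp(2) Ga] z z')
  next
    case (Cons c bs)
    note F = Cons.prems(4) and G = Cons.prems(5)
    have c: "c \<in> V" and bs: "set bs \<subseteq> V" using Cons.prems(1) by auto
    show ?case
      using Cons.IH[OF bs s(2,3) cochain_contract[OF F c] G]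
        Cons.IH[OF bs s(2,3) F cochain_contract[OF G c]] bs s c
      by (simp add: wedge_Cons[OF F B sp(2) G])
  qed
qed

text \<open>The inserted value uses up one argument of \<open>F\<close>, so the true degree is
  \<open>p + f - 1\<close>. Its parity is that of \<open>Suc (p + f)\<close>, which is well defined
  also for \<open>p = f = 0\<close>.\<close>

lemma cochain_ins:
  assumes sp: "subspace V" "subspace W"
    and X: "cochain V V p X" and F: "cochain V W f F"
  shows "cochain V W (Suc (p + f)) (ins X F)"
  unfolding cochain_def
proof (intro conjI allI impI)
  fix as assume as: "set as \<subseteq> V"
  show "ins X F as \<in> W"
    by (rule ins_mem[OF cochain_mem[OF X] cochain_mem[OF F] sp(2) as])
  show "ins X F as = 0" if ne: "even (length as) \<noteq> even (Suc (p + f))"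
  proof -
    have "ins X F as = shuffle_sum as (\<lambda>x y. 0)"
      unfolding ins_def
    proof (rule shuffle_sum_cong)
      fix x y assume "set x \<subseteq> set as" "set y \<subseteq> set as" "length x + length y = length as"
      then have *: "set x \<subseteq> V" "set y \<subseteq> V" "length as = length x + length y" using as by auto
      then have "even (length x) \<noteq> even p \<or> even (length (X x # y)) \<noteq> even f" using ne by auto
      then show "F (X x # y) = 0"
        using cochain_parity[OF X *(1)] cochain_parity[OF F, of "X x # y"]
          cochain_mem[OF X *(1)] linear_on_0[OF cochain_linear[OF F *(2)] sp(1)] *
        by auto
    qed
    then show ?thesis by (simp add: shuffle_sum_0)
  qed
next
  fix bs as assume s: "set bs \<subseteq> V" "set as \<subseteq> V"
  then show "linear_on V (\<lambda>a. ins X F (bs @ a # as))"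
    using F X
  proof (induction bs arbitrary: F X f p)
    case Nil
    note F = Nil.prems(3) and X = Nil.prems(4)
    show ?case
    proof (rule linear_onI_lincomb[OF _ sp(1)])
      fix a b c assume ab: "a \<in> V" "b \<in> V"
      then have abc: "a + c *\<^sub>R b \<in> V" using sp by (simp add: subspace_add subspace_scale)
      have 1: "ins (contract (a + c *\<^sub>R b) X) F as
         = ins (contract a X) F as + c *\<^sub>R ins (contract b X) F as"
        by (rule ins_lincomb_left[OF F sp(1)
           cochain_contract[OF X ab(1)] cochain_contract[OF X ab(2)]
           contract_lincomb[OF X ab _ sp(1)] s(2)])
      have 2: "ins X (contract (a + c *\<^sub>R b) F) as
         = ins X (contract a F) as + c *\<^sub>R ins X (contract b F) as"
        by (rule ins_lincomb_right[OF X contract_lincomb[OF F ab _ sp(1)] s(2)])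
      show "ins X F ([] @ (a + c *\<^sub>R b) # as)
         = ins X F ([] @ a # as) + c *\<^sub>R ins X F ([] @ b # as)"
        using ab abc s by (simp add: ins_Cons[OF X F sp(1)] 1 2 algebra_simps)
    qed
  next
    case (Cons c bs)
    note F = Cons.prems(3) and X = Cons.prems(4)
    have c: "c \<in> V" and bs: "set bs \<subseteq> V" using Cons.prems(1) by auto
    note 1 = Cons.IH[OF bs s(2) F cochain_contract[OF X c]]
    note 2 = Cons.IH[OF bs s(2) cochain_contract[OF F c] X]
    have "linear_on V (\<lambda>a. ins (contract c X) F (bs @ a # as)
        - (- 1) ^ p *\<^sub>R ins X (contract c F) (bs @ a # as))"
      using 1 2 by (simp add: linear_on_def algebra_simps)
    then show ?case
      by (subst linear_on_cong[OF _ sp(1)])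
       (use bs s c in \<open>auto simp: ins_Cons[OF X F sp(1)]\<close>)
  qed
next
  fix bs a as assume s: "set bs \<subseteq> V" "a \<in> V" "set as \<subseteq> V"
  then show "ins X F (bs @ a # a # as) = 0"
    using F X
  proof (induction bs arbitrary: F X f p)
    case Nil
    note F = Nil.prems(4) and X = Nil.prems(5)
    note Fa = cochain_contract[OF F s(2)] and Xa = cochain_contract[OF X s(2)]
    have z: "ins (contract a (contract a X)) F as = 0"
    proof -
      have "ins (contract a (contract a X)) F as = ins (\<lambda>x. 0) F as"
        by (rule ins_cong[where V = V, OF _ _ refl s(3)])
          (use s cochain_alt[OF X] subspace_0[OF sp(1)] in \<open>auto simp: contract_def\<close>)
      also have "\<dots> = shuffle_sum as (\<lambda>x y. 0)"
        unfolding ins_def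
        by (rule shuffle_sum_cong, rule linear_on_0[OF cochain_linear[OF F] sp(1)])
          (use s in auto)
      finally show ?thesis by (simp add: shuffle_sum_0)
    qed
    have z': "ins X (contract a (contract a F)) as = 0"
    proof -
      have "ins X (contract a (contract a F)) as = ins X (\<lambda>x. 0) as"
        by (rule ins_cong[OF refl cochain_mem[OF X] _ s(3)])
          (use s in \<open>auto simp add: contract_def cochain_alt[OF F]\<close>)
      then show ?thesis by (simp add: ins_def shuffle_sum_0)
    qed
    show ?case
      using s by (simp add: ins_Cons[OF X F sp(1)] ins_Cons[OF Xa F sp(1)]
          ins_Cons[OF X Fa sp(1)] z z')
  next
    case (Cons c bs)
    note F = Cons.prems(4) and X = Cons.prems(5)
    have c: "c \<in> V" and bs: "set bs \<subseteq> V" using Cons.prems(1) by auto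
    show ?case
      using Cons.IH[OF bs s(2,3) cochain_contract[OF F c] X]
        Cons.IH[OF bs s(2,3) F cochain_contract[OF X c]] bs s c
      by (simp add: ins_Cons[OF X F sp(1)])
  qed
qed

section \<open>The bracket of cochains with values in a Lie algebra\<close>

text \<open>Both sides obey the same recursion under contraction. On the empty list either
  \<open>f\<close> is even and the sign is 1, or \<open>F []\<close> vanishes.\<close>

lemma wedge_swap:
  assumes B: "bilinear_into U W Z B" and sp: "subspace U" "subspace W"
    and F: "cochain V U f F" and G: "cochain V W g G" and as: "set as \<subseteq> V"
  shows "wedge B F G as = (- 1) ^ (f * g) *\<^sub>R wedge (\<lambda>y x. B x y) G F as"
  using as F G
proof (induction as arbitrary: F G f g)
  case Nil
  have "B 0 (G []) = 0" "B (F []) 0 = 0"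
    using linear_on_0[OF bilinear_into_left[OF B] sp(1)] linear_on_0[OF bilinear_into_right[OF B] sp(2)]
      cochain_mem[OF Nil.prems(2)] cochain_mem[OF Nil.prems(3)] by auto
  then have "B (F []) (G []) = (- 1) ^ (f * g) *\<^sub>R B (F []) (G [])"
    using cochain_parity[OF Nil.prems(2), of "[]"] by (auto simp: minus_one_power_iff)
  then show ?case by (simp add: wedge_def)
next
  case (Cons a as)
  note F = Cons.prems(2) and G = Cons.prems(3)
  have a: "a \<in> V" and as: "set as \<subseteq> V" using Cons.prems by auto
  have B': "bilinear_into W U Z (\<lambda>y x. B x y)" using B by (auto simp: bilinear_into_def)
  show ?case
    unfolding wedge_Cons[OF F B sp(1) G as a]
      wedge_Cons[OF G B' sp(2) F as a]
      Cons.IH[OF as cochain_contract[OF F a] G] Cons.IH[OF as F cochain_contract[OF G a]]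
    by (simp add: minus_one_power_iff algebra_simps)
qed

lemma contract_wedge:
  assumes "cochain V U f F" "bilinear_into U W Z B" "subspace U" "cochain V W g G" "set as \<subseteq> V" "a \<in> V"
  shows "contract a (wedge B F G) as
    = wedge B (contract a F) G as + (- 1) ^ f *\<^sub>R wedge B F (contract a G) as"
  unfolding contract_def[of a "wedge B F G"]
  by (rule wedge_Cons[OF assms])

text \<open>A representation stays one after extending the action to cochains. The hypothesis
  \<open>rep\<close> is used on the empty list only; everything else is the derivation rule for
  contraction. With the adjoint action in place of \<open>L\<close> the lemma yields the Jacobi
  identity for products.\<close>

lemma wedge_rep:
  assumes br: "bilinear_into U U U br" and L: "bilinear_into U W W L"
    and rep: "\<And>x y w. x \<in> U \<Longrightarrow> y \<in> U \<Longrightarrow> w \<in> W \<Longrightarrow> L (br x y) w = L x (L y w) - L y (L x w)"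
    and sp: "subspace V" "subspace U" "subspace W"
    and F: "cochain V U f F" and G: "cochain V U g G" and H: "cochain V W h H" and as: "set as \<subseteq> V"
  shows "wedge L (wedge br F G) H as
    = wedge L F (wedge L G H) as - (- 1) ^ (f * g) *\<^sub>R wedge L G (wedge L F H) as"
  using as F G H
proof (induction as arbitrary: F G H f g h)
  case Nil
  note F = Nil.prems(2) and G = Nil.prems(3) and H = Nil.prems(4)
  note m = cochain_mem[OF F, of "[]"] cochain_mem[OF G, of "[]"] cochain_mem[OF H, of "[]"]
  have L0: "w \<in> W \<Longrightarrow> L 0 w = 0" for w
    using linear_on_0[OF bilinear_into_left[OF L] sp(2)] by auto
  have L0': "w \<in> U \<Longrightarrow> L w 0 = 0" for w
    using linear_on_0[OF bilinear_into_right[OF L] sp(3)] by auto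
  \<comment> \<open>A negative sign requires \<open>f\<close> and \<open>g\<close> to be odd, and
    then \<open>F\<close> and \<open>G\<close> vanish on the empty list.\<close>
  have "F [] = 0 \<or> G [] = 0 \<or> (- 1 :: real) ^ (f * g) = 1"
    using cochain_parity[OF F, of "[]"] cochain_parity[OF G, of "[]"] by (auto simp: minus_one_power_iff)
  then show ?case
    using rep[of "F []" "G []" "H []"] m L0 L0' sp
    by (auto simp: wedge_def bilinear_into_mem[OF L])
next
  case (Cons a as)
  note F = Cons.prems(2) and G = Cons.prems(3) and H = Cons.prems(4)
  have a: "a \<in> V" and as: "set as \<subseteq> V" using Cons.prems by auto
  note Fa = cochain_contract[OF F a] and Ga = cochain_contract[OF G a] and Ha = cochain_contract[OF H a]
  note brc = cochain_wedge[OF br sp(1,2,2,2)] and Lc = cochain_wedge[OF L sp(1,2,3,3)]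
  have 1: "wedge L (wedge br F G) H (a # as)
     = (wedge L (wedge br (contract a F) G) H as + (- 1) ^ f *\<^sub>R wedge L (wedge br F (contract a G)) H as)
       + (- 1) ^ (f + g) *\<^sub>R wedge L (wedge br F G) (contract a H) as"
    unfolding wedge_Cons[OF brc[OF F G] L sp(2) H as a]
    by (subst wedge_lincomb_left[OF L sp(2) H brc[OF Fa G]
        brc[OF F Ga] _ as]) (auto simp: contract_wedge[OF F br sp(2) G _ a])
  have 2: "wedge L P (wedge L Q H) (a # as)
     = wedge L (contract a P) (wedge L Q H) as
       + (- 1) ^ p *\<^sub>R (wedge L P (wedge L (contract a Q) H) as
         + (- 1) ^ q *\<^sub>R wedge L P (wedge L Q (contract a H)) as)"
    if P: "cochain V U p P" and Q: "cochain V U q Q" for p q P Q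
    unfolding wedge_Cons[OF P L sp(2) Lc[OF Q H] as a]
    by (subst wedge_lincomb_right[OF L sp(3) P
        Lc[OF cochain_contract[OF Q a] H] Lc[OF Q Ha] _ as]) (auto simp: contract_wedge[OF Q L sp(2) H _ a])
  show ?case
    unfolding 1 2[OF F G] 2[OF G F] Cons.IH[OF as Fa G H] Cons.IH[OF as F Ga H] Cons.IH[OF as F G Ha]
    by (simp add: minus_one_power_iff algebra_simps)
qed

lemma contract_ins:
  assumes "cochain V V p X" "cochain V W f F" "subspace V" "set as \<subseteq> V" "a \<in> V"
  shows "contract a (ins X F) as = ins (contract a X) F as - (- 1) ^ p *\<^sub>R ins X (contract a F) as"
  unfolding contract_def[of a "ins X F"] by (rule ins_Cons[OF assms])

text \<open>\<open>ins X\<close> is a derivation of parity \<open>Suc p\<close>: as a vector field,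
  \<open>X\<close> has degree \<open>p - 1\<close>, because inserting it removes one
  coordinate.\<close>

lemma ins_wedge:
  assumes B: "bilinear_into U W Z B" and sp: "subspace V" "subspace U" "subspace W" "subspace Z"
    and X: "cochain V V p X" and F: "cochain V U f F" and G: "cochain V W g G" and as: "set as \<subseteq> V"
  shows "ins X (wedge B F G) as
    = wedge B (ins X F) G as + (- 1) ^ (Suc p * f) *\<^sub>R wedge B F (ins X G) as"
  using as X F G
proof (induction as arbitrary: X F G p f g)
  case Nil
  note X = Nil.prems(2) and F = Nil.prems(3) and G = Nil.prems(4)
  have x: "X [] \<in> V" using cochain_mem[OF X] by simp
  have *: "X [] = 0 \<or> even p" using cochain_parity[OF X, of "[]"] by auto
  have G0: "G [0] = 0" using linear_on_0[OF cochain_linear[OF G, of "[]"] sp(1)] by simp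
  have F0: "B (F []) 0 = 0"
    using linear_on_0[OF bilinear_into_right[OF B cochain_mem[OF F, of "[]"]] sp(3)] by simp
  show ?case
    using * G0 F0 x wedge_Cons[OF F B sp(2) G, of "[]" "X []"]
    by (auto simp: ins_def wedge_def contract_def minus_one_power_iff)
next
  case (Cons a as)
  note X = Cons.prems(2) and F = Cons.prems(3) and G = Cons.prems(4)
  have a: "a \<in> V" and as: "set as \<subseteq> V" using Cons.prems by auto
  note Xa = cochain_contract[OF X a] and Fa = cochain_contract[OF F a] and Ga = cochain_contract[OF G a]
  note wc = cochain_wedge[OF B sp] and ic = cochain_ins[OF sp(1)]
  note XF = ic[OF sp(2) X F] and XG = ic[OF sp(3) X G]
  have 1: "ins X (wedge B F G) (a # as) = ins (contract a X) (wedge B F G) as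
     - (- 1) ^ p *\<^sub>R (ins X (wedge B (contract a F) G) as + (- 1) ^ f *\<^sub>R ins X (wedge B F (contract a G)) as)"
    unfolding ins_Cons[OF X wc[OF F G] sp(1) as a]
    by (subst ins_lincomb_right[OF X _ as]) (auto simp: contract_wedge[OF F B sp(2) G _ a])
  have 2: "wedge B (ins X F) G (a # as)
     = (wedge B (ins (contract a X) F) G as + (- ((- 1) ^ p)) *\<^sub>R wedge B (ins X (contract a F)) G as)
       + (- 1) ^ (Suc (p + f)) *\<^sub>R wedge B (ins X F) (contract a G) as"
    unfolding wedge_Cons[OF XF B sp(2) G as a]
    by (subst wedge_lincomb_left[OF B sp(2) G ic[OF sp(2) Xa F]
        ic[OF sp(2) X Fa] _ as, where c = "- ((- 1) ^ p)"])
      (auto simp: contract_ins[OF X F sp(1) _ a])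
  have 3: "wedge B F (ins X G) (a # as)
     = wedge B (contract a F) (ins X G) as + (- 1) ^ f *\<^sub>R
        (wedge B F (ins (contract a X) G) as + (- ((- 1) ^ p)) *\<^sub>R wedge B F (ins X (contract a G)) as)"
    unfolding wedge_Cons[OF F B sp(2) XG as a]
    by (subst wedge_lincomb_right[OF B sp(3) F ic[OF sp(3) Xa G]
        ic[OF sp(3) X Ga] _ as, where c = "- ((- 1) ^ p)"])
      (auto simp: contract_ins[OF X G sp(1) _ a])
  show ?case
    unfolding 1 2 3 Cons.IH[OF as Xa F G] Cons.IH[OF as X Fa G] Cons.IH[OF as X F Ga]
    by (cases "even p"; cases "even f") (simp_all add: minus_one_power_iff algebra_simps)
qed

text \<open>The graded commutator of two derivations is again of first order, since the terms in
  which both values are inserted into different slots of \<open>F\<close> cancel. What is left is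
  insertion of the graded commutator of the two vector fields.\<close>

lemma ins_commutator:
  assumes sp: "subspace V" "subspace W"
    and X: "cochain V V p X" and Y: "cochain V V q Y" and F: "cochain V W f F" and as: "set as \<subseteq> V"
  shows "ins X (ins Y F) as - (- 1) ^ (Suc p * Suc q) *\<^sub>R ins Y (ins X F) as
    = ins (ins X Y) F as - (- 1) ^ (Suc p * Suc q) *\<^sub>R ins (ins Y X) F as"
  using as X Y F
proof (induction as arbitrary: X Y F p q f)
  case Nil
  note X = Nil.prems(2) and Y = Nil.prems(3) and F = Nil.prems(4)
  have x: "X [] \<in> V" "Y [] \<in> V" using cochain_mem[OF X] cochain_mem[OF Y] by simp_all
  have z: "a \<in> V \<Longrightarrow> F [0, a] = 0" "a \<in> V \<Longrightarrow> F [a, 0] = 0" for a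
    using linear_on_0[OF cochain_linear[OF F, of "[a]"] sp(1)]
      linear_on_0[OF cochain_linear_at[OF F, of "[a]" "[]"] sp(1)] by simp_all
  have *: "ins X (ins Y F) [] = F [Y [X []]] - (- 1) ^ q *\<^sub>R F [X [], Y []]"
    using ins_Cons[OF Y F sp(1), of "[]" "X []"] x by (simp add: ins_def contract_def)
  have **: "ins Y (ins X F) [] = F [X [Y []]] - (- 1) ^ p *\<^sub>R F [Y [], X []]"
    using ins_Cons[OF X F sp(1), of "[]" "Y []"] x by (simp add: ins_def contract_def)
  have "X [] = 0 \<or> even p" "Y [] = 0 \<or> even q"
    using cochain_parity[OF X, of "[]"] cochain_parity[OF Y, of "[]"] by auto
  \<comment> \<open>The second-order terms match because \<open>F\<close> is alternating; if
    \<open>p\<close> or \<open>q\<close> is odd, they contain a zero entry and vanish.\<close>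
  then have "(- 1) ^ q *\<^sub>R F [X [], Y []] = (- 1) ^ (Suc p * Suc q) *\<^sub>R (- 1) ^ p *\<^sub>R F [Y [], X []]"
    using cochain_swap[OF F sp(1) x, of "[]"] z x by (auto simp: minus_one_power_iff)
  then show ?case
    unfolding * ** by (simp add: ins_def scaleR_diff_right)
next
  case (Cons a as)
  note X = Cons.prems(2) and Y = Cons.prems(3) and F = Cons.prems(4)
  have a: "a \<in> V" and as: "set as \<subseteq> V" using Cons.prems by auto
  note Xa = cochain_contract[OF X a] and Ya = cochain_contract[OF Y a] and Fa = cochain_contract[OF F a]
  note ic = cochain_ins[OF sp] and iv = cochain_ins[OF sp(1,1)]
  have 1: "ins P (ins Q F) (a # as) = ins (contract a P) (ins Q F) as
     - (- 1) ^ p *\<^sub>R (ins P (ins (contract a Q) F) as + (- ((- 1) ^ q)) *\<^sub>R ins P (ins Q (contract a F)) as)"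
    if P: "cochain V V p P" and Q: "cochain V V q Q" for P Q p q
    unfolding ins_Cons[OF P ic[OF Q F] sp(1) as a]
    by (subst ins_lincomb_right[OF P _ as, where c = "- ((- 1) ^ q)"])
      (auto simp: contract_ins[OF Q F sp(1) _ a])
  have 2: "ins (ins P Q) F (a # as)
      = (ins (ins (contract a P) Q) F as + (- ((- 1) ^ p)) *\<^sub>R ins (ins P (contract a Q)) F as)
       - (- 1) ^ (Suc (p + q)) *\<^sub>R ins (ins P Q) (contract a F) as"
    if P: "cochain V V p P" and Q: "cochain V V q Q" for P Q p q
    unfolding ins_Cons[OF iv[OF P Q] F sp(1) as a]
    by (subst ins_lincomb_left[OF F sp(1) iv[OF cochain_contract[OF P a] Q]
        iv[OF P cochain_contract[OF Q a]] _ as, where c = "- ((- 1) ^ p)"])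
      (auto simp: contract_ins[OF P Q sp(1) _ a])
  show ?case
    unfolding 1[OF X Y] 1[OF Y X] 2[OF X Y] 2[OF Y X]
      Cons.IH[OF as Xa Y F, unfolded diff_eq_eq] Cons.IH[OF as X Ya F, unfolded diff_eq_eq]
      Cons.IH[OF as X Y Fa, unfolded diff_eq_eq]
    by (cases "even p"; cases "even q") (simp_all add: minus_one_power_iff algebra_simps)
qed

text \<open>The coordinate functions of the odd vector space: a cochain with values in that space
  itself. Multiplying it by \<open>F\<close> through the action gives the vector field that
  \<open>F\<close> induces.\<close>

definition id_cochain :: "'a::zero list \<Rightarrow> 'a" where
  "id_cochain as = (case as of [a] \<Rightarrow> a | _ \<Rightarrow> 0)"

lemma id_cochain_simps [simp]:
  "id_cochain [a] = a" "id_cochain [] = 0" "id_cochain (a # b # as) = 0"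
  by (simp_all add: id_cochain_def)

lemma cochain_id: "subspace V \<Longrightarrow> cochain V V 1 id_cochain"
proof -
  assume V: "subspace V"
  have "bs @ a # as \<noteq> [] \<and> (bs @ a # as = [c] \<longleftrightarrow> bs = [] \<and> as = [] \<and> a = c)" for bs as and a c :: 'a
    by (cases bs) auto
  then have *: "id_cochain (bs @ a # as) = (if bs = [] \<and> as = [] then a else 0)" for bs as and a :: 'a
    by (cases "bs @ a # as" rule: remdups_adj.cases) (auto split: if_splits)
  have "id_cochain as \<in> V" if "set as \<subseteq> V" for as
    using that V by (auto simp: id_cochain_def subspace_0 split: list.splits)
  moreover have "id_cochain as = 0" if "even (length as) \<noteq> even (1::nat)" for as :: "'a list"
    using that by (auto simp: id_cochain_def split: list.splits)
  ultimately show ?thesis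
    unfolding cochain_def * by (auto simp: linear_on_def *)
qed

lemma shuffle_sum_all_left: "shuffle_sum as (\<lambda>x y. if y = [] then G x else 0) = G as"
  by (induction as arbitrary: G) (auto simp: shuffle_sum_0)

text \<open>A vector field applied to the coordinates returns its components: only the summand in
  which \<open>X\<close> takes all arguments survives.\<close>

lemma ins_id: "ins X id_cochain as = X as"
proof -
  have "(\<lambda>x y. id_cochain (X x # y)) = (\<lambda>x y. if y = [] then X x else 0)"
    by (auto simp: fun_eq_iff id_cochain_def split: list.splits)
  then show ?thesis by (simp add: ins_def shuffle_sum_all_left)
qed

text \<open>Instantiated below by sections of \<open>A\<close> acting on sections of the dual.
  Linearity is over the reals here: \<open>L\<close> differentiates coefficients, and linearity over
  functions is treated separately, for the bracket.\<close>

locale lie_representation =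
  fixes U :: "'u::real_vector set" and V :: "'a::real_vector set"
    and br :: "'u \<Rightarrow> 'u \<Rightarrow> 'u" and L :: "'u \<Rightarrow> 'a \<Rightarrow> 'a"
  assumes subspace_U: "subspace U" and subspace_V: "subspace V"
    and br_bilinear: "bilinear_into U U U br" and L_bilinear: "bilinear_into U V V L"
    and br_skew: "x \<in> U \<Longrightarrow> y \<in> U \<Longrightarrow> br y x = - br x y"
    and br_jacobi: "x \<in> U \<Longrightarrow> y \<in> U \<Longrightarrow> z \<in> U \<Longrightarrow> br (br x y) z = br x (br y z) - br y (br x z)"
    and L_rep: "x \<in> U \<Longrightarrow> y \<in> U \<Longrightarrow> v \<in> V \<Longrightarrow> L (br x y) v = L x (L y v) - L y (L x v)"
begin

definition rho :: "('a list \<Rightarrow> 'u) \<Rightarrow> 'a list \<Rightarrow> 'a" where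
  "rho F = wedge L F id_cochain"

text \<open>
  This is the bracket of sections of the action Lie algebroid of \<open>U\<close> on the odd vector space
  \<open>V[1]\<close>: \<open>F\<close> is a \<open>U\<close>-valued function, \<open>rho F\<close> the vector field that it induces, and
  \<open>ins X G\<close> the derivative of \<open>G\<close> along the vector field \<open>X\<close>.
\<close>

definition bracket :: "nat \<Rightarrow> nat \<Rightarrow> ('a list \<Rightarrow> 'u) \<Rightarrow> ('a list \<Rightarrow> 'u) \<Rightarrow> 'a list \<Rightarrow> 'u" where
  "bracket f g F G as =
     ins (rho F) G as - (- 1) ^ (f * g) *\<^sub>R ins (rho G) F as - wedge br F G as"

lemma cochain_rho: "cochain V U f F \<Longrightarrow> cochain V V (Suc f) (rho F)"
  using cochain_wedge[OF L_bilinear subspace_V subspace_U subspace_V subspace_V _ cochain_id[OF subspace_V]]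
  by (simp add: rho_def)

text \<open>The unit that \<open>rho\<close> adds to the degree is lost again by insertion;
  \<open>Suc (Suc f + g)\<close> and \<open>f + g\<close> have the same parity.\<close>

lemma cochain_ins_rho: "cochain V U f F \<Longrightarrow> cochain V U g G \<Longrightarrow> cochain V U (f + g) (ins (rho F) G)"
  by (rule cochain_even_cong[OF cochain_ins[OF subspace_V subspace_U cochain_rho]]) auto

lemma cochain_bracket:
  assumes "cochain V U f F" "cochain V U g G"
  shows "cochain V U (f + g) (bracket f g F G)"
proof -
  have 1: "cochain V U (f + g) (ins (rho F) G)" "cochain V U (f + g) (ins (rho G) F)"
    using cochain_ins_rho[OF assms] cochain_ins_rho[OF assms(2,1)] by (auto simp: add.commute)
  have 2: "cochain V U (f + g) (wedge br F G)"
    using cochain_wedge[OF br_bilinear subspace_V subspace_U subspace_U subspace_U assms] .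
  have "cochain V U (f + g) (\<lambda>as. ins (rho F) G as - (- 1) ^ (f * g) *\<^sub>R ins (rho G) F as)"
    by (rule cochain_lincomb[OF 1 subspace_U _ subspace_V, where c = "- ((- 1) ^ (f * g))"]) simp
  from cochain_lincomb[OF this 2 subspace_U _ subspace_V, where c = "- 1"]
  show ?thesis by (simp add: bracket_def)
qed

lemma wedge_br_swap:
  assumes F: "cochain V U f F" and G: "cochain V U g G" and as: "set as \<subseteq> V"
  shows "wedge br F G as = - ((- 1) ^ (f * g) *\<^sub>R wedge br G F as)"
proof -
  have "wedge br F G as = (- 1) ^ (f * g) *\<^sub>R wedge (\<lambda>y x. br x y) G F as"
    by (rule wedge_swap[OF br_bilinear subspace_U subspace_U assms])
  also have "wedge (\<lambda>y x. br x y) G F as = shuffle_sum as (\<lambda>x y. (- 1) *\<^sub>R br (G x) (F y))"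
    unfolding wedge_def
  proof (rule shuffle_sum_cong)
    fix x y assume "set x \<subseteq> set as" "set y \<subseteq> set as"
    then show "br (F y) (G x) = (- 1) *\<^sub>R br (G x) (F y)"
      using br_skew[OF cochain_mem[OF G, of x] cochain_mem[OF F, of y]] assms(3) by auto
  qed
  also have "\<dots> = - wedge br G F as"
    unfolding shuffle_sum_scale wedge_def by simp
  finally show ?thesis by simp
qed

lemma bracket_skew:
  assumes "cochain V U f F" "cochain V U g G" "set as \<subseteq> V"
  shows "bracket f g F G as = - ((- 1) ^ (f * g) *\<^sub>R bracket g f G F as)"
  unfolding bracket_def wedge_br_swap[OF assms]
  by (cases "even f"; cases "even g") (simp_all add: minus_one_power_iff algebra_simps)

lemma rho_lincomb:
  assumes "cochain V U f F" "cochain V U f G" "\<And>x. set x \<subseteq> V \<Longrightarrow> K x = F x + c *\<^sub>R G x" "set as \<subseteq> V"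
  shows "rho K as = rho F as + c *\<^sub>R rho G as"
  unfolding rho_def
  by (rule wedge_lincomb_left[OF L_bilinear subspace_U cochain_id[OF subspace_V]
        assms(1) assms(2) assms(3,4)])

text \<open>The derivation rule for \<open>rho G\<close>, which is a product of \<open>G\<close>
  with the coordinates. The first summand differentiates the coefficients, the second one the
  coordinates, by \<open>ins_id\<close>.\<close>

lemma ins_rho_rho:
  assumes F: "cochain V U f F" and G: "cochain V U g G" and as: "set as \<subseteq> V"
  shows "ins (rho F) (rho G) as
    = rho (ins (rho F) G) as + (- 1) ^ (f * g) *\<^sub>R wedge L G (rho F) as"
proof -
  have "ins (rho F) (rho G) as = rho (ins (rho F) G) as
    + (- 1) ^ (Suc (Suc f) * g) *\<^sub>R wedge L G (ins (rho F) id_cochain) as"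
    unfolding rho_def[of G] rho_def[of "ins (rho F) G"]
    by (rule ins_wedge[OF L_bilinear subspace_V subspace_U subspace_V subspace_V cochain_rho[OF F] G
          cochain_id[OF subspace_V] as])
  also have "ins (rho F) id_cochain = rho F" by (simp add: fun_eq_iff ins_id)
  finally show ?thesis by (simp add: minus_one_power_iff)
qed

text \<open>The anchor of the action algebroid is a homomorphism. By \<open>ins_rho_rho\<close> the
  right-hand side contains, besides the derivatives of coefficients, the terms
  \<open>wedge L F (rho G)\<close> and \<open>wedge L G (rho F)\<close>; since \<open>L\<close> is a
  representation, these are exactly what \<open>rho (wedge br F G)\<close> contributes on the
  left.\<close>

lemma rho_bracket:
  assumes F: "cochain V U f F" and G: "cochain V U g G" and as: "set as \<subseteq> V"
  shows "rho (bracket f g F G) as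
    = ins (rho F) (rho G) as - (- 1) ^ (f * g) *\<^sub>R ins (rho G) (rho F) as"
proof -
  have 1: "cochain V U (f + g) (ins (rho F) G)" "cochain V U (f + g) (ins (rho G) F)"
    using cochain_ins_rho[OF F G] cochain_ins_rho[OF G F] by (auto simp: add.commute)
  have 2: "cochain V U (f + g) (wedge br F G)"
    using cochain_wedge[OF br_bilinear subspace_V subspace_U subspace_U subspace_U F G] .
  have 3: "cochain V U (f + g) (\<lambda>as. ins (rho F) G as - (- 1) ^ (f * g) *\<^sub>R ins (rho G) F as)"
    by (rule cochain_lincomb[OF 1 subspace_U _ subspace_V, where c = "- ((- 1) ^ (f * g))"]) simp
  have "rho (bracket f g F G) as
     = rho (\<lambda>as. ins (rho F) G as - (- 1) ^ (f * g) *\<^sub>R ins (rho G) F as) as + (- 1) *\<^sub>R rho (wedge br F G) as"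
    by (rule rho_lincomb[OF 3 2 _ as, where c = "- 1"]) (simp add: bracket_def)
  also have "rho (\<lambda>as. ins (rho F) G as - (- 1) ^ (f * g) *\<^sub>R ins (rho G) F as) as
     = rho (ins (rho F) G) as + (- ((- 1) ^ (f * g))) *\<^sub>R rho (ins (rho G) F) as"
    by (rule rho_lincomb[OF 1 _ as]) simp
  also have "rho (wedge br F G) as = wedge L F (rho G) as - (- 1) ^ (f * g) *\<^sub>R wedge L G (rho F) as"
    unfolding rho_def
    by (rule wedge_rep[OF br_bilinear L_bilinear L_rep subspace_V subspace_U subspace_V F G
          cochain_id[OF subspace_V] as])
  finally show ?thesis
    unfolding ins_rho_rho[OF F G as] ins_rho_rho[OF G F as]
    by (cases "even f"; cases "even g") (simp_all add: minus_one_power_iff algebra_simps)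
qed

lemma bracket_lincomb_right:
  assumes F: "cochain V U f F" and G: "cochain V U g G" and H: "cochain V U g H"
    and K: "\<And>x. set x \<subseteq> V \<Longrightarrow> K x = G x + c *\<^sub>R H x" and as: "set as \<subseteq> V"
  shows "bracket f g F K as = bracket f g F G as + c *\<^sub>R bracket f g F H as"
proof -
  have "ins (rho F) K as = ins (rho F) G as + c *\<^sub>R ins (rho F) H as"
    by (rule ins_lincomb_right[OF cochain_rho[OF F] K as])
  moreover have "ins (rho K) F as = ins (rho G) F as + c *\<^sub>R ins (rho H) F as"
    by (rule ins_lincomb_left[OF F subspace_V cochain_rho[OF G]
          cochain_rho[OF H] rho_lincomb[OF G H K] as])
  moreover have "wedge br F K as = wedge br F G as + c *\<^sub>R wedge br F H as"
    by (rule wedge_lincomb_right[OF br_bilinear subspace_U F G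
          H K as])
  ultimately show ?thesis by (simp add: bracket_def algebra_simps)
qed

lemma ins_rho_bracket:
  assumes F: "cochain V U f F" and G: "cochain V U g G" and H: "cochain V U h H" and as: "set as \<subseteq> V"
  shows "ins (rho F) (bracket g h G H) as
    = ins (rho F) (ins (rho G) H) as - (- 1) ^ (g * h) *\<^sub>R ins (rho F) (ins (rho H) G) as
      - wedge br (ins (rho F) G) H as - (- 1) ^ (f * g) *\<^sub>R wedge br G (ins (rho F) H) as"
proof -
  note m = cochain_rho[OF F]
  have "ins (rho F) (bracket g h G H) as
     = ins (rho F) (\<lambda>as. ins (rho G) H as - (- 1) ^ (g * h) *\<^sub>R ins (rho H) G as) as
       + (- 1) *\<^sub>R ins (rho F) (wedge br G H) as"
    by (rule ins_lincomb_right[OF m _ as, where c = "- 1"]) (simp add: bracket_def)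
  also have "ins (rho F) (\<lambda>as. ins (rho G) H as - (- 1) ^ (g * h) *\<^sub>R ins (rho H) G as) as
     = ins (rho F) (ins (rho G) H) as + (- ((- 1) ^ (g * h))) *\<^sub>R ins (rho F) (ins (rho H) G) as"
    by (rule ins_lincomb_right[OF m _ as]) simp
  also have "ins (rho F) (wedge br G H) as
     = wedge br (ins (rho F) G) H as + (- 1) ^ (Suc (Suc f) * g) *\<^sub>R wedge br G (ins (rho F) H) as"
    by (rule ins_wedge[OF br_bilinear subspace_V subspace_U subspace_U subspace_U cochain_rho[OF F] G H as])
  finally show ?thesis by (simp add: minus_one_power_iff)
qed

text \<open>Combines two homomorphism properties: \<open>rho\<close> takes brackets to commutators
  of vector fields, and insertion takes these to commutators of derivations.\<close>

lemma ins_rho_of_bracket: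
  assumes F: "cochain V U f F" and G: "cochain V U g G" and H: "cochain V U h H" and as: "set as \<subseteq> V"
  shows "ins (rho (bracket f g F G)) H as
    = ins (rho F) (ins (rho G) H) as - (- 1) ^ (f * g) *\<^sub>R ins (rho G) (ins (rho F) H) as"
proof -
  note FV = cochain_rho[OF F] and GV = cochain_rho[OF G]
  note iv = cochain_ins[OF subspace_V subspace_V]
  have "ins (rho (bracket f g F G)) H as
     = ins (ins (rho F) (rho G)) H as + (- ((- 1) ^ (f * g))) *\<^sub>R ins (ins (rho G) (rho F)) H as"
    by (rule ins_lincomb_left[OF H subspace_V iv[OF FV GV] iv[OF GV FV] _ as])
      (simp add: rho_bracket[OF F G])
  also have "\<dots> = ins (rho F) (ins (rho G) H) as
     - (- 1) ^ (Suc (Suc f) * Suc (Suc g)) *\<^sub>R ins (rho G) (ins (rho F) H) as"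
    using ins_commutator[OF subspace_V subspace_U FV GV H as] by (simp add: minus_one_power_iff)
  finally show ?thesis by (simp add: minus_one_power_iff)
qed

lemma wedge_bracket:
  assumes F: "cochain V U f F" and G: "cochain V U g G" and H: "cochain V U h H" and as: "set as \<subseteq> V"
  shows "wedge br F (bracket g h G H) as
    = wedge br F (ins (rho G) H) as - (- 1) ^ (g * h) *\<^sub>R wedge br F (ins (rho H) G) as
      - wedge br F (wedge br G H) as"
proof -
  note GH = cochain_ins_rho[OF G H]
  have HG: "cochain V U (g + h) (ins (rho H) G)" using cochain_ins_rho[OF H G] by (simp add: add.commute)
  have 2: "cochain V U (g + h) (wedge br G H)"
    using cochain_wedge[OF br_bilinear subspace_V subspace_U subspace_U subspace_U G H] .
  have 3: "cochain V U (g + h) (\<lambda>as. ins (rho G) H as - (- 1) ^ (g * h) *\<^sub>R ins (rho H) G as)"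
    by (rule cochain_lincomb[OF GH HG subspace_U _ subspace_V, where c = "- ((- 1) ^ (g * h))"]) simp
  have "wedge br F (bracket g h G H) as
    = wedge br F (\<lambda>as. ins (rho G) H as - (- 1) ^ (g * h) *\<^sub>R ins (rho H) G as) as
      + (- 1) *\<^sub>R wedge br F (wedge br G H) as"
    by (rule wedge_lincomb_right[OF br_bilinear subspace_U F 3
          2 _ as, where c = "- 1"]) (simp add: bracket_def)
  also have "wedge br F (\<lambda>as. ins (rho G) H as - (- 1) ^ (g * h) *\<^sub>R ins (rho H) G as) as
    = wedge br F (ins (rho G) H) as + (- ((- 1) ^ (g * h))) *\<^sub>R wedge br F (ins (rho H) G) as"
    by (rule wedge_lincomb_right[OF br_bilinear subspace_U F GH
          HG _ as]) simp
  finally show ?thesis by simp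
qed

text \<open>A normal form for double brackets that are nested on the right: second derivatives,
  products of a derivative with a cochain, and one triple product.\<close>

lemma bracket_nested:
  assumes F: "cochain V U f F" and G: "cochain V U g G" and H: "cochain V U h H" and as: "set as \<subseteq> V"
  shows "bracket f (g + h) F (bracket g h G H) as
    = ins (rho F) (ins (rho G) H) as - (- 1) ^ (g * h) *\<^sub>R ins (rho F) (ins (rho H) G) as
      - wedge br (ins (rho F) G) H as - (- 1) ^ (f * g) *\<^sub>R wedge br G (ins (rho F) H) as
      - (- 1) ^ (f * (g + h)) *\<^sub>R
          (ins (rho G) (ins (rho H) F) as - (- 1) ^ (g * h) *\<^sub>R ins (rho H) (ins (rho G) F) as)
      - (wedge br F (ins (rho G) H) as - (- 1) ^ (g * h) *\<^sub>R wedge br F (ins (rho H) G) as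
      - wedge br F (wedge br G H) as)"
  unfolding bracket_def[of f "g + h"] ins_rho_bracket[OF F G H as] ins_rho_of_bracket[OF G H F as]
    wedge_bracket[OF F G H as] by simp

text \<open>Skew symmetry first turns the bracket that is nested on the left into one nested on the
  right, so that all three double brackets have the same normal form. The second derivatives then
  cancel as in a commutator, the mixed products after being ordered by graded skew symmetry, and the
  triple products by the Jacobi identity of \<open>U\<close>.\<close>

lemma bracket_jacobi:
  assumes F: "cochain V U f F" and G: "cochain V U g G" and H: "cochain V U h H" and as: "set as \<subseteq> V"
  shows "bracket f (g + h) F (bracket g h G H) as
    = bracket (f + g) h (bracket f g F G) H as
      + (- 1) ^ (f * g) *\<^sub>R bracket g (f + h) G (bracket f h F H) as"
proof -
  note w = cochain_wedge[OF br_bilinear subspace_V subspace_U subspace_U subspace_U]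
  have 1: "bracket (f + g) h (bracket f g F G) H as
     = - ((- 1) ^ ((f + g) * h) *\<^sub>R bracket h (f + g) H (bracket f g F G) as)"
    by (rule bracket_skew[OF cochain_bracket[OF F G] H as])
  have s1: "wedge br (ins (rho P) Q) R as = - ((- 1) ^ ((p + q) * r) *\<^sub>R wedge br R (ins (rho P) Q) as)"
    if "cochain V U p P" "cochain V U q Q" "cochain V U r R" for p q r P Q R
    by (rule wedge_br_swap[OF cochain_ins_rho[OF that(1,2)] that(3) as])
  have s2: "wedge br (wedge br F G) H as = - ((- 1) ^ ((f + g) * h) *\<^sub>R wedge br H (wedge br F G) as)"
    by (rule wedge_br_swap[OF w[OF F G] H as])
  have r: "wedge br (wedge br F G) H as
    = wedge br F (wedge br G H) as - (- 1) ^ (f * g) *\<^sub>R wedge br G (wedge br F H) as"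
    by (rule wedge_rep[OF br_bilinear br_bilinear br_jacobi subspace_V subspace_U subspace_U F G H as])
  \<comment> \<open>The Jacobi identity of \<open>U\<close> in the form that eliminates one of the
    three iterated products; the other two are kept as independent terms.\<close>
  have r': "wedge br F (wedge br G H) as
    = (- 1) ^ (f * g) *\<^sub>R wedge br G (wedge br F H) as - ((- 1) ^ ((f + g) * h) *\<^sub>R wedge br H (wedge br F G) as)"
    using r s2 by (simp add: algebra_simps)
  show ?thesis
    unfolding 1 bracket_nested[OF F G H as] bracket_nested[OF H F G as] bracket_nested[OF G F H as]
      s1[OF F G H] s1[OF F H G] s1[OF H F G] s1[OF G F H] r'
    by (cases "even f"; cases "even g"; cases "even h") (simp_all add: minus_one_power_iff algebra_simps)
qed

end

section \<open>Unshuffles\<close>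

text \<open>Describes how a permutation of the tail of a list extends to the whole list: position
  \<open>s\<close> receives the index 0 of the head, and the remaining positions receive the indices
  of the tail, raised by one.\<close>

definition lift_perm :: "nat \<Rightarrow> (nat \<Rightarrow> nat) \<Rightarrow> nat \<Rightarrow> nat" where
  "lift_perm s \<tau> i = (if i = s then 0 else if i < s then Suc (\<tau> i) else Suc (\<tau> (i - 1)))"

lemma lift_perm_permutes:
  assumes "\<tau> permutes {..<n}" "s \<le> n"
  shows "lift_perm s \<tau> permutes {..<Suc n}"
proof (rule inj_imp_permutes)
  have inj: "\<tau> i = \<tau> j \<longleftrightarrow> i = j" for i j using permutes_inj[OF assms(1)] by (auto simp: inj_def)
  show "inj_on (lift_perm s \<tau>) {..<Suc n}"
    by (rule inj_onI) (auto simp: lift_perm_def inj split: if_splits)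
  show "lift_perm s \<tau> i \<in> {..<Suc n}" if "i \<in> {..<Suc n}" for i
    using that assms(2) permutes_in_image[OF assms(1), of i] permutes_in_image[OF assms(1), of "i - 1"]
    by (auto simp: lift_perm_def)
  show "lift_perm s \<tau> i = i" if "i \<notin> {..<Suc n}" for i
    using that assms(2) permutes_not_in[OF assms(1), of "i - 1"] by (auto simp: lift_perm_def)
qed simp

text \<open>For \<open>s = 0\<close> the permutation is a copy of \<open>\<tau>\<close> moved along
  \<open>Suc\<close>. Shifting the value 0 one position to the right is composition with an adjacent
  transposition, and \<open>s\<close> of them are needed.\<close>

lemma sign_lift_perm:
  assumes "\<tau> permutes {..<n}" "s \<le> n"
  shows "sign (lift_perm s \<tau>) = (- 1) ^ s * sign \<tau>"
  using assms(2)
proof (induction s)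
  case 0
  have "lift_perm 0 \<tau> = map_permutation {..<n} Suc \<tau>"
  proof
    fix i
    show "lift_perm 0 \<tau> i = map_permutation {..<n} Suc \<tau> i"
    proof (cases "i \<in> Suc ` {..<n}")
      case True
      then show ?thesis by (auto simp: lift_perm_def map_permutation_apply)
    next
      case False
      then have "i = 0 \<or> i - 1 \<notin> {..<n}" by (cases i) auto
      then show ?thesis using False permutes_not_in[OF assms(1), of "i - 1"]
        by (auto simp: lift_perm_def map_permutation_def restrict_id_def)
    qed
  qed
  then show ?case using sign_map_permutation[of Suc "{..<n}" \<tau>] assms(1) by simp
next
  case (Suc s)
  have eq: "lift_perm (Suc s) \<tau> = lift_perm s \<tau> \<circ> Transposition.transpose s (Suc s)"
    by (auto simp: fun_eq_iff lift_perm_def Transposition.transpose_def)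
  have "permutation (lift_perm s \<tau>)"
    using lift_perm_permutes[OF assms(1), of s] Suc.prems by (metis Suc_leD finite_lessThan permutation_permutes)
  then show ?case
    using Suc by (subst eq, subst sign_compose) (auto simp: permutation_swap_id sign_swap_id)
qed

lemma unshuffles_3:
  "unshuffles [a, b, c] = {\<sigma>. \<sigma> permutes {..<a + b + c} \<and> strict_mono_on {0..<a} \<sigma> \<and>
     strict_mono_on {a..<a + b} \<sigma> \<and> strict_mono_on {a + b..<a + b + c} \<sigma>}"
  by (auto simp: unshuffles_def numeral_3_eq_3 less_Suc_eq all_conj_distrib add.assoc)

lemma unshuffles_2: "unshuffles [a, b] = unshuffles [a, b, 0]"
  unfolding unshuffles_3 by (auto simp: unshuffles_def numeral_2_eq_2 less_Suc_eq all_conj_distrib)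

lemma finite_unshuffles: "finite (unshuffles is)"
  by (rule finite_subset[OF _ finite_permutations[of "{..<sum_list is}"]]) (auto simp: unshuffles_def)

lemma lift_perm_surj:
  assumes "\<sigma> permutes {..<Suc n}" "\<sigma> s = 0" "s \<le> n"
  obtains \<tau> where "\<tau> permutes {..<n}" "\<sigma> = lift_perm s \<tau>"
proof
  \<comment> \<open>Delete position \<open>s\<close> and lower all values by one. The subtraction is
    exact, as the value 0 occurs at \<open>s\<close> only.\<close>
  define \<tau> where "\<tau> = (\<lambda>i. \<sigma> (if i < s then i else Suc i) - 1)"
  have inj: "\<sigma> i = \<sigma> j \<longleftrightarrow> i = j" for i j using permutes_inj[OF assms(1)] by (auto simp: inj_def)
  have pos: "\<sigma> i > 0 \<longleftrightarrow> i \<noteq> s" for i using inj[of i s] assms(2) by auto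
  have *: "\<sigma> (if i < s then i else Suc i) = Suc (\<tau> i)" for i
    using pos[of "if i < s then i else Suc i"] by (auto simp: \<tau>_def)
  show "\<tau> permutes {..<n}"
  proof (rule inj_imp_permutes)
    show "inj_on \<tau> {..<n}"
    proof (rule inj_onI)
      fix i j assume "\<tau> i = \<tau> j"
      then have "\<sigma> (if i < s then i else Suc i) = \<sigma> (if j < s then j else Suc j)" unfolding * by simp
      then show "i = j" unfolding inj by (auto split: if_splits)
    qed
    show "\<tau> i \<in> {..<n}" if "i \<in> {..<n}" for i
      using *[of i] permutes_in_image[OF assms(1), of "if i < s then i else Suc i"] that by auto
    show "\<tau> i = i" if "i \<notin> {..<n}" for i
      using *[of i] permutes_not_in[OF assms(1), of "if i < s then i else Suc i"] that assms(3) by auto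
  qed simp
  show "\<sigma> = lift_perm s \<tau>"
  proof
    fix i
    show "\<sigma> i = lift_perm s \<tau> i"
      using *[of i] *[of "i - 1"] assms(2) by (cases i; cases "i < s"; cases "i = s") (auto simp: lift_perm_def)
  qed
qed

lemma inj_lift_perm: "inj (lift_perm s)"
proof (rule injI)
  fix \<tau> \<tau>' assume eq: "lift_perm s \<tau> = lift_perm s \<tau>'"
  show "\<tau> = \<tau>'"
  proof
    fix i
    show "\<tau> i = \<tau>' i"
      using fun_cong[OF eq, of "if i < s then i else Suc i"] by (auto simp: lift_perm_def split: if_splits)
  qed
qed

text \<open>A common form of the three sums in the bracket formula: the middle block has length 1 in
  the insertion sums, and an empty last block leaves a sum over two blocks.\<close>

definition unshuffle_sum ::
  "nat \<Rightarrow> nat \<Rightarrow> nat \<Rightarrow> ('a list \<Rightarrow> 'a list \<Rightarrow> 'a list \<Rightarrow> 'b::real_vector) \<Rightarrow> 'a list \<Rightarrow> 'b" where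
  "unshuffle_sum a b c H as = (\<Sum>\<sigma>\<in>unshuffles [a, b, c]. real_of_int (sign \<sigma>) *\<^sub>R
     H (map (\<lambda>i. as ! \<sigma> i) [0..<a]) (map (\<lambda>i. as ! \<sigma> i) [a..<a + b])
       (map (\<lambda>i. as ! \<sigma> i) [a + b..<a + b + c]))"

lemma map_lift_perm:
  "q \<le> s \<Longrightarrow> map (\<lambda>i. (x # as) ! lift_perm s \<tau> i) [p..<q] = map (\<lambda>i. as ! \<tau> i) [p..<q]"
  "s \<le> q \<Longrightarrow> map (\<lambda>i. (x # as) ! lift_perm s \<tau> i) [s..<Suc q] = x # map (\<lambda>i. as ! \<tau> i) [s..<q]"
  "s \<le> p \<Longrightarrow> map (\<lambda>i. (x # as) ! lift_perm s \<tau> i) [Suc p..<Suc q] = map (\<lambda>i. as ! \<tau> i) [p..<q]"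
proof -
  show 3: "s \<le> p \<Longrightarrow> map (\<lambda>i. (x # as) ! lift_perm s \<tau> i) [Suc p..<Suc q] = map (\<lambda>i. as ! \<tau> i) [p..<q]" for p
    unfolding map_Suc_upt[symmetric] map_map by (rule map_cong) (auto simp: lift_perm_def)
  show "q \<le> s \<Longrightarrow> map (\<lambda>i. (x # as) ! lift_perm s \<tau> i) [p..<q] = map (\<lambda>i. as ! \<tau> i) [p..<q]"
    by (rule map_cong) (auto simp: lift_perm_def)
  show "s \<le> q \<Longrightarrow> map (\<lambda>i. (x # as) ! lift_perm s \<tau> i) [s..<Suc q] = x # map (\<lambda>i. as ! \<tau> i) [s..<q]"
    by (subst upt_conv_Cons) (simp_all add: 3 lift_perm_def[of s \<tau> s] del: upt_Suc)
qed

lemma strict_mono_on_lift_perm: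
  "q \<le> s \<Longrightarrow> strict_mono_on {p..<q} (lift_perm s \<tau>) \<longleftrightarrow> strict_mono_on {p..<q} \<tau>"
  "strict_mono_on {s..<Suc q} (lift_perm s \<tau>) \<longleftrightarrow> strict_mono_on {s..<q} \<tau>"
  "s \<le> p \<Longrightarrow> strict_mono_on {Suc p..<Suc q} (lift_perm s \<tau>) \<longleftrightarrow> strict_mono_on {p..<q} \<tau>"
proof -
  show "q \<le> s \<Longrightarrow> strict_mono_on {p..<q} (lift_perm s \<tau>) \<longleftrightarrow> strict_mono_on {p..<q} \<tau>"
    by (auto simp: strict_mono_on_def lift_perm_def)
  have "strict_mono_on {Suc p..<Suc q} (lift_perm s \<tau>) \<longleftrightarrow> strict_mono_on {p..<q} \<tau>" if "s \<le> p" for p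
  proof
    assume l: "strict_mono_on {Suc p..<Suc q} (lift_perm s \<tau>)"
    show "strict_mono_on {p..<q} \<tau>"
    proof (rule strict_mono_onI)
      fix i j assume "i \<in> {p..<q}" "j \<in> {p..<q}" "i < j"
      then show "\<tau> i < \<tau> j"
        using strict_mono_onD[OF l, of "Suc i" "Suc j"] that by (auto simp: lift_perm_def)
    qed
  next
    assume l: "strict_mono_on {p..<q} \<tau>"
    show "strict_mono_on {Suc p..<Suc q} (lift_perm s \<tau>)"
    proof (rule strict_mono_onI)
      fix i j assume "i \<in> {Suc p..<Suc q}" "j \<in> {Suc p..<Suc q}" "i < j"
      then show "lift_perm s \<tau> i < lift_perm s \<tau> j"
        using strict_mono_onD[OF l, of "i - 1" "j - 1"] that by (auto simp: lift_perm_def)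
    qed
  qed
  note 3 = this
  show "s \<le> p \<Longrightarrow> strict_mono_on {Suc p..<Suc q} (lift_perm s \<tau>) \<longleftrightarrow> strict_mono_on {p..<q} \<tau>"
    by (rule 3)
  have "strict_mono_on {s..<Suc q} (lift_perm s \<tau>) \<longleftrightarrow> strict_mono_on {Suc s..<Suc q} (lift_perm s \<tau>)"
    by (auto simp: strict_mono_on_def lift_perm_def)
  then show "strict_mono_on {s..<Suc q} (lift_perm s \<tau>) \<longleftrightarrow> strict_mono_on {s..<q} \<tau>"
    using 3[of s] by simp
qed

text \<open>As an unshuffle increases on each block, the index of the head can only stand at the
  beginning of a block, that is at position 0, \<open>a\<close> or \<open>a + b\<close>. Removing it
  leaves an unshuffle of the tail, and the position gives the sign.\<close>

lemma unshuffle_sum_Cons: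
  assumes "a + b + c = Suc n"
  shows "unshuffle_sum a b c H (x # as) =
      (if a = 0 then 0 else unshuffle_sum (a - 1) b c (\<lambda>u. H (x # u)) as)
    + (if b = 0 then 0 else (- 1) ^ a *\<^sub>R unshuffle_sum a (b - 1) c (\<lambda>u v. H u (x # v)) as)
    + (if c = 0 then 0 else (- 1) ^ (a + b) *\<^sub>R unshuffle_sum a b (c - 1) (\<lambda>u v w. H u v (x # w)) as)"
proof -
  let ?U = "unshuffles [a, b, c]"
  let ?t = "\<lambda>\<sigma>. real_of_int (sign \<sigma>) *\<^sub>R
     H (map (\<lambda>i. (x # as) ! \<sigma> i) [0..<a]) (map (\<lambda>i. (x # as) ! \<sigma> i) [a..<a + b])
       (map (\<lambda>i. (x # as) ! \<sigma> i) [a + b..<a + b + c])"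
  define A where "A = {\<sigma> \<in> ?U. a \<noteq> 0 \<and> \<sigma> 0 = 0}"
  define B where "B = {\<sigma> \<in> ?U. b \<noteq> 0 \<and> \<sigma> a = 0}"
  define C where "C = {\<sigma> \<in> ?U. c \<noteq> 0 \<and> \<sigma> (a + b) = 0}"
  have U: "?U = A \<union> B \<union> C"
  proof (rule antisym)
    show "?U \<subseteq> A \<union> B \<union> C"
    proof
      fix \<sigma> assume \<sigma>: "\<sigma> \<in> ?U"
      then have p: "\<sigma> permutes {..<a + b + c}" and m: "strict_mono_on {0..<a} \<sigma>"
        "strict_mono_on {a..<a + b} \<sigma>" "strict_mono_on {a + b..<a + b + c} \<sigma>"
        unfolding unshuffles_3 by auto
      have "0 \<in> \<sigma> ` {..<a + b + c}" unfolding permutes_image[OF p] using assms by auto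
      then obtain s where s: "s < a + b + c" "\<sigma> s = 0" by auto
      consider "s < a" | "a \<le> s" "s < a + b" | "a + b \<le> s" by linarith
      then show "\<sigma> \<in> A \<union> B \<union> C"
      proof cases
        case 1
        then have "s = 0" using strict_mono_onD[OF m(1), of 0 s] s by (cases "s = 0") auto
        then show ?thesis using \<sigma> s 1 by (auto simp: A_def)
      next
        case 2
        then have "s = a" using strict_mono_onD[OF m(2), of a s] s by (cases "s = a") auto
        then show ?thesis using \<sigma> s 2 by (auto simp: B_def)
      next
        case 3
        then have "s = a + b" using strict_mono_onD[OF m(3), of "a + b" s] s by (cases "s = a + b") auto
        then show ?thesis using \<sigma> s 3 by (auto simp: C_def)
      qed
    qed
  qed (auto simp: A_def B_def C_def)
  have inj: "\<sigma> i = \<sigma> j \<longleftrightarrow> i = j" if "\<sigma> \<in> ?U" for \<sigma> i j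
    using that permutes_inj[of \<sigma>] by (auto simp: unshuffles_3 inj_def)
  have disj: "A \<inter> B = {}" "(A \<union> B) \<inter> C = {}"
  proof -
    have "\<sigma> \<notin> B \<and> \<sigma> \<notin> C" if "\<sigma> \<in> A" for \<sigma>
      using that inj[of \<sigma> 0 a] inj[of \<sigma> 0 "a + b"] by (auto simp: A_def B_def C_def)
    moreover have "\<sigma> \<notin> C" if "\<sigma> \<in> B" for \<sigma>
      using that inj[of \<sigma> a "a + b"] by (auto simp: B_def C_def)
    ultimately show "A \<inter> B = {}" "(A \<union> B) \<inter> C = {}" by blast+
  qed
  have fin: "finite A" "finite B" "finite C"
    using finite_unshuffles[of "[a, b, c]"] unfolding U by auto
  have split: "unshuffle_sum a b c H (x # as) = sum ?t A + sum ?t B + sum ?t C"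
    unfolding unshuffle_sum_def U using disj fin by (simp add: sum.union_disjoint)
  \<comment> \<open>Lifting accounts for all permutations with value 0 at \<open>s\<close>;
    \<open>P\<close> stands for monotonicity on the three blocks.\<close>
  have img: "{\<sigma>. \<sigma> permutes {..<Suc n} \<and> P \<sigma> \<and> \<sigma> s = 0}
     = lift_perm s ` {\<tau>. \<tau> permutes {..<n} \<and> P (lift_perm s \<tau>)}" if sn: "s \<le> n" for P s
  proof (rule antisym)
    show "{\<sigma>. \<sigma> permutes {..<Suc n} \<and> P \<sigma> \<and> \<sigma> s = 0}
        \<subseteq> lift_perm s ` {\<tau>. \<tau> permutes {..<n} \<and> P (lift_perm s \<tau>)}"
    proof
      fix \<sigma> assume \<sigma>: "\<sigma> \<in> {\<sigma>. \<sigma> permutes {..<Suc n} \<and> P \<sigma> \<and> \<sigma> s = 0}"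
      then have "\<sigma> permutes {..<Suc n}" "\<sigma> s = 0" by auto
      then obtain \<tau> where "\<tau> permutes {..<n}" "\<sigma> = lift_perm s \<tau>"
        by (rule lift_perm_surj[OF _ _ sn])
      then show "\<sigma> \<in> lift_perm s ` {\<tau>. \<tau> permutes {..<n} \<and> P (lift_perm s \<tau>)}" using \<sigma> by auto
    qed
    show "lift_perm s ` {\<tau>. \<tau> permutes {..<n} \<and> P (lift_perm s \<tau>)}
       \<subseteq> {\<sigma>. \<sigma> permutes {..<Suc n} \<and> P \<sigma> \<and> \<sigma> s = 0}"
      using lift_perm_permutes[OF _ that] by (auto simp: lift_perm_def[of s _ s])
  qed
  have A': "A = lift_perm 0 ` unshuffles [a - 1, b, c]" if "a \<noteq> 0"
  proof -
    obtain a' where a': "a = Suc a'" using \<open>a \<noteq> 0\<close> by (cases a) auto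
    have "A = {\<sigma>. \<sigma> permutes {..<Suc n} \<and> (strict_mono_on {0..<a} \<sigma> \<and>
       strict_mono_on {a..<a + b} \<sigma> \<and> strict_mono_on {a + b..<a + b + c} \<sigma>) \<and> \<sigma> 0 = 0}"
      unfolding A_def unshuffles_3 assms using that by auto
    then show ?thesis
      using assms unfolding img[of 0, simplified] unshuffles_3
      by (simp add: a' strict_mono_on_lift_perm)
  qed
  have B': "B = lift_perm a ` unshuffles [a, b - 1, c]" if "b \<noteq> 0"
  proof -
    obtain b' where b': "b = Suc b'" using \<open>b \<noteq> 0\<close> by (cases b) auto
    have "B = {\<sigma>. \<sigma> permutes {..<Suc n} \<and> (strict_mono_on {0..<a} \<sigma> \<and>
       strict_mono_on {a..<a + b} \<sigma> \<and> strict_mono_on {a + b..<a + b + c} \<sigma>) \<and> \<sigma> a = 0}"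
      unfolding B_def unshuffles_3 assms using that by auto
    moreover have "a \<le> n" using assms b' by simp
    ultimately show ?thesis
      using assms unfolding img[OF \<open>a \<le> n\<close>] unshuffles_3
      by (simp add: b' strict_mono_on_lift_perm)
  qed
  have C': "C = lift_perm (a + b) ` unshuffles [a, b, c - 1]" if "c \<noteq> 0"
  proof -
    obtain c' where c': "c = Suc c'" using \<open>c \<noteq> 0\<close> by (cases c) auto
    have "C = {\<sigma>. \<sigma> permutes {..<Suc n} \<and> (strict_mono_on {0..<a} \<sigma> \<and>
       strict_mono_on {a..<a + b} \<sigma> \<and> strict_mono_on {a + b..<a + b + c} \<sigma>) \<and> \<sigma> (a + b) = 0}"
      unfolding C_def unshuffles_3 assms using that by auto
    moreover have "a + b \<le> n" using assms c' by simp
    ultimately show ?thesis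
      using assms unfolding img[OF \<open>a + b \<le> n\<close>] unshuffles_3
      by (simp add: c' strict_mono_on_lift_perm)
  qed
  have sgn: "real_of_int (sign (lift_perm s \<tau>)) = (- 1) ^ s * real_of_int (sign \<tau>)"
    if "\<tau> \<in> unshuffles [p, q, r]" "p + q + r = n" "s \<le> n" for s \<tau> p q r
  proof -
    have "\<tau> permutes {..<n}" using that(1,2) unfolding unshuffles_3 by auto
    from sign_lift_perm[OF this that(3)] show ?thesis by simp
  qed
  have inj': "inj_on (lift_perm s) X" for s X using inj_lift_perm by (rule inj_on_subset) auto
  have 1: "sum ?t A = (if a = 0 then 0 else unshuffle_sum (a - 1) b c (\<lambda>u. H (x # u)) as)"
  proof (cases a)
    case 0 then show ?thesis by (simp add: A_def)
  next
    case (Suc a')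
    have "sum ?t A = (\<Sum>\<tau>\<in>unshuffles [a', b, c]. ?t (lift_perm 0 \<tau>))"
      using A' Suc by (simp add: sum.reindex[OF inj'])
    also have "\<dots> = unshuffle_sum a' b c (\<lambda>u. H (x # u)) as"
      unfolding unshuffle_sum_def
      by (rule sum.cong[OF refl], subst sgn)
        (use assms in \<open>auto simp: Suc map_lift_perm simp del: upt_Suc\<close>)
    finally show ?thesis by (simp add: Suc)
  qed
  have 2: "sum ?t B = (if b = 0 then 0 else (- 1) ^ a *\<^sub>R unshuffle_sum a (b - 1) c (\<lambda>u v. H u (x # v)) as)"
  proof (cases b)
    case 0 then show ?thesis by (simp add: B_def)
  next
    case (Suc b')
    have "sum ?t B = (\<Sum>\<tau>\<in>unshuffles [a, b', c]. ?t (lift_perm a \<tau>))"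
      using B' Suc by (simp add: sum.reindex[OF inj'])
    also have "\<dots> = (- 1) ^ a *\<^sub>R unshuffle_sum a b' c (\<lambda>u v. H u (x # v)) as"
      unfolding unshuffle_sum_def scaleR_sum_right
      by (rule sum.cong[OF refl], subst sgn)
        (use assms in \<open>auto simp: Suc map_lift_perm simp del: upt_Suc\<close>)
    finally show ?thesis by (simp add: Suc)
  qed
  have 3: "sum ?t C = (if c = 0 then 0 else (- 1) ^ (a + b) *\<^sub>R unshuffle_sum a b (c - 1) (\<lambda>u v w. H u v (x # w)) as)"
  proof (cases c)
    case 0 then show ?thesis by (simp add: C_def)
  next
    case (Suc c')
    have "sum ?t C = (\<Sum>\<tau>\<in>unshuffles [a, b, c']. ?t (lift_perm (a + b) \<tau>))"
      using C' Suc by (simp add: sum.reindex[OF inj'])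
    also have "\<dots> = (- 1) ^ (a + b) *\<^sub>R unshuffle_sum a b c' (\<lambda>u v w. H u v (x # w)) as"
      unfolding unshuffle_sum_def scaleR_sum_right
      by (rule sum.cong[OF refl], subst sgn)
        (use assms in \<open>auto simp: Suc map_lift_perm simp del: upt_Suc\<close>)
    finally show ?thesis by (simp add: Suc)
  qed
  show ?thesis unfolding split 1 2 3 by simp
qed

text \<open>Both sides satisfy the recursion of \<open>unshuffle_sum_Cons\<close>. Splitting twice
  into complementary sublists distributes the letters over three blocks, and the condition on
  lengths selects the prescribed ones.\<close>

lemma unshuffle_sum_eq_shuffle_sum:
  assumes "length as = a + b + c"
  shows "unshuffle_sum a b c H as = shuffle_sum as (\<lambda>u w. shuffle_sum u (\<lambda>x v.
    if length x = a \<and> length v = b \<and> length w = c then H x v w else 0))"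
  using assms
proof (induction as arbitrary: a b c H)
  case Nil
  then have "unshuffles [a, b, c] = {id}"
    by (auto simp: unshuffles_3 strict_mono_on_def)
  then show ?case using Nil by (simp add: unshuffle_sum_def)
next
  case (Cons y as)
  \<comment> \<open>The right-hand side for the tail, with block lengths and summand left free,
    since removing the head changes both.\<close>
  define T where "T = (\<lambda>a b c H. shuffle_sum as (\<lambda>u w. shuffle_sum u (\<lambda>x v.
    if length x = a \<and> length v = b \<and> length w = c then H x v w else (0::'b))))"
  have 1: "shuffle_sum as (\<lambda>u w. shuffle_sum u (\<lambda>x v.
      if length (y # x) = a \<and> length v = b \<and> length w = c then H (y # x) v w else 0))
    = (if a = 0 then 0 else T (a - 1) b c (\<lambda>x. H (y # x)))"
    by (cases a) (auto simp: T_def shuffle_sum_0)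
  have 2: "shuffle_sum as (\<lambda>u w. shuffle_sum u (\<lambda>x v. (- 1) ^ length x *\<^sub>R
      (if length x = a \<and> length (y # v) = b \<and> length w = c then H x (y # v) w else 0)))
    = (if b = 0 then 0 else (- 1) ^ a *\<^sub>R T a (b - 1) c (\<lambda>x v. H x (y # v)))"
  proof (cases b)
    case (Suc b')
    have "shuffle_sum u (\<lambda>x v. (- 1) ^ length x *\<^sub>R
      (if length x = a \<and> length (y # v) = b \<and> length w = c then H x (y # v) w else 0))
      = (- 1) ^ a *\<^sub>R shuffle_sum u (\<lambda>x v.
      if length x = a \<and> length v = b' \<and> length w = c then H x (y # v) w else 0)" for u w
      unfolding shuffle_sum_scale[symmetric] by (rule shuffle_sum_cong) (auto simp: Suc)
    then show ?thesis unfolding T_def by (simp only: shuffle_sum_scale) (simp add: Suc)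
  qed (simp add: shuffle_sum_0)
  have 3: "shuffle_sum as (\<lambda>u w. (- 1) ^ length u *\<^sub>R shuffle_sum u (\<lambda>x v.
      if length x = a \<and> length v = b \<and> length (y # w) = c then H x v (y # w) else 0))
    = (if c = 0 then 0 else (- 1) ^ (a + b) *\<^sub>R T a b (c - 1) (\<lambda>x v w. H x v (y # w)))"
  proof (cases c)
    case (Suc c')
    have "(- 1) ^ length u *\<^sub>R shuffle_sum u (\<lambda>x v.
      if length x = a \<and> length v = b \<and> length (y # w) = c then H x v (y # w) else 0)
      = (- 1) ^ (a + b) *\<^sub>R shuffle_sum u (\<lambda>x v.
      if length x = a \<and> length v = b \<and> length w = c' then H x v (y # w) else 0)" for u w
      unfolding shuffle_sum_scale[symmetric] by (rule shuffle_sum_cong) (auto simp: Suc)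
    then show ?thesis unfolding T_def by (simp only: shuffle_sum_scale) (simp add: Suc)
  qed (simp add: shuffle_sum_0)
  have "shuffle_sum (y # as) (\<lambda>u w. shuffle_sum u (\<lambda>x v.
      if length x = a \<and> length v = b \<and> length w = c then H x v w else 0))
    = (if a = 0 then 0 else T (a - 1) b c (\<lambda>x. H (y # x)))
      + (if b = 0 then 0 else (- 1) ^ a *\<^sub>R T a (b - 1) c (\<lambda>x v. H x (y # v)))
      + (if c = 0 then 0 else (- 1) ^ (a + b) *\<^sub>R T a b (c - 1) (\<lambda>x v w. H x v (y # w)))"
    unfolding 1[symmetric] 2[symmetric] 3[symmetric] by (simp add: shuffle_sum_add)
  moreover have "a + b + c = Suc (length as)" using Cons.prems by simp
  ultimately show ?case
    using Cons.prems by (simp add: unshuffle_sum_Cons Cons.IH T_def)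
qed

lemma unshuffle_sum_2:
  assumes "length as = a + b"
  shows "unshuffle_sum a b 0 (\<lambda>x v w. H x v) as
    = shuffle_sum as (\<lambda>x v. if length x = a \<and> length v = b then H x v else 0)"
proof -
  have "unshuffle_sum a b 0 (\<lambda>x v w. H x v) as = shuffle_sum as (\<lambda>u w. shuffle_sum u (\<lambda>x v.
     if length x = a \<and> length v = b \<and> length w = 0 then H x v else 0))"
    using unshuffle_sum_eq_shuffle_sum[of as a b 0 "\<lambda>x v w. H x v"] assms by simp
  also have "\<dots> = shuffle_sum as (\<lambda>u w. if w = [] then shuffle_sum u (\<lambda>x v.
     if length x = a \<and> length v = b then H x v else 0) else 0)"
    by (rule shuffle_sum_cong) (auto simp: shuffle_sum_0)
  finally show ?thesis by (simp add: shuffle_sum_all_left)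
qed

section \<open>Smooth functions\<close>

text \<open>As \<open>S\<close> is open, the derivative at a point of \<open>S\<close> depends on
  the values in \<open>S\<close> only, so the agreement passes on to all derivatives.\<close>

lemma Ck_on_cong:
  assumes "open S" "\<And>x. x \<in> S \<Longrightarrow> f x = g x" "Ck_on n S f"
  shows "Ck_on n S g"
  using assms(2,3)
proof (induction n arbitrary: f g)
  case 0
  then show ?case using continuous_on_cong[of S S f g] by simp
next
  case (Suc n)
  have f: "(f has_derivative frechet_derivative f (at x)) (at x)" if "x \<in> S" for x
    using Suc.prems(2) that by (simp add: frechet_derivative_works)
  have g: "(g has_derivative frechet_derivative f (at x)) (at x)" if "x \<in> S" for x
    by (rule has_derivative_transform_within_open[OF f[OF that] assms(1) that Suc.prems(1)])
  have "Ck_on n S (\<lambda>x. frechet_derivative g (at x) v)" for v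
    by (rule Suc.IH[of "\<lambda>x. frechet_derivative f (at x) v"])
      (use Suc.prems(2) frechet_derivative_at[OF g] in auto)
  then show ?case using g by (auto intro: differentiableI)
qed

text \<open>Frees the definition from the chosen \<open>frechet_derivative\<close>: any derivative
  that is known explicitly will do.\<close>

lemma Ck_on_SucI:
  assumes "open S" "\<And>x. x \<in> S \<Longrightarrow> (f has_derivative D x) (at x)" "\<And>v. Ck_on n S (\<lambda>x. D x v)"
  shows "Ck_on (Suc n) S f"
proof -
  have "Ck_on n S (\<lambda>x. frechet_derivative f (at x) v)" for v
    by (rule Ck_on_cong[OF assms(1) _ assms(3)[of v]]) (simp add: frechet_derivative_at[OF assms(2)])
  then show ?thesis using assms(2) by (auto intro: differentiableI)
qed

lemma Ck_on_SucD:
  "Ck_on (Suc n) S f \<Longrightarrow> x \<in> S \<Longrightarrow> (f has_derivative frechet_derivative f (at x)) (at x)"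
  unfolding Ck_on.simps frechet_derivative_works by blast

lemma Ck_on_Suc_weaken: "Ck_on (Suc n) S f \<Longrightarrow> Ck_on n S f"
proof (induction n arbitrary: f)
  case 0
  then show ?case
    by (auto simp: continuous_on_eq_continuous_within intro!: differentiable_imp_continuous_within
      intro: differentiable_at_withinI)
next
  case (Suc n)
  have "\<forall>v. Ck_on (Suc n) S (\<lambda>x. frechet_derivative f (at x) v)" "\<forall>x\<in>S. f differentiable (at x)"
    using Suc.prems by simp_all
  then show ?case using Suc.IH by simp
qed

lemma Ck_on_subset: "Ck_on n S f \<Longrightarrow> T \<subseteq> S \<Longrightarrow> Ck_on n T f"
  by (induction n arbitrary: f) (auto intro: continuous_on_subset)

lemma Ck_on_local:
  assumes "\<And>x. x \<in> S \<Longrightarrow> \<exists>T. open T \<and> x \<in> T \<and> Ck_on n (S \<inter> T) f"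
  shows "Ck_on n S f"
  using assms
proof (induction n arbitrary: f)
  case 0
  show ?case
    unfolding Ck_on.simps continuous_on_eq_continuous_within
  proof
    fix x assume "x \<in> S"
    with 0 obtain T where T: "open T" "x \<in> T" "continuous_on (S \<inter> T) f" by auto
    then have "continuous (at x within S \<inter> T) f"
      using \<open>x \<in> S\<close> by (simp add: continuous_on_eq_continuous_within)
    moreover have "at x within S \<inter> T = at x within S"
      using T by (metis at_within_nhd inf_assoc inf_idem open_Int[OF T(1)] Int_commute)
    ultimately show "continuous (at x within S) f" by simp
  qed
next
  case (Suc n)
  have "f differentiable (at x)" if "x \<in> S" for x using Suc.prems[OF that] that by auto
  moreover have "Ck_on n S (\<lambda>x. frechet_derivative f (at x) v)" for v
    by (rule Suc.IH) (use Suc.prems in force)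
  ultimately show ?case by simp
qed

lemma Ck_on_const: "Ck_on n S (\<lambda>x. c)"
proof (induction n arbitrary: c)
  case (Suc n)
  show ?case using Suc[of 0] by (simp add: frechet_derivative_const)
qed simp

lemma Ck_on_bounded_linear:
  assumes "open S" "bounded_linear h" "Ck_on n S f"
  shows "Ck_on n S (\<lambda>x. h (f x))"
  using assms(3)
proof (induction n arbitrary: f)
  case 0
  then show ?case using bounded_linear.continuous_on[OF assms(2)] by auto
next
  case (Suc n)
  show ?case
    by (rule Ck_on_SucI[OF assms(1) bounded_linear.has_derivative[OF assms(2) Ck_on_SucD[OF Suc.prems]]])
      (use Suc in auto)
qed

lemma Ck_on_add:
  assumes "open S" "Ck_on n S f" "Ck_on n S g"
  shows "Ck_on n S (\<lambda>x. f x + g x)"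
  using assms(2,3)
proof (induction n arbitrary: f g)
  case 0
  then show ?case by (auto intro: continuous_on_add)
next
  case (Suc n)
  show ?case
    by (rule Ck_on_SucI[OF assms(1) has_derivative_add[OF Ck_on_SucD[OF Suc.prems(1)] Ck_on_SucD[OF Suc.prems(2)]]])
      (use Suc in auto)
qed

lemma Ck_on_bilinear:
  assumes "open S" "bounded_bilinear h" "Ck_on n S f" "Ck_on n S g"
  shows "Ck_on n S (\<lambda>x. h (f x) (g x))"
  using assms(3,4)
proof (induction n arbitrary: f g)
  case 0
  then show ?case by (auto intro: bounded_bilinear.continuous_on[OF assms(2)])
next
  case (Suc n)
  show ?case
  proof (rule Ck_on_SucI[OF assms(1) bounded_bilinear.FDERIV[OF assms(2) Ck_on_SucD[OF Suc.prems(1)] Ck_on_SucD[OF Suc.prems(2)]]])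
    fix v
    show "Ck_on n S (\<lambda>x. h (f x) (frechet_derivative g (at x) v) + h (frechet_derivative f (at x) v) (g x))"
      by (intro Ck_on_add assms(1) Suc.IH) (use Suc.prems Ck_on_Suc_weaken in auto)
  qed
qed

text \<open>On the line a derivative is multiplication by its value at 1. The chain rule thus
  produces a product, to which \<open>Ck_on_bilinear\<close> applies; composition with functions of
  one variable is what bump functions require.\<close>

lemma Ck_on_compose_real:
  fixes s :: "real \<Rightarrow> real"
  assumes "open S" "open T" "Ck_on n T s" "Ck_on n S u" "u ` S \<subseteq> T"
  shows "Ck_on n S (\<lambda>x. s (u x))"
  using assms(3,4)
proof (induction n arbitrary: s)
  case 0
  then show ?case using continuous_on_compose2[of T s S u] assms(5) by auto
next
  case (Suc n)
  note s = Ck_on_SucD[OF Suc.prems(1)] and u = Ck_on_SucD[OF Suc.prems(2)]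
  show ?case
  proof (rule Ck_on_SucI[OF assms(1)])
    fix x assume x: "x \<in> S"
    then have "u x \<in> T" using assms(5) by auto
    from has_derivative_compose[OF u[OF x] s[OF this]]
    have "((\<lambda>x. s (u x)) has_derivative
       (\<lambda>v. frechet_derivative s (at (u x)) (frechet_derivative u (at x) v))) (at x)" .
    moreover have "(\<lambda>v. frechet_derivative s (at (u x)) (frechet_derivative u (at x) v))
      = (\<lambda>v. frechet_derivative u (at x) v * frechet_derivative s (at (u x)) 1)"
    proof
      interpret bounded_linear "frechet_derivative s (at (u x))"
        using has_derivative_bounded_linear[OF s[OF \<open>u x \<in> T\<close>]] .
      show "frechet_derivative s (at (u x)) (frechet_derivative u (at x) v)
        = frechet_derivative u (at x) v * frechet_derivative s (at (u x)) 1" for v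
        using scaleR[of "frechet_derivative u (at x) v" 1] by simp
    qed
    ultimately show "((\<lambda>x. s (u x)) has_derivative
       (\<lambda>v. frechet_derivative u (at x) v * frechet_derivative s (at (u x)) 1)) (at x)"
by simp
  next
    fix v
    show "Ck_on n S (\<lambda>x. frechet_derivative u (at x) v * frechet_derivative s (at (u x)) 1)"
    proof (rule Ck_on_bilinear[OF assms(1) bounded_bilinear_mult])
      show "Ck_on n S (\<lambda>x. frechet_derivative u (at x) v)" using Suc.prems(2) by simp
      show "Ck_on n S (\<lambda>x. frechet_derivative s (at (u x)) 1)"
        by (rule Suc.IH[OF _ Ck_on_Suc_weaken[OF Suc.prems(2)]]) (use Suc.prems(1) in simp)
    qed
  qed
qed

section \<open>Smooth functions of one real variable\<close>

lemma Ck_on_DERIV: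
  fixes f :: "real \<Rightarrow> real"
  assumes "open S" "\<And>x. x \<in> S \<Longrightarrow> (f has_real_derivative f' x) (at x)" "Ck_on n S f'"
  shows "Ck_on (Suc n) S f"
proof (rule Ck_on_SucI[OF assms(1)])
  show "(f has_derivative (\<lambda>v. f' x * v)) (at x)" if "x \<in> S" for x
    using assms(2)[OF that] by (simp add: has_field_derivative_def)
  show "Ck_on n S (\<lambda>x. f' x * v)" for v
    by (rule Ck_on_bounded_linear[OF assms(1) bounded_linear_mult_left assms(3)])
qed

text \<open>The derivative of a member of this family is a linear combination of two others.
  Smoothness of the classical flat function, the case \<open>n = 0\<close>, thus becomes an
  induction on the order that covers all \<open>n\<close> at once.\<close>

definition flat :: "nat \<Rightarrow> real \<Rightarrow> real" where
  "flat n x = (if x > 0 then (1 / x) ^ n * exp (- (1 / x)) else 0)"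

lemma flat_nonpos: "x \<le> 0 \<Longrightarrow> flat n x = 0"
  and flat_pos: "x > 0 \<Longrightarrow> flat n x = (1 / x) ^ n * exp (- (1 / x))"
  by (simp_all add: flat_def)

text \<open>In terms of the inverse variable this is the decay of \<open>t ^ n / exp t\<close> at
  infinity.\<close>

lemma flat_tendsto_0: "flat n \<midarrow>0\<rightarrow> 0"
proof -
  have "((\<lambda>x::real. x ^ n / exp x) \<longlongrightarrow> 0) at_top" by (rule tendsto_power_div_exp_0)
  from filterlim_compose[OF this filterlim_inverse_at_top_right]
  have "((\<lambda>x::real. inverse x ^ n / exp (inverse x)) \<longlongrightarrow> 0) (at_right 0)" .
  moreover have "\<forall>\<^sub>F x in at_right 0. inverse x ^ n / exp (inverse x) = flat n x"
    using eventually_at_right_less[of "0::real"]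
    by eventually_elim (simp add: flat_def exp_minus field_simps)
  ultimately have 1: "(flat n \<longlongrightarrow> 0) (at_right 0)" by (rule Lim_transform_eventually)
  have "\<forall>\<^sub>F x in at_left 0. 0 = flat n x"
    by (simp add: eventually_at_filter flat_def)
  then have 2: "(flat n \<longlongrightarrow> 0) (at_left 0)" by (rule Lim_transform_eventually[OF tendsto_const])
  show ?thesis using 1 2 by (simp add: filterlim_at_split)
qed

lemma flat_has_derivative:
  "(flat n has_real_derivative flat (n + 2) x + (- real n) * flat (n + 1) x) (at x)"
proof (cases "x > 0")
  case True
  have g: "((\<lambda>x. 1 / x) has_real_derivative - ((1 / x)\<^sup>2)) (at x)"
    using True by (auto intro!: derivative_eq_intros simp: power2_eq_square)
  have "((\<lambda>x. (1 / x) ^ n * exp (- (1 / x))) has_real_derivative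
     real n * (- ((1 / x)\<^sup>2) * (1 / x) ^ (n - Suc 0)) * exp (- (1 / x))
       + exp (- (1 / x)) * (- (- ((1 / x)\<^sup>2))) * (1 / x) ^ n) (at x)"
    by (rule DERIV_mult[OF DERIV_power[OF g] DERIV_fun_exp[OF DERIV_minus[OF g]]])
  then have "((\<lambda>x. (1 / x) ^ n * exp (- (1 / x))) has_real_derivative
     flat (n + 2) x + (- real n) * flat (n + 1) x) (at x)"
  proof (rule DERIV_cong)
    have "real n * (- (y\<^sup>2) * y ^ (n - Suc 0)) * E + E * (- (- (y\<^sup>2))) * y ^ n
        = y ^ (n + 2) * E + (- real n) * (y ^ (n + 1) * E)" for y E :: real
    proof (cases n)
      case (Suc m)
      have "c * (- (y\<^sup>2) * z) * E + E * (- (- (y\<^sup>2))) * (y * z)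
        = (y * z) * y\<^sup>2 * E + (- c) * ((y * z) * y * E)" for c z
        by algebra
      from this[of "real n" "y ^ m"] show ?thesis by (simp only: Suc power_add power_Suc power_one_right diff_Suc_Suc diff_zero)
    qed (simp add: power2_eq_square)
    from this[of "1 / x" "exp (- (1 / x))"]
    show "real n * (- ((1 / x)\<^sup>2) * (1 / x) ^ (n - Suc 0)) * exp (- (1 / x))
       + exp (- (1 / x)) * (- (- ((1 / x)\<^sup>2))) * (1 / x) ^ n = flat (n + 2) x + (- real n) * flat (n + 1) x"
      unfolding flat_pos[OF True] .
  qed
  then show ?thesis
    by (rule has_field_derivative_transform_within_open[of _ _ x "{0<..}"])
       (use True in \<open>simp_all add: flat_pos\<close>)
next
  case False
  show ?thesis
  proof (cases "x = 0")
    case True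
    \<comment> \<open>At 0 the difference quotient of \<open>flat n\<close> is the next member of
      the family, whose limit is already known.\<close>
    have "flat (Suc n) = (\<lambda>h. (flat n (0 + h) - flat n 0) / h)"
      by (simp add: fun_eq_iff flat_def)
    with flat_tendsto_0[of "Suc n"] have "(\<lambda>h. (flat n (0 + h) - flat n 0) / h) \<midarrow>0\<rightarrow> 0"
      by (rule back_subst)
    then have "(flat n has_real_derivative 0) (at 0)" unfolding DERIV_def .
    then show ?thesis using True by (simp add: flat_nonpos)
  next
    case neg: False
    then have "x < 0" using False by simp
    have "(flat n has_real_derivative 0) (at x)"
      by (rule has_field_derivative_transform_within_open[of "\<lambda>x. 0" 0 x "{..<0}"])
        (use \<open>x < 0\<close> in \<open>auto simp: flat_nonpos\<close>)
    then show ?thesis using \<open>x < 0\<close> by (simp add: flat_nonpos)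
  qed
qed

lemma Ck_on_flat: "Ck_on k UNIV (flat n)"
proof (induction k arbitrary: n)
  case 0
  show ?case
    unfolding Ck_on.simps
    by (intro continuous_at_imp_continuous_on ballI DERIV_isCont[OF flat_has_derivative])
next
  case (Suc k)
  show ?case
    by (rule Ck_on_DERIV[OF open_UNIV flat_has_derivative])
      (intro Ck_on_add open_UNIV Suc Ck_on_bounded_linear[OF open_UNIV bounded_linear_mult_right])
qed

text \<open>Again a family that is closed under differentiation up to constants; the reciprocal in
  \<open>smooth_step\<close> is its member \<open>n = 1\<close>.\<close>

lemma Ck_on_inverse_power: "Ck_on k {0<..} (\<lambda>x::real. inverse x ^ n)"
proof (induction k arbitrary: n)
  case 0
  show ?case by (auto intro!: continuous_intros)
next
  case (Suc k)
  show ?case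
  proof (rule Ck_on_DERIV[where f' = "\<lambda>x. - real n * inverse x ^ (n + 1)"])
    show "((\<lambda>x. inverse x ^ n) has_real_derivative - real n * inverse x ^ (n + 1)) (at x)"
      if "x \<in> {0<..}" for x
      using that
      by (intro DERIV_cong[OF DERIV_power[OF DERIV_inverse[of x]]]) (cases n; simp add: algebra_simps)+
    show "Ck_on k {0<..} (\<lambda>x::real. - real n * inverse x ^ (n + 1))"
      by (intro Ck_on_bounded_linear[OF open_greaterThan bounded_linear_mult_right] Suc)
  qed simp
qed

text \<open>The denominator is positive everywhere, because \<open>t\<close> and
  \<open>1 - t\<close> are never both non-positive.\<close>

definition smooth_step :: "real \<Rightarrow> real" where
  "smooth_step t = flat 0 t * inverse (flat 0 t + flat 0 (1 - t))"

lemma smooth_step_0: "t \<le> 0 \<Longrightarrow> smooth_step t = 0"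
  and smooth_step_1: "t \<ge> 1 \<Longrightarrow> smooth_step t = 1"
  by (simp_all add: smooth_step_def flat_def)

lemma smooth_on_step: "smooth_on UNIV smooth_step"
  unfolding smooth_on_def
proof
  fix k
  have c: "Ck_on k UNIV (\<lambda>t::real. 1 - t)"
  proof (cases k)
    case 0
    then show ?thesis by (auto intro: continuous_intros)
  next
    case (Suc j)
    show ?thesis unfolding Suc
      by (rule Ck_on_DERIV[where f' = "\<lambda>_. - 1"]) (auto intro!: derivative_eq_intros Ck_on_const)
  qed
  have "flat 0 t \<ge> 0" "t > 0 \<Longrightarrow> flat 0 t > 0" for t by (auto simp: flat_def)
  then have pos: "flat 0 t + flat 0 (1 - t) > 0" for t
    by (cases "t > 0") (auto intro: add_pos_nonneg add_nonneg_pos)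
  have d: "Ck_on k UNIV (\<lambda>t. flat 0 t + flat 0 (1 - t))"
    by (intro Ck_on_add open_UNIV Ck_on_flat Ck_on_compose_real[OF open_UNIV open_UNIV Ck_on_flat c]) auto
  have "Ck_on k UNIV (\<lambda>t. inverse (flat 0 t + flat 0 (1 - t)))"
    using Ck_on_compose_real[OF open_UNIV _ Ck_on_inverse_power[of k 1] d] pos by auto
  then show "Ck_on k UNIV smooth_step"
    unfolding smooth_step_def[abs_def]
    by (intro Ck_on_bilinear[OF open_UNIV bounded_bilinear_mult Ck_on_flat])
qed

section \<open>Finite-dimensional inner product spaces\<close>

text \<open>Orthogonality enters through the expansion formula. In dimension 0 the empty set is such
  a basis, so this case needs no separate treatment.\<close>

definition orthonormal_basis :: "'a::real_inner set \<Rightarrow> bool" where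
  "orthonormal_basis B \<longleftrightarrow> finite B \<and> (\<forall>b\<in>B. norm b = 1) \<and> (\<forall>x. (\<Sum>b\<in>B. (b \<bullet> x) *\<^sub>R b) = x)"

lemma orthonormal_basis_exists:
  assumes "finite_dimensional TYPE('a::real_inner)"
  shows "\<exists>B::'a set. orthonormal_basis B"
proof -
  obtain B0 :: "'a set" where B0: "finite B0" "span B0 = UNIV"
    using assms by (auto simp: finite_dimensional_def)
  obtain C :: "'a set" where C: "finite C" "span C = UNIV" "pairwise orthogonal C"
    using basis_orthogonal[OF B0(1)] B0(2) by auto
  define D where "D = (\<lambda>c. c /\<^sub>R norm c) ` (C - {0})"
  have fin: "finite D" using C(1) by (simp add: D_def)
  have unit: "norm d = 1" if "d \<in> D" for d
  proof -
    from that[unfolded D_def] obtain c where "d = c /\<^sub>R norm c" "c \<in> C - {0}" by (rule imageE)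
    then show ?thesis by simp
  qed
  have orth: "d \<bullet> e = (if d = e then 1 else 0)" if de: "d \<in> D" "e \<in> D" for d e
  proof -
    obtain c c' where c: "c \<in> C" "c' \<in> C" "d = c /\<^sub>R norm c" "e = c' /\<^sub>R norm c'"
      using de by (auto simp: D_def)
    show ?thesis
    proof (cases "d = e")
      case True
      then show ?thesis using unit[OF de(1)] by (simp add: norm_eq_1)
    next
      case False
      then have "c \<noteq> c'" using c by auto
      then have "c \<bullet> c' = 0" using C(3) c by (auto simp: pairwise_def orthogonal_def)
      then show ?thesis using False c by simp
    qed
  qed
  have "C \<subseteq> span D"
  proof
    fix c assume "c \<in> C"
    show "c \<in> span D"
    proof (cases "c = 0")
      case False
      then have "c /\<^sub>R norm c \<in> span D" using \<open>c \<in> C\<close> by (auto simp: D_def intro: span_base)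
      from span_scale[OF this, of "norm c"] show ?thesis using False by simp
    qed (simp add: span_zero)
  qed
  then have "span C \<subseteq> span D" by (simp add: span_minimal)
  then have sp: "span D = UNIV" using C(2) by auto
  have "(\<Sum>b\<in>D. (b \<bullet> x) *\<^sub>R b) = x" for x
  proof -
    \<comment> \<open>The remainder of the expansion is orthogonal to \<open>D\<close>, hence to
      \<open>span D = UNIV\<close>, and in particular to itself.\<close>
    define y where "y = x - (\<Sum>b\<in>D. (b \<bullet> x) *\<^sub>R b)"
    have "orthogonal y d" if "d \<in> D" for d
    proof -
      have "(\<Sum>b\<in>D. (b \<bullet> x) * (b \<bullet> d)) = (\<Sum>b\<in>D. if b = d then d \<bullet> x else 0)"
        by (rule sum.cong) (auto simp: orth that)
      then show ?thesis
        using that fin by (simp add: y_def orthogonal_def inner_diff_left inner_sum_left inner_commute[of x d])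
    qed
    then have "orthogonal y y" using orthogonal_to_span[of y D y] sp by auto
    then show ?thesis by (simp add: y_def orthogonal_def)
  qed
  then show ?thesis using fin unit unfolding orthonormal_basis_def by blast
qed

text \<open>The ball is a closed subset of the set of linear combinations of an orthonormal basis
  with coefficients bounded by \<open>norm c + r\<close>; the bound is the Cauchy-Schwarz inequality
  for unit vectors. That set is compact by induction on the basis, each step being a continuous
  image of an interval times a compact set.\<close>

lemma compact_cball_finite_dimensional:
  assumes "finite_dimensional TYPE('a::real_inner)"
  shows "compact (cball (c::'a) r)"
proof -
  obtain B :: "'a set" where B: "finite B" "\<forall>b\<in>B. norm b = 1" "\<forall>x. (\<Sum>b\<in>B. (b \<bullet> x) *\<^sub>R b) = x"
    using orthonormal_basis_exists[OF assms] by (auto simp: orthonormal_basis_def)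
  define K where "K = (\<lambda>B::'a set. {\<Sum>b\<in>B. k b *\<^sub>R b | k. \<forall>b\<in>B. \<bar>k b\<bar> \<le> norm c + r})"
  have "compact (K B)"
    using B(1)
  proof (induction B)
    case empty
    then show ?case by (simp add: K_def)
  next
    case (insert b B)
    have "K (insert b B) = (\<lambda>(t, x). t *\<^sub>R b + x) ` ({- (norm c + r)..norm c + r} \<times> K B)"
    proof (rule antisym; rule subsetI)
      fix x assume "x \<in> K (insert b B)"
      then obtain k where "\<forall>b\<in>insert b B. \<bar>k b\<bar> \<le> norm c + r" "x = (\<Sum>b\<in>insert b B. k b *\<^sub>R b)"
        by (auto simp: K_def)
      then show "x \<in> (\<lambda>(t, x). t *\<^sub>R b + x) ` ({- (norm c + r)..norm c + r} \<times> K B)"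
        using insert.hyps by (intro image_eqI[of _ _ "(k b, \<Sum>b\<in>B. k b *\<^sub>R b)"]) (auto simp: K_def abs_le_iff)
    next
      fix x assume "x \<in> (\<lambda>(t, x). t *\<^sub>R b + x) ` ({- (norm c + r)..norm c + r} \<times> K B)"
      then obtain t y where ty: "t \<in> {- (norm c + r)..norm c + r}" "y \<in> K B" "x = t *\<^sub>R b + y"
        by (auto simp del: atLeastAtMost_iff)
      then obtain k where tk: "\<bar>t\<bar> \<le> norm c + r" "\<forall>b\<in>B. \<bar>k b\<bar> \<le> norm c + r"
        "x = t *\<^sub>R b + (\<Sum>b\<in>B. k b *\<^sub>R b)"
        unfolding K_def by (auto simp: abs_le_iff)
      have "(\<Sum>d\<in>B. (k(b := t)) d *\<^sub>R d) = (\<Sum>d\<in>B. k d *\<^sub>R d)"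
        using insert.hyps by (intro sum.cong) auto
      then have "x = (\<Sum>d\<in>insert b B. (k(b := t)) d *\<^sub>R d)"
        using insert.hyps tk by simp
      moreover have "\<forall>a\<in>insert b B. \<bar>(k(b := t)) a\<bar> \<le> norm c + r" using tk by auto
      ultimately show "x \<in> K (insert b B)" unfolding K_def by blast
    qed
    moreover have "compact \<dots>"
      by (rule compact_continuous_image)
        (auto intro!: continuous_intros compact_Times insert.IH simp: case_prod_beta)
    ultimately show ?case by simp
  qed
  note compact = this
  have "cball c r \<subseteq> K B"
  proof
    fix x assume "x \<in> cball c r"
    then have "norm x \<le> norm c + r"
      using norm_triangle_ineq[of c "x - c"] by (simp add: dist_norm norm_minus_commute)
    then have "\<forall>b\<in>B. \<bar>b \<bullet> x\<bar> \<le> norm c + r"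
      using order_trans[OF Cauchy_Schwarz_ineq2[of _ x]] B(2) by simp
    moreover have "x = (\<Sum>b\<in>B. (b \<bullet> x) *\<^sub>R b)" using B(3) by simp
    ultimately show "x \<in> K B" unfolding K_def by (intro CollectI exI[of _ "\<lambda>b. b \<bullet> x"]) simp
  qed
  then have "K B \<inter> cball c r = cball c r" by blast
  then show ?thesis using compact_Int_closed[OF compact closed_cball[of c r]] by simp
qed

section \<open>Smooth functions on manifolds\<close>

lemma chart_facts:
  assumes "smooth_manifold M" "(U, \<phi>) \<in> charts M"
  shows chart_open: "open U" and chart_image_open: "open (\<phi> ` U)"
    and chart_homeo: "homeomorphism U (\<phi> ` U) \<phi> (inv_into U \<phi>)" and chart_inj: "inj_on \<phi> U"
proof -
  show "open U" "open (\<phi> ` U)" and h: "homeomorphism U (\<phi> ` U) \<phi> (inv_into U \<phi>)"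
    using assms unfolding smooth_manifold_def by blast+
  show "inj_on \<phi> U"
    using h by (metis homeomorphism_def inj_on_inverseI)
qed

lemma chart_at:
  assumes "smooth_manifold M"
  obtains U \<phi> where "(U, \<phi>) \<in> charts M" "p \<in> U"
proof -
  have "p \<in> (\<Union>(U, \<phi>)\<in>charts M. U)" using assms by (simp add: smooth_manifold_def)
  then show ?thesis using that by blast
qed

lemma chart_transition:
  assumes M: "smooth_manifold M" and "(U, \<phi>) \<in> charts M" "(V, \<psi>) \<in> charts M"
  shows "smooth_on (\<phi> ` (U \<inter> V)) (\<lambda>x. \<psi> (inv_into U \<phi> x))"
proof -
  have "\<forall>(U, \<phi>)\<in>charts M. \<forall>(V, \<psi>)\<in>charts M. smooth_on (\<phi> ` (U \<inter> V)) (\<lambda>x. \<psi> (inv_into U \<phi> x))"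
    using M by (simp add: smooth_manifold_def)
  then show ?thesis using assms(2,3) by blast
qed

lemma open_chart_image:
  assumes "smooth_manifold M" "(U, \<phi>) \<in> charts M" "open W"
  shows "open (\<phi> ` (U \<inter> W))"
proof -
  note c = chart_facts[OF assms(1,2)]
  have "openin (top_of_set (\<phi> ` U)) (\<phi> ` (U \<inter> W))"
    by (rule homeomorphism_imp_open_map[OF c(3)]) (use assms(3) in \<open>auto simp: openin_open\<close>)
  then show ?thesis using c(2) by (simp add: openin_open_eq)
qed

lemma inv_chart_mem: "inj_on \<phi> U \<Longrightarrow> x \<in> \<phi> ` (U \<inter> W) \<Longrightarrow> inv_into U \<phi> x \<in> U \<inter> W"
  by (auto simp: inv_into_f_f)

lemma mfd_smooth_onD:
  "mfd_smooth_on M W f \<Longrightarrow> (U, \<phi>) \<in> charts M \<Longrightarrow> Ck_on n (\<phi> ` (U \<inter> W)) (\<lambda>x. f (inv_into U \<phi> x))"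
  by (auto simp: mfd_smooth_on_def smooth_on_def)

lemma mfd_smooth_onI:
  "(\<And>U \<phi> n. (U, \<phi>) \<in> charts M \<Longrightarrow> Ck_on n (\<phi> ` (U \<inter> W)) (\<lambda>x. f (inv_into U \<phi> x)))
    \<Longrightarrow> mfd_smooth_on M W f"
  by (auto simp: mfd_smooth_on_def smooth_on_def)

lemma mfd_smooth_on_cong:
  assumes M: "smooth_manifold M" and W: "open W" and eq: "\<And>p. p \<in> W \<Longrightarrow> f p = g p"
    and f: "mfd_smooth_on M W f"
  shows "mfd_smooth_on M W g"
proof (rule mfd_smooth_onI)
  fix U \<phi> n assume c: "(U, \<phi>) \<in> charts M"
  show "Ck_on n (\<phi> ` (U \<inter> W)) (\<lambda>x. g (inv_into U \<phi> x))"
    by (rule Ck_on_cong[OF open_chart_image[OF M c W] _ mfd_smooth_onD[OF f c]])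
      (use inv_chart_mem[OF chart_inj[OF M c]] in \<open>auto simp: eq\<close>)
qed

lemma mfd_smooth_on_subset: "mfd_smooth_on M W f \<Longrightarrow> W' \<subseteq> W \<Longrightarrow> mfd_smooth_on M W' f"
  by (rule mfd_smooth_onI, rule Ck_on_subset[OF mfd_smooth_onD]) auto

lemma mfd_smooth_on_local:
  assumes M: "smooth_manifold M"
    and loc: "\<And>p. p \<in> W \<Longrightarrow> \<exists>N. open N \<and> p \<in> N \<and> mfd_smooth_on M (W \<inter> N) f"
  shows "mfd_smooth_on M W f"
proof (rule mfd_smooth_onI, rule Ck_on_local)
  fix U \<phi> n x assume c: "(U, \<phi>) \<in> charts M" and "x \<in> \<phi> ` (U \<inter> W)"
  then obtain p where p: "p \<in> U" "p \<in> W" "x = \<phi> p" by auto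
  then obtain N where N: "open N" "p \<in> N" "mfd_smooth_on M (W \<inter> N) f" using loc by blast
  have "\<phi> ` (U \<inter> W) \<inter> \<phi> ` (U \<inter> N) \<subseteq> \<phi> ` (U \<inter> (W \<inter> N))"
    using chart_inj[OF M c] by (auto dest: inj_onD)
  then have "Ck_on n (\<phi> ` (U \<inter> W) \<inter> \<phi> ` (U \<inter> N)) (\<lambda>x. f (inv_into U \<phi> x))"
    by (rule Ck_on_subset[OF mfd_smooth_onD[OF N(3) c]])
  then show "\<exists>T. open T \<and> x \<in> T \<and> Ck_on n (\<phi> ` (U \<inter> W) \<inter> T) (\<lambda>x. f (inv_into U \<phi> x))"
    using open_chart_image[OF M c N(1)] p N(2) by blast
qed

lemma mfd_smooth_on_const: "mfd_smooth_on M W (\<lambda>p. c)"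
  by (rule mfd_smooth_onI) (rule Ck_on_const)

lemma mfd_smooth_on_bounded_linear:
  assumes "smooth_manifold M" "open W" "bounded_linear h" "mfd_smooth_on M W f"
  shows "mfd_smooth_on M W (\<lambda>p. h (f p))"
  by (rule mfd_smooth_onI, rule Ck_on_bounded_linear[OF open_chart_image[OF assms(1) _ assms(2)]
      assms(3) mfd_smooth_onD[OF assms(4)]])

lemma mfd_smooth_on_add:
  assumes "smooth_manifold M" "open W" "mfd_smooth_on M W f" "mfd_smooth_on M W g"
  shows "mfd_smooth_on M W (\<lambda>p. f p + g p)"
  by (rule mfd_smooth_onI, rule Ck_on_add[OF open_chart_image[OF assms(1) _ assms(2)]
      mfd_smooth_onD[OF assms(3)] mfd_smooth_onD[OF assms(4)]])

lemma mfd_smooth_on_bilinear: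
  assumes "smooth_manifold M" "open W" "bounded_bilinear h" "mfd_smooth_on M W f" "mfd_smooth_on M W g"
  shows "mfd_smooth_on M W (\<lambda>p. h (f p) (g p))"
  by (rule mfd_smooth_onI, rule Ck_on_bilinear[OF open_chart_image[OF assms(1) _ assms(2)]
      assms(3) mfd_smooth_onD[OF assms(4)] mfd_smooth_onD[OF assms(5)]])

lemma mfd_smooth_on_sum:
  assumes "smooth_manifold M" "open W" "\<And>i. i \<in> I \<Longrightarrow> mfd_smooth_on M W (f i)"
  shows "mfd_smooth_on M W (\<lambda>p. \<Sum>i\<in>I. f i p)"
  using assms(3)
proof (induction I rule: infinite_finite_induct)
  case (insert i I)
  then show ?case using mfd_smooth_on_add[OF assms(1,2), of "f i" "\<lambda>p. \<Sum>i\<in>I. f i p"] by simp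
qed (auto intro: mfd_smooth_on_const)

lemmas mfd_smooth_on_scaleR = mfd_smooth_on_bilinear[OF _ _ bounded_bilinear_scaleR]
lemmas mfd_smooth_on_mult = mfd_smooth_on_bilinear[OF _ _ bounded_bilinear_mult]

text \<open>A smooth step of the squared distance in a chart. Besides the neighbourhood
  \<open>N\<close> where the function is 1, the closed set \<open>K\<close> inside \<open>W\<close>
  is needed: off \<open>K\<close> the function is 0, which allows objects over \<open>W\<close> to
  be extended by zero.\<close>

lemma bump_function:
  assumes M: "smooth_manifold (M :: ('m::{t2_space,second_countable_topology}, 'e::real_inner, 'z) manifold_scheme)"
    and W: "open W" "p \<in> W"
  obtains \<theta> N K where "\<theta> \<in> smooth_functions M" "open N" "p \<in> N" "N \<subseteq> W" "closed K" "K \<subseteq> W"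
    "\<And>q. q \<in> N \<Longrightarrow> \<theta> q = 1" "\<And>q. q \<notin> K \<Longrightarrow> \<theta> q = 0"
proof -
  obtain U \<phi> where c: "(U, \<phi>) \<in> charts M" and pU: "p \<in> U"
    by (rule chart_at[OF M])
  note cf = chart_facts[OF M c]
  have fd: "finite_dimensional TYPE('e)" using M by (simp add: smooth_manifold_def)
  have "open (\<phi> ` (U \<inter> W))" by (rule open_chart_image[OF M c W(1)])
  then obtain r where r: "r > 0" "cball (\<phi> p) r \<subseteq> \<phi> ` (U \<inter> W)"
    using pU W(2) open_contains_cball by (metis IntI imageI)
  \<comment> \<open>Scaled such that \<open>2 - d q\<close> is at least 1 at distance
    \<open>r / sqrt 2\<close> or less and at most 0 at distance \<open>r\<close> or more. The
    squared norm is used because it is smooth at the centre as well.\<close>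
  define d where "d = (\<lambda>q. 2 / r\<^sup>2 * ((\<phi> q - \<phi> p) \<bullet> (\<phi> q - \<phi> p)))"
  define \<theta> where "\<theta> = (\<lambda>q. if q \<in> U then smooth_step (2 - d q) else 0)"
  define K where "K = inv_into U \<phi> ` cball (\<phi> p) r"
  define N where "N = U \<inter> \<phi> -` ball (\<phi> p) (r / sqrt 2)"
  have dq: "d q = 2 * (dist (\<phi> p) (\<phi> q) / r)\<^sup>2" for q
  proof -
    have "dist (\<phi> p) (\<phi> q) = norm (\<phi> q - \<phi> p)" by (simp add: dist_norm norm_minus_commute)
    then show ?thesis by (simp add: d_def power_divide power2_norm_eq_inner)
  qed
  have "continuous_on U \<phi>" by (rule homeomorphism_cont1[OF cf(3)])
  then have "open N" unfolding N_def using cf(1) continuous_open_preimage[of U \<phi>] by simp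
  have sub: "cball (\<phi> p) r \<subseteq> \<phi> ` U" using r(2) by auto
  have "continuous_on (cball (\<phi> p) r) (inv_into U \<phi>)"
    by (rule continuous_on_subset[OF homeomorphism_cont2[OF cf(3)] sub])
  then have "compact K"
    unfolding K_def by (rule compact_continuous_image[OF _ compact_cball_finite_dimensional[OF fd]])
  \<comment> \<open>The manifold is Hausdorff, so \<open>K\<close> is closed in all of it and not
    merely in the chart; this makes the complement of \<open>K\<close> a neighbourhood of every
    point outside the chart.\<close>
  then have "closed K" by (rule compact_imp_closed)
  have K: "q \<in> K \<longleftrightarrow> q \<in> U \<and> dist (\<phi> p) (\<phi> q) \<le> r" for q
  proof
    assume "q \<in> K"
    then obtain x where x: "x \<in> cball (\<phi> p) r" "q = inv_into U \<phi> x" by (auto simp: K_def)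
    then have "x \<in> \<phi> ` U" using sub by auto
    then have "\<phi> q = x" "q \<in> U" using x by (auto simp: f_inv_into_f inv_into_into)
    then show "q \<in> U \<and> dist (\<phi> p) (\<phi> q) \<le> r" using x by auto
  next
    assume q: "q \<in> U \<and> dist (\<phi> p) (\<phi> q) \<le> r"
    then have "q = inv_into U \<phi> (\<phi> q)" using cf(4) by simp
    then show "q \<in> K" using q unfolding K_def by (metis image_eqI mem_cball)
  qed
  have "K \<subseteq> W"
  proof
    fix q assume "q \<in> K"
    then have q: "q \<in> U" "\<phi> q \<in> \<phi> ` (U \<inter> W)" using r(2) by (auto simp: K)
    then show "q \<in> W" using cf(4) by (auto dest: inj_onD)
  qed
  have dN: "d q \<le> 1" if "q \<in> N" for q
  proof -
    have "dist (\<phi> p) (\<phi> q) / r \<le> 1 / sqrt 2"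
      using that r(1) by (simp add: N_def divide_simps mult.commute)
    then have "(dist (\<phi> p) (\<phi> q) / r)\<^sup>2 \<le> (1 / sqrt 2)\<^sup>2"
      using r(1) by (intro power_mono) auto
    then show ?thesis by (simp add: dq power_divide mult.commute)
  qed
  have one: "\<theta> q = 1" if "q \<in> N" for q
  proof -
    have "q \<in> U" using that by (simp add: N_def)
    then show ?thesis using dN[OF that] by (simp add: \<theta>_def smooth_step_1)
  qed
  have zero: "\<theta> q = 0" if "q \<notin> K" for q
  proof (cases "q \<in> U")
    case True
    then have "dist (\<phi> p) (\<phi> q) / r \<ge> 1" using that r(1) by (auto simp: K)
    then have "d q \<ge> 2" using power_mono[of 1 "dist (\<phi> p) (\<phi> q) / r" 2] by (simp add: dq)
    then show ?thesis using True by (simp add: \<theta>_def smooth_step_0)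
  qed (simp add: \<theta>_def)
  have "N \<subseteq> K"
  proof
    fix q assume "q \<in> N"
    moreover have "r / sqrt 2 \<le> r" using r(1) by (simp add: divide_simps)
    ultimately show "q \<in> K" by (auto simp: K N_def)
  qed
  have "mfd_smooth_on M UNIV \<theta>"
  proof (rule mfd_smooth_on_local[OF M])
    fix q :: 'm
    show "\<exists>N. open N \<and> q \<in> N \<and> mfd_smooth_on M (UNIV \<inter> N) \<theta>"
    proof (cases "q \<in> U")
      case True
      have \<phi>: "mfd_smooth_on M U \<phi>"
      proof (rule mfd_smooth_onI)
        fix V \<psi> n assume cV: "(V, \<psi>) \<in> charts M"
        have "smooth_on (\<psi> ` (V \<inter> U)) (\<lambda>x. \<phi> (inv_into V \<psi> x))"
          by (rule chart_transition[OF M cV c])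
        then show "Ck_on n (\<psi> ` (V \<inter> U)) (\<lambda>x. \<phi> (inv_into V \<psi> x))" by (simp add: smooth_on_def)
      qed
      have s: "mfd_smooth_on M U (\<lambda>q. \<phi> q - \<phi> p)"
        using mfd_smooth_on_add[OF M cf(1) \<phi> mfd_smooth_on_const[of _ _ "- \<phi> p"]] by simp
      have u: "mfd_smooth_on M U (\<lambda>q. 2 - d q)"
        using mfd_smooth_on_add[OF M cf(1) mfd_smooth_on_const[of _ _ 2]
          mfd_smooth_on_bounded_linear[OF M cf(1) bounded_linear_mult_right[of "- (2 / r\<^sup>2)"]
            mfd_smooth_on_bilinear[OF M cf(1) bounded_bilinear_inner s s]]]
        by (simp add: d_def)
      have "mfd_smooth_on M U (\<lambda>q. smooth_step (2 - d q))"
      proof (rule mfd_smooth_onI)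
        fix V \<psi> n assume cV: "(V, \<psi>) \<in> charts M"
        show "Ck_on n (\<psi> ` (V \<inter> U)) (\<lambda>x. smooth_step (2 - d (inv_into V \<psi> x)))"
          by (rule Ck_on_compose_real[OF open_chart_image[OF M cV cf(1)] open_UNIV _ mfd_smooth_onD[OF u cV]])
            (use smooth_on_step in \<open>auto simp: smooth_on_def\<close>)
      qed
      then have "mfd_smooth_on M U \<theta>"
        by (rule mfd_smooth_on_cong[OF M cf(1), rotated]) (simp add: \<theta>_def)
      then show ?thesis using True cf(1) by auto
    next
      case False
      have "mfd_smooth_on M (- K) \<theta>"
        by (rule mfd_smooth_on_cong[OF M _ _ mfd_smooth_on_const[of _ _ 0]])
          (use \<open>closed K\<close> zero in auto)
      moreover have "q \<in> - K" using False K by auto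
      ultimately show ?thesis using \<open>closed K\<close> by (intro exI[of _ "- K"]) auto
    qed
  qed
  moreover have "p \<in> N" using pU r(1) by (simp add: N_def)
  ultimately show ?thesis
    using that[of \<theta> N K] \<open>open N\<close> \<open>N \<subseteq> K\<close> \<open>closed K\<close> \<open>K \<subseteq> W\<close> one zero
    by (auto simp: smooth_functions_def)
qed

text \<open>The open sets \<open>W\<close> and \<open>- K\<close> cover the manifold: on the first
  the function is a product of smooth functions, on the second it is 0.\<close>

lemma mfd_smooth_on_extend:
  assumes M: "smooth_manifold M" and \<theta>: "\<theta> \<in> smooth_functions M" and K: "closed K" "K \<subseteq> W" "open W"
    and zero: "\<And>q. q \<notin> K \<Longrightarrow> \<theta> q = 0" and V: "open V" and f: "mfd_smooth_on M (V \<inter> W) f"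
  shows "mfd_smooth_on M V (\<lambda>q. if q \<in> W then \<theta> q *\<^sub>R f q else 0)"
proof (rule mfd_smooth_on_local[OF M])
  fix q assume q: "q \<in> V"
  let ?g = "\<lambda>q. if q \<in> W then \<theta> q *\<^sub>R f q else 0"
  show "\<exists>N. open N \<and> q \<in> N \<and> mfd_smooth_on M (V \<inter> N) ?g"
  proof (cases "q \<in> W")
    case True
    have VW: "open (V \<inter> W)" using V K by auto
    have "mfd_smooth_on M (V \<inter> W) \<theta>"
      using \<theta> by (auto simp: smooth_functions_def intro: mfd_smooth_on_subset)
    then have "mfd_smooth_on M (V \<inter> W) (\<lambda>q. \<theta> q *\<^sub>R f q)"
      by (rule mfd_smooth_on_scaleR[OF M VW _ f])
    then have "mfd_smooth_on M (V \<inter> W) ?g"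
      by (rule mfd_smooth_on_cong[OF M VW, rotated]) auto
    then show ?thesis using True K by auto
  next
    case False
    have "mfd_smooth_on M (V \<inter> - K) ?g"
      by (rule mfd_smooth_on_cong[OF M _ _ mfd_smooth_on_const[of _ _ 0]]) (use V K zero in auto)
    then show ?thesis using False K by (intro exI[of _ "- K"]) auto
  qed
qed

lemma smooth_functions_const: "(\<lambda>p. c) \<in> smooth_functions M"
  by (simp add: smooth_functions_def mfd_smooth_on_const)

lemma smooth_functions_add:
  "smooth_manifold M \<Longrightarrow> f \<in> smooth_functions M \<Longrightarrow> g \<in> smooth_functions M \<Longrightarrow> f + g \<in> smooth_functions M"
  using mfd_smooth_on_add[of M UNIV f g] by (simp add: smooth_functions_def plus_fun_def)

lemma smooth_functions_mult:
  "smooth_manifold M \<Longrightarrow> f \<in> smooth_functions M \<Longrightarrow> g \<in> smooth_functions M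
    \<Longrightarrow> fscale f g \<in> smooth_functions M"
  using mfd_smooth_on_mult[of M UNIV f g] by (simp add: smooth_functions_def fscale_def)

lemma subspace_smooth_functions:
  assumes "smooth_manifold M"
  shows "subspace (smooth_functions M)"
proof (rule subspaceI)
  show "0 \<in> smooth_functions M" using smooth_functions_const[of 0 M] by (simp add: zero_fun_def)
  show "c *\<^sub>R f \<in> smooth_functions M" if "f \<in> smooth_functions M" for c f
    using smooth_functions_mult[OF assms smooth_functions_const that, of c]
    by (simp add: fscale_def scaleR_fun_def)
qed (rule smooth_functions_add[OF assms])

section \<open>Vector bundles\<close>

definition onb :: "'f::real_inner set" where
  "onb = (SOME B. orthonormal_basis B)"

lemma subspace_dual_space: "subspace (dual_space V)"
  by (rule subspaceI)
    (auto simp: dual_space_def linear_on_def scaleR_fun_def algebra_simps)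

lemma fscale_apply: "fscale f x p = f p *\<^sub>R x p"
  by (simp add: fscale_def)

locale smooth_bundle =
  fixes A :: "('m::{t2_space,second_countable_topology}, 'e::real_inner, 'v::real_vector,
                'f::real_inner, 'z) vbundle_scheme"
  assumes vb: "vector_bundle A"
begin

lemma manifold: "smooth_manifold A"
  using vb by (simp add: vector_bundle_def)

lemma onb: "orthonormal_basis (onb :: 'f set)"
proof -
  have "finite_dimensional TYPE('f)" using vb by (simp add: vector_bundle_def)
  then show ?thesis unfolding onb_def by (rule someI_ex[OF orthonormal_basis_exists])
qed

lemma onb_expand: "(\<Sum>b\<in>onb. (b \<bullet> x) *\<^sub>R b) = (x :: 'f)"
  using onb by (simp add: orthonormal_basis_def)

lemma subspace_fibre: "subspace (fibre A p)"
  using vb by (simp add: vector_bundle_def)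

lemma triv_at: obtains U \<Phi> where "(U, \<Phi>) \<in> trivs A" "p \<in> U"
proof -
  have "p \<in> (\<Union>(U, \<Phi>)\<in>trivs A. U)" using vb by (simp add: vector_bundle_def)
  then show ?thesis using that by blast
qed

lemma triv_all: "(U, \<Phi>) \<in> trivs A \<Longrightarrow> open U \<and>
    (\<forall>p\<in>U. linear_on (fibre A p) (\<Phi> p) \<and> bij_betw (\<Phi> p) (fibre A p) UNIV)"
proof -
  have "\<forall>(U, \<Phi>)\<in>trivs A. open U \<and>
    (\<forall>p\<in>U. linear_on (fibre A p) (\<Phi> p) \<and> bij_betw (\<Phi> p) (fibre A p) UNIV)"
    using vb by (simp add: vector_bundle_def)
  then show "(U, \<Phi>) \<in> trivs A \<Longrightarrow> ?thesis" by (auto dest: bspec)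
qed

lemma triv_open: "(U, \<Phi>) \<in> trivs A \<Longrightarrow> open U"
  and triv_linear: "(U, \<Phi>) \<in> trivs A \<Longrightarrow> p \<in> U \<Longrightarrow> linear_on (fibre A p) (\<Phi> p)"
  and triv_bij: "(U, \<Phi>) \<in> trivs A \<Longrightarrow> p \<in> U \<Longrightarrow> bij_betw (\<Phi> p) (fibre A p) UNIV"
  using triv_all by simp_all

lemma triv_transition:
  assumes "(U, \<Phi>) \<in> trivs A" "(V, \<Psi>) \<in> trivs A"
  shows "mfd_smooth_on A (U \<inter> V) (\<lambda>p. \<Psi> p (inv_into (fibre A p) (\<Phi> p) w))"
proof -
  have "\<forall>(U, \<Phi>)\<in>trivs A. \<forall>(V, \<Psi>)\<in>trivs A. \<forall>w.
        mfd_smooth_on A (U \<inter> V) (\<lambda>p. \<Psi> p (inv_into (fibre A p) (\<Phi> p) w))"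
    using vb by (simp add: vector_bundle_def)
  from bspec[OF this assms(1)] have "\<forall>(V, \<Psi>)\<in>trivs A. \<forall>w.
        mfd_smooth_on A (U \<inter> V) (\<lambda>p. \<Psi> p (inv_into (fibre A p) (\<Phi> p) w))" by simp
  from bspec[OF this assms(2)] show ?thesis by simp
qed

text \<open>The vector with constant components \<open>w\<close> in the trivialization, the
  counterpart of \<open>const_covector\<close>.\<close>

definition frame :: "('m \<Rightarrow> 'v \<Rightarrow> 'f) \<Rightarrow> 'm \<Rightarrow> 'f \<Rightarrow> 'v" where
  "frame \<Phi> p = inv_into (fibre A p) (\<Phi> p)"

context
  fixes U \<Phi> p
  assumes t: "(U, \<Phi>) \<in> trivs A" and p: "p \<in> U"
begin

lemma frame_mem: "frame \<Phi> p w \<in> fibre A p"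
  unfolding frame_def using triv_bij[OF t p] by (intro inv_into_into) (simp add: bij_betw_def)

lemma triv_frame: "\<Phi> p (frame \<Phi> p w) = w"
  unfolding frame_def using triv_bij[OF t p] by (intro f_inv_into_f) (simp add: bij_betw_def)

lemma triv_inject: "v \<in> fibre A p \<Longrightarrow> v' \<in> fibre A p \<Longrightarrow> \<Phi> p v = \<Phi> p v' \<Longrightarrow> v = v'"
  using triv_bij[OF t p] by (auto simp: bij_betw_def inj_on_def)

lemma frame_triv: "v \<in> fibre A p \<Longrightarrow> frame \<Phi> p (\<Phi> p v) = v"
  by (rule triv_inject[OF frame_mem]) (simp_all add: triv_frame)

lemma frame_expand: "v \<in> fibre A p \<Longrightarrow> (\<Sum>b\<in>onb. (b \<bullet> \<Phi> p v) *\<^sub>R frame \<Phi> p b) = v"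
proof (rule triv_inject)
  assume v: "v \<in> fibre A p"
  have m: "(b \<bullet> \<Phi> p v) *\<^sub>R frame \<Phi> p b \<in> fibre A p" for b
    by (rule subspace_scale[OF subspace_fibre frame_mem])
  show "(\<Sum>b\<in>onb. (b \<bullet> \<Phi> p v) *\<^sub>R frame \<Phi> p b) \<in> fibre A p"
    by (rule subspace_sum[OF subspace_fibre m])
  have "\<Phi> p (\<Sum>b\<in>onb. (b \<bullet> \<Phi> p v) *\<^sub>R frame \<Phi> p b) = (\<Sum>b\<in>onb. \<Phi> p ((b \<bullet> \<Phi> p v) *\<^sub>R frame \<Phi> p b))"
    by (rule linear_on_sum[OF triv_linear[OF t p] subspace_fibre m])
  also have "\<dots> = (\<Sum>b\<in>onb. (b \<bullet> \<Phi> p v) *\<^sub>R b)"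
    by (simp add: linear_on_scale[OF triv_linear[OF t p] frame_mem] triv_frame)
  finally show "\<Phi> p (\<Sum>b\<in>onb. (b \<bullet> \<Phi> p v) *\<^sub>R frame \<Phi> p b) = \<Phi> p v" by (simp add: onb_expand)
qed

lemma covector_expand:
  assumes "linear_on (fibre A p) \<alpha>" "v \<in> fibre A p"
  shows "\<alpha> v = (\<Sum>b\<in>onb. (b \<bullet> \<Phi> p v) *\<^sub>R \<alpha> (frame \<Phi> p b))"
proof -
  have m: "(b \<bullet> \<Phi> p v) *\<^sub>R frame \<Phi> p b \<in> fibre A p" for b
    by (rule subspace_scale[OF subspace_fibre frame_mem])
  have "\<alpha> v = \<alpha> (\<Sum>b\<in>onb. (b \<bullet> \<Phi> p v) *\<^sub>R frame \<Phi> p b)" by (simp add: frame_expand[OF assms(2)])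
  also have "\<dots> = (\<Sum>b\<in>onb. \<alpha> ((b \<bullet> \<Phi> p v) *\<^sub>R frame \<Phi> p b))"
    by (rule linear_on_sum[OF assms(1) subspace_fibre m])
  finally show ?thesis by (simp add: linear_on_scale[OF assms(1) frame_mem])
qed

lemma const_covector_mem: "const_covector A \<Phi> p w \<in> dual_space (fibre A p)"
  using triv_linear[OF t p] subspace_fibre[of p]
  by (auto simp: dual_space_def const_covector_def linear_on_def subspace_add subspace_scale inner_add_right)

lemma const_covector_expand:
  assumes "\<alpha> \<in> dual_space (fibre A p)"
  shows "(\<Sum>b\<in>onb. \<alpha> (frame \<Phi> p b) *\<^sub>R const_covector A \<Phi> p b) = \<alpha>"
proof
  fix v
  have sum_apply: "(\<Sum>b\<in>B. F b) v = (\<Sum>b\<in>B. F b v)" for F :: "'f \<Rightarrow> 'v \<Rightarrow> real" and B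
    by (induction B rule: infinite_finite_induct) auto
  show "(\<Sum>b\<in>onb. \<alpha> (frame \<Phi> p b) *\<^sub>R const_covector A \<Phi> p b) v = \<alpha> v"
  proof (cases "v \<in> fibre A p")
    case True
    then show ?thesis using assms covector_expand[of \<alpha> v]
      by (simp add: sum_apply scaleR_fun_def dual_space_def const_covector_def mult.commute)
  next
    case False
    then show ?thesis using assms
      by (simp add: sum_apply scaleR_fun_def dual_space_def const_covector_def)
  qed
qed

text \<open>Covectors with constant components suffice, since the inner product of the typical fibre
  separates points.\<close>

lemma dual_separates:
  assumes "v \<in> fibre A p" "v' \<in> fibre A p" "\<And>\<beta>. \<beta> \<in> dual_space (fibre A p) \<Longrightarrow> \<beta> v = \<beta> v'"
  shows "v = v'"
proof (rule triv_inject[OF assms(1,2)])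
  have "w \<bullet> \<Phi> p v = w \<bullet> \<Phi> p v'" for w
    using assms(3)[OF const_covector_mem[of w]] assms(1,2) by (simp add: const_covector_def)
  then show "\<Phi> p v = \<Phi> p v'" using vector_eq_ldot[of "\<Phi> p v" "\<Phi> p v'"] by simp
qed

end

lemma mfd_smooth_on_coord:
  "open W \<Longrightarrow> mfd_smooth_on A W f \<Longrightarrow> mfd_smooth_on A W (\<lambda>p. b \<bullet> f p)"
  by (rule mfd_smooth_on_bounded_linear[OF manifold _ bounded_linear_inner_right])

lemma sections_fibre: "x \<in> sections A \<Longrightarrow> x p \<in> fibre A p"
  by (simp add: sections_def)

lemma sections_smooth:
  assumes "x \<in> sections A" "(U, \<Phi>) \<in> trivs A"
  shows "mfd_smooth_on A U (\<lambda>p. \<Phi> p (x p))"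
proof -
  have "\<forall>(U, \<Phi>)\<in>trivs A. mfd_smooth_on A U (\<lambda>p. \<Phi> p (x p))" using assms(1) by (simp add: sections_def)
  from bspec[OF this assms(2)] show ?thesis by simp
qed

lemma dual_sections_fibre: "\<xi> \<in> dual_sections A \<Longrightarrow> \<xi> p \<in> dual_space (fibre A p)"
  by (simp add: dual_sections_def)

lemma dual_sections_smooth:
  assumes "\<xi> \<in> dual_sections A" "(U, \<Phi>) \<in> trivs A"
  shows "mfd_smooth_on A U (\<lambda>p. \<xi> p (frame \<Phi> p w))"
proof -
  have "\<forall>(U, \<Phi>)\<in>trivs A. \<forall>w. mfd_smooth_on A U (\<lambda>p. \<xi> p (inv_into (fibre A p) (\<Phi> p) w))"
    using assms(1) by (simp add: dual_sections_def)
  from bspec[OF this assms(2)] show ?thesis by (simp add: frame_def)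
qed

lemma sectionsI:
  assumes "\<And>p. x p \<in> fibre A p" "\<And>U \<Phi>. (U, \<Phi>) \<in> trivs A \<Longrightarrow> mfd_smooth_on A U (\<lambda>p. \<Phi> p (x p))"
  shows "x \<in> sections A"
  unfolding sections_def by (intro CollectI conjI allI ballI, rule assms(1), clarify, rule assms(2))

lemma dual_sectionsI:
  assumes "\<And>p. \<xi> p \<in> dual_space (fibre A p)"
    "\<And>U \<Phi> w. (U, \<Phi>) \<in> trivs A \<Longrightarrow> mfd_smooth_on A U (\<lambda>p. \<xi> p (frame \<Phi> p w))"
  shows "\<xi> \<in> dual_sections A"
  unfolding dual_sections_def
  by (intro CollectI conjI allI ballI, rule assms(1), clarify, rule assms(2)[unfolded frame_def])

lemma subspace_sections: "subspace (sections A)"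
proof (rule subspaceI)
  show "0 \<in> sections A"
  proof (rule sectionsI)
    fix U \<Phi> assume t: "(U, \<Phi>) \<in> trivs A"
    show "mfd_smooth_on A U (\<lambda>p. \<Phi> p (0 p))"
      by (rule mfd_smooth_on_cong[OF manifold triv_open[OF t] _ mfd_smooth_on_const[of _ _ 0]])
        (simp add: linear_on_0[OF triv_linear[OF t] subspace_fibre])
  qed (simp add: subspace_0[OF subspace_fibre])
next
  fix x y assume x: "x \<in> sections A" and y: "y \<in> sections A"
  show "x + y \<in> sections A"
  proof (rule sectionsI)
    fix U \<Phi> assume t: "(U, \<Phi>) \<in> trivs A"
    show "mfd_smooth_on A U (\<lambda>p. \<Phi> p ((x + y) p))"
      by (rule mfd_smooth_on_cong[OF manifold triv_open[OF t] _
            mfd_smooth_on_add[OF manifold triv_open[OF t] sections_smooth[OF x t] sections_smooth[OF y t]]])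
        (simp add: linear_on_add[OF triv_linear[OF t] sections_fibre[OF x] sections_fibre[OF y]])
  qed (simp add: subspace_add[OF subspace_fibre sections_fibre[OF x] sections_fibre[OF y]])
next
  fix c x assume x: "x \<in> sections A"
  show "c *\<^sub>R x \<in> sections A"
  proof (rule sectionsI)
    fix U \<Phi> assume t: "(U, \<Phi>) \<in> trivs A"
    show "mfd_smooth_on A U (\<lambda>p. \<Phi> p ((c *\<^sub>R x) p))"
      by (rule mfd_smooth_on_cong[OF manifold triv_open[OF t] _
            mfd_smooth_on_bounded_linear[OF manifold triv_open[OF t] bounded_linear_scaleR_right[of c] sections_smooth[OF x t]]])
        (simp add: scaleR_fun_def linear_on_scale[OF triv_linear[OF t] sections_fibre[OF x]])
  qed (simp add: scaleR_fun_def subspace_scale[OF subspace_fibre sections_fibre[OF x]])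
qed

lemma smooth_functions_on: "h \<in> smooth_functions A \<Longrightarrow> mfd_smooth_on A W h"
  by (auto simp: smooth_functions_def intro: mfd_smooth_on_subset)

lemma fscale_sections:
  assumes h: "h \<in> smooth_functions A" and x: "x \<in> sections A"
  shows "fscale h x \<in> sections A"
proof (rule sectionsI)
  fix U \<Phi> assume t: "(U, \<Phi>) \<in> trivs A"
  show "mfd_smooth_on A U (\<lambda>p. \<Phi> p (fscale h x p))"
    by (rule mfd_smooth_on_cong[OF manifold triv_open[OF t] _
          mfd_smooth_on_scaleR[OF manifold triv_open[OF t] smooth_functions_on[OF h] sections_smooth[OF x t]]])
      (simp add: fscale_def linear_on_scale[OF triv_linear[OF t] sections_fibre[OF x]])
qed (simp add: fscale_def subspace_scale[OF subspace_fibre sections_fibre[OF x]])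

lemma subspace_dual_sections: "subspace (dual_sections A)"
proof (rule subspaceI)
  show "0 \<in> dual_sections A"
    by (rule dual_sectionsI) (simp_all add: subspace_0[OF subspace_dual_space] mfd_smooth_on_const)
next
  fix x y assume x: "x \<in> dual_sections A" and y: "y \<in> dual_sections A"
  show "x + y \<in> dual_sections A"
  proof (rule dual_sectionsI)
    fix U \<Phi> w assume t: "(U, \<Phi>) \<in> trivs A"
    show "mfd_smooth_on A U (\<lambda>p. (x + y) p (frame \<Phi> p w))"
      using mfd_smooth_on_add[OF manifold triv_open[OF t] dual_sections_smooth[OF x t, of w]
        dual_sections_smooth[OF y t, of w]] by simp
  qed (simp add: subspace_add[OF subspace_dual_space dual_sections_fibre[OF x] dual_sections_fibre[OF y]]
      del: plus_fun_apply add: plus_fun_apply[of x y])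
next
  fix c x assume x: "x \<in> dual_sections A"
  show "c *\<^sub>R x \<in> dual_sections A"
  proof (rule dual_sectionsI)
    fix U \<Phi> w assume t: "(U, \<Phi>) \<in> trivs A"
    show "mfd_smooth_on A U (\<lambda>p. (c *\<^sub>R x) p (frame \<Phi> p w))"
      using mfd_smooth_on_bounded_linear[OF manifold triv_open[OF t] bounded_linear_mult_right
          dual_sections_smooth[OF x t, of w], of c] by (simp add: scaleR_fun_def)
  next
    fix p
    show "(c *\<^sub>R x) p \<in> dual_space (fibre A p)"
      using subspace_scale[OF subspace_dual_space dual_sections_fibre[OF x], of c p]
      by (simp add: scaleR_fun_def[of c x])
  qed
qed

lemma fscale_dual_sections:
  assumes h: "h \<in> smooth_functions A" and x: "x \<in> dual_sections A"
  shows "fscale h x \<in> dual_sections A"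
proof (rule dual_sectionsI)
  fix U \<Phi> w assume t: "(U, \<Phi>) \<in> trivs A"
  show "mfd_smooth_on A U (\<lambda>p. fscale h x p (frame \<Phi> p w))"
    using mfd_smooth_on_mult[OF manifold triv_open[OF t] smooth_functions_on[OF h]
       dual_sections_smooth[OF x t, of w]] by (simp add: fscale_def scaleR_fun_def)
qed (simp add: fscale_def subspace_scale[OF subspace_dual_space dual_sections_fibre[OF x]])

lemma pairing_smooth:
  assumes \<xi>: "\<xi> \<in> dual_sections A" and x: "x \<in> sections A"
  shows "pairing \<xi> x \<in> smooth_functions A"
  unfolding smooth_functions_def mem_Collect_eq
proof (rule mfd_smooth_on_local[OF manifold])
  fix p
  obtain U \<Phi> where t: "(U, \<Phi>) \<in> trivs A" and p: "p \<in> U" by (rule triv_at)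
  note M = manifold triv_open[OF t]
  have "mfd_smooth_on A U (\<lambda>q. \<Sum>b\<in>onb. (b \<bullet> \<Phi> q (x q)) *\<^sub>R \<xi> q (frame \<Phi> q b))"
    by (intro mfd_smooth_on_sum[OF M] mfd_smooth_on_scaleR[OF M] mfd_smooth_on_coord[OF M(2)]
        sections_smooth[OF x t] dual_sections_smooth[OF \<xi> t])
  then have "mfd_smooth_on A U (pairing \<xi> x)"
  proof (rule mfd_smooth_on_cong[OF M, rotated])
    fix q assume q: "q \<in> U"
    have "linear_on (fibre A q) (\<xi> q)" using dual_sections_fibre[OF \<xi>, of q] by (simp add: dual_space_def)
    from covector_expand[OF t q this sections_fibre[OF x]]
    show "(\<Sum>b\<in>onb. (b \<bullet> \<Phi> q (x q)) *\<^sub>R \<xi> q (frame \<Phi> q b)) = pairing \<xi> x q" by (simp add: pairing_def)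
  qed
  then show "\<exists>N. open N \<and> p \<in> N \<and> mfd_smooth_on A (UNIV \<inter> N) (pairing \<xi> x)" using p M by auto
qed

text \<open>Read in another trivialization, a frame vector is a transition function, and this is
  smooth on the overlap.\<close>

lemma extend_section:
  assumes t: "(U, \<Phi>) \<in> trivs A" and \<theta>: "\<theta> \<in> smooth_functions A" and K: "closed K" "K \<subseteq> U"
    and zero: "\<And>q. q \<notin> K \<Longrightarrow> \<theta> q = 0"
  shows "(\<lambda>q. if q \<in> U then \<theta> q *\<^sub>R frame \<Phi> q w else 0) \<in> sections A"
proof (rule sectionsI)
  fix q show "(if q \<in> U then \<theta> q *\<^sub>R frame \<Phi> q w else 0) \<in> fibre A q"
    by (simp add: subspace_0[OF subspace_fibre] subspace_scale[OF subspace_fibre frame_mem[OF t]])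
next
  fix V \<Psi> assume s: "(V, \<Psi>) \<in> trivs A"
  have "mfd_smooth_on A (V \<inter> U) (\<lambda>q. \<Psi> q (frame \<Phi> q w))"
    using triv_transition[OF t s, of w] by (simp add: frame_def Int_commute)
  from mfd_smooth_on_extend[OF manifold \<theta> K triv_open[OF t] zero triv_open[OF s] this]
  show "mfd_smooth_on A V (\<lambda>q. \<Psi> q (if q \<in> U then \<theta> q *\<^sub>R frame \<Phi> q w else 0))"
  proof (rule mfd_smooth_on_cong[OF manifold triv_open[OF s], rotated])
    fix q assume "q \<in> V"
    then show "(if q \<in> U then \<theta> q *\<^sub>R \<Psi> q (frame \<Phi> q w) else 0)
       = \<Psi> q (if q \<in> U then \<theta> q *\<^sub>R frame \<Phi> q w else 0)"
      by (cases "q \<in> U") (simp_all add: linear_on_0[OF triv_linear[OF s] subspace_fibre]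
        linear_on_scale[OF triv_linear[OF s] frame_mem[OF t]])
  qed
qed

text \<open>The components in another trivialization are coordinates of a transition function again,
  this time in the opposite direction.\<close>

lemma extend_dual_section:
  assumes t: "(U, \<Phi>) \<in> trivs A" and \<theta>: "\<theta> \<in> smooth_functions A" and K: "closed K" "K \<subseteq> U"
    and zero: "\<And>q. q \<notin> K \<Longrightarrow> \<theta> q = 0"
  shows "(\<lambda>q. if q \<in> U then \<theta> q *\<^sub>R const_covector A \<Phi> q w else 0) \<in> dual_sections A"
proof (rule dual_sectionsI)
  fix q show "(if q \<in> U then \<theta> q *\<^sub>R const_covector A \<Phi> q w else 0) \<in> dual_space (fibre A q)"
    by (simp add: subspace_0[OF subspace_dual_space] subspace_scale[OF subspace_dual_space const_covector_mem[OF t]])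
next
  fix V \<Psi> w' assume s: "(V, \<Psi>) \<in> trivs A"
  have VU: "open (V \<inter> U)" using triv_open[OF s] triv_open[OF t] by auto
  have "mfd_smooth_on A (V \<inter> U) (\<lambda>q. w \<bullet> \<Phi> q (frame \<Psi> q w'))"
    using mfd_smooth_on_coord[OF VU, of _ w] triv_transition[OF s t, of w'] by (simp add: frame_def)
  then have "mfd_smooth_on A (V \<inter> U) (\<lambda>q. const_covector A \<Phi> q w (frame \<Psi> q w'))"
    by (rule mfd_smooth_on_cong[OF manifold VU, rotated]) (simp add: const_covector_def frame_mem[OF s])
  from mfd_smooth_on_extend[OF manifold \<theta> K triv_open[OF t] zero triv_open[OF s] this]
  show "mfd_smooth_on A V (\<lambda>q. (if q \<in> U then \<theta> q *\<^sub>R const_covector A \<Phi> q w else 0) (frame \<Psi> q w'))"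
  proof (rule mfd_smooth_on_cong[OF manifold triv_open[OF s], rotated])
    fix q
    show "(if q \<in> U then \<theta> q *\<^sub>R const_covector A \<Phi> q w (frame \<Psi> q w') else 0)
       = (if q \<in> U then \<theta> q *\<^sub>R const_covector A \<Phi> q w else 0) (frame \<Psi> q w')"
      by (cases "q \<in> U") (simp_all add: scaleR_fun_def)
  qed
qed

text \<open>Multiplication with a bump function makes the frame global and does not change it where
  the function is 1.\<close>

lemma local_frame:
  assumes t: "(U, \<Phi>) \<in> trivs A" and p: "p \<in> U"
  obtains N where "open N" "p \<in> N" "N \<subseteq> U"
    "\<And>w. \<exists>x\<in>sections A. \<forall>q\<in>N. x q = frame \<Phi> q w"
    "\<And>w. \<exists>\<xi>\<in>dual_sections A. \<forall>q\<in>N. \<xi> q = const_covector A \<Phi> q w"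
proof -
  obtain \<theta> N K where b: "\<theta> \<in> smooth_functions A" "open N" "p \<in> N" "N \<subseteq> U" "closed K" "K \<subseteq> U"
    "\<And>q. q \<in> N \<Longrightarrow> \<theta> q = 1" "\<And>q. q \<notin> K \<Longrightarrow> \<theta> q = 0"
    by (rule bump_function[OF manifold triv_open[OF t] p]) (rule that)
  show ?thesis
  proof (rule that[OF b(2-4)])
    fix w
    show "\<exists>x\<in>sections A. \<forall>q\<in>N. x q = frame \<Phi> q w"
      by (rule bexI[OF _ extend_section[OF t b(1,5,6,8)]]) (use b(4,7) in auto)
    show "\<exists>\<xi>\<in>dual_sections A. \<forall>q\<in>N. \<xi> q = const_covector A \<Phi> q w"
      by (rule bexI[OF _ extend_dual_section[OF t b(1,5,6,8)]]) (use b(4,7) in auto)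
  qed
qed

lemma section_through:
  assumes "v \<in> fibre A p"
  obtains x where "x \<in> sections A" "x p = v"
proof -
  obtain U \<Phi> where t: "(U, \<Phi>) \<in> trivs A" and p: "p \<in> U" by (rule triv_at)
  obtain N where N: "p \<in> N" "\<And>w. \<exists>x\<in>sections A. \<forall>q\<in>N. x q = frame \<Phi> q w"
    by (rule local_frame[OF t p]) (rule that)
  from N(2)[of "\<Phi> p v"] obtain x where "x \<in> sections A" "\<forall>q\<in>N. x q = frame \<Phi> q (\<Phi> p v)" by (rule bexE)
  then show ?thesis using that N(1) by (simp add: frame_triv[OF t p assms])
qed

end

text \<open>
  \<open>locally_framed S C p\<close>: near \<open>p\<close> the module \<open>S\<close> over the ring \<open>C\<close> of functions has a finite
  frame, in the form that the localization argument for tensoriality needs.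
\<close>

definition locally_framed :: "('m \<Rightarrow> 'w::real_vector) set \<Rightarrow> ('m \<Rightarrow> real) set \<Rightarrow> 'm \<Rightarrow> 'i set \<Rightarrow> bool" where
  "locally_framed S C p I \<longleftrightarrow> (\<exists>\<theta>\<in>C. \<theta> p = 1 \<and> (\<exists>e. e ` I \<subseteq> S \<and>
     (\<forall>x\<in>S. \<exists>c. (\<forall>i\<in>I. c i \<in> C \<and> (x p = 0 \<longrightarrow> c i p = 0)) \<and> fscale \<theta> x = (\<Sum>i\<in>I. fscale (c i) (e i)))))"

lemma sum_fun_apply: "(\<Sum>i\<in>I. F i) p = (\<Sum>i\<in>I. F i p)"
  by (induction I rule: infinite_finite_induct) auto

text \<open>As \<open>\<theta> p = 1\<close>, the value at \<open>p\<close> is that of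
  \<open>T (fscale \<theta> x)\<close>. Expanded in the frame, this is a linear combination of the
  \<open>T (e i) p\<close> with coefficients \<open>c i p\<close>, which vanish together with
  \<open>x p\<close>.\<close>

lemma tensorial_at:
  fixes T :: "('m \<Rightarrow> 'w::real_vector) \<Rightarrow> 'm \<Rightarrow> 'b::real_vector"
  assumes fr: "locally_framed S C p I" and S: "subspace S"
    and Sf: "\<And>h x. h \<in> C \<Longrightarrow> x \<in> S \<Longrightarrow> fscale h x \<in> S"
    and lin: "linear_on S T" and T: "\<And>h x. h \<in> C \<Longrightarrow> x \<in> S \<Longrightarrow> T (fscale h x) = fscale h (T x)"
    and x: "x \<in> S" "x p = 0"
  shows "T x p = 0"
proof -
  from fr[unfolded locally_framed_def] obtain \<theta> where \<theta>: "\<theta> \<in> C" "\<theta> p = 1" and "\<exists>e. e ` I \<subseteq> S \<and>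
     (\<forall>x\<in>S. \<exists>c. (\<forall>i\<in>I. c i \<in> C \<and> (x p = 0 \<longrightarrow> c i p = 0)) \<and> fscale \<theta> x = (\<Sum>i\<in>I. fscale (c i) (e i)))"
    by (elim bexE conjE)
  from this(3) obtain e where e: "e ` I \<subseteq> S" and ce: "\<forall>x\<in>S. \<exists>c. (\<forall>i\<in>I. c i \<in> C \<and> (x p = 0 \<longrightarrow> c i p = 0)) \<and>
       fscale \<theta> x = (\<Sum>i\<in>I. fscale (c i) (e i))"
    by (elim exE conjE)
  from bspec[OF ce x(1)] obtain c where c: "\<forall>i\<in>I. c i \<in> C \<and> (x p = 0 \<longrightarrow> c i p = 0)"
       "fscale \<theta> x = (\<Sum>i\<in>I. fscale (c i) (e i))"
    by (elim exE conjE)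
  have m: "i \<in> I \<Longrightarrow> c i \<in> C" "i \<in> I \<Longrightarrow> e i \<in> S" for i using c(1) e by auto
  have "T x p = T (fscale \<theta> x) p" using T[OF \<theta>(1) x(1)] \<theta>(2) by (simp add: fscale_def)
  also have "T (fscale \<theta> x) = (\<Sum>i\<in>I. T (fscale (c i) (e i)))"
    unfolding c(2) by (rule linear_on_sum[OF lin S Sf[OF m]])
  also have "\<dots> p = (\<Sum>i\<in>I. c i p *\<^sub>R T (e i) p)"
    unfolding sum_fun_apply by (rule sum.cong[OF refl]) (simp add: T[OF m] fscale_apply)
  also have "\<dots> = 0" using c(1) x(2) by (intro sum.neutral) auto
  finally show ?thesis .
qed

context smooth_bundle
begin

text \<open>The square of a bump function is used, because one factor is needed to extend the frame
  by zero and the other to extend the coefficients.\<close>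

lemma sections_locally_framed: "locally_framed (sections A) (smooth_functions A) p (onb :: 'f set)"
proof -
  obtain U \<Phi> where t: "(U, \<Phi>) \<in> trivs A" and p: "p \<in> U" by (rule triv_at)
  obtain \<theta> N K where b: "\<theta> \<in> smooth_functions A" "open N" "p \<in> N" "N \<subseteq> U" "closed K" "K \<subseteq> U"
    "\<And>q. q \<in> N \<Longrightarrow> \<theta> q = 1" "\<And>q. q \<notin> K \<Longrightarrow> \<theta> q = 0"
    by (rule bump_function[OF manifold triv_open[OF t] p]) (rule that)
  define e where "e = (\<lambda>w q. if q \<in> U then \<theta> q *\<^sub>R frame \<Phi> q w else 0)"
  have e: "e w \<in> sections A" for w
    unfolding e_def by (rule extend_section[OF t b(1,5,6,8)])
  show ?thesis
    unfolding locally_framed_def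
  proof (intro bexI[of _ "fscale \<theta> \<theta>"] conjI exI[of _ e] ballI)
    show "fscale \<theta> \<theta> \<in> smooth_functions A" by (rule smooth_functions_mult[OF manifold b(1) b(1)])
    show "fscale \<theta> \<theta> p = 1" using b(3,7) by (simp add: fscale_def)
    show "e ` onb \<subseteq> sections A" using e by auto
    fix x assume x: "x \<in> sections A"
    define c where "c = (\<lambda>b q. if q \<in> U then \<theta> q *\<^sub>R (b \<bullet> \<Phi> q (x q)) else 0)"
    have "c b \<in> smooth_functions A" for b
    proof -
      have "mfd_smooth_on A (UNIV \<inter> U) (\<lambda>q. b \<bullet> \<Phi> q (x q))"
        using mfd_smooth_on_coord[OF triv_open[OF t] sections_smooth[OF x t]] by simp
      from mfd_smooth_on_extend[OF manifold b(1,5,6) triv_open[OF t] b(8) open_UNIV this]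
      show ?thesis by (simp add: smooth_functions_def c_def)
    qed
    moreover have "c b p = 0" if "x p = 0" for b
      using linear_on_0[OF triv_linear[OF t p] subspace_fibre] that by (simp add: c_def)
    moreover have "fscale (fscale \<theta> \<theta>) x = (\<Sum>b\<in>onb. fscale (c b) (e b))"
    proof
      fix q
      show "fscale (fscale \<theta> \<theta>) x q = (\<Sum>b\<in>onb. fscale (c b) (e b)) q"
      proof (cases "q \<in> U")
        case True
        have "fscale (fscale \<theta> \<theta>) x q
           = (\<theta> q * \<theta> q) *\<^sub>R (\<Sum>b\<in>onb. (b \<bullet> \<Phi> q (x q)) *\<^sub>R frame \<Phi> q b)"
          unfolding frame_expand[OF t True sections_fibre[OF x]] by (simp add: fscale_def)
        then show ?thesis using True
          by (simp add: sum_fun_apply fscale_def c_def e_def scaleR_sum_right mult_ac)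
      next
        case False
        then have "\<theta> q = 0" using b(6,8) by blast
        then show ?thesis using False by (simp add: sum_fun_apply fscale_def c_def e_def)
      qed
    qed
    ultimately show "\<exists>c. (\<forall>i\<in>onb. c i \<in> smooth_functions A \<and> (x p = 0 \<longrightarrow> c i p = 0)) \<and>
        fscale (fscale \<theta> \<theta>) x = (\<Sum>i\<in>onb. fscale (c i) (e i))"
      by (intro exI[of _ c]) simp
  qed
qed

text \<open>The same with constant covectors; the coefficients are the values of the dual section on
  the frame vectors.\<close>

lemma dual_sections_locally_framed: "locally_framed (dual_sections A) (smooth_functions A) p (onb :: 'f set)"
proof -
  obtain U \<Phi> where t: "(U, \<Phi>) \<in> trivs A" and p: "p \<in> U" by (rule triv_at)
  obtain \<theta> N K where b: "\<theta> \<in> smooth_functions A" "open N" "p \<in> N" "N \<subseteq> U" "closed K" "K \<subseteq> U"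
    "\<And>q. q \<in> N \<Longrightarrow> \<theta> q = 1" "\<And>q. q \<notin> K \<Longrightarrow> \<theta> q = 0"
    by (rule bump_function[OF manifold triv_open[OF t] p]) (rule that)
  define e where "e = (\<lambda>w q. if q \<in> U then \<theta> q *\<^sub>R const_covector A \<Phi> q w else 0)"
  have e: "e w \<in> dual_sections A" for w
    unfolding e_def by (rule extend_dual_section[OF t b(1,5,6,8)])
  show ?thesis
    unfolding locally_framed_def
  proof (intro bexI[of _ "fscale \<theta> \<theta>"] conjI exI[of _ e] ballI)
    show "fscale \<theta> \<theta> \<in> smooth_functions A" by (rule smooth_functions_mult[OF manifold b(1) b(1)])
    show "fscale \<theta> \<theta> p = 1" using b(3,7) by (simp add: fscale_def)
    show "e ` onb \<subseteq> dual_sections A" using e by auto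
    fix x assume x: "x \<in> dual_sections A"
    define c where "c = (\<lambda>b q. if q \<in> U then \<theta> q *\<^sub>R (x q (frame \<Phi> q b)) else 0)"
    have "c b \<in> smooth_functions A" for b
    proof -
      have "mfd_smooth_on A (UNIV \<inter> U) (\<lambda>q. x q (frame \<Phi> q b))"
        using dual_sections_smooth[OF x t, of b] by simp
      from mfd_smooth_on_extend[OF manifold b(1,5,6) triv_open[OF t] b(8) open_UNIV this]
      show ?thesis by (simp add: smooth_functions_def c_def)
    qed
    moreover have "c b p = 0" if "x p = 0" for b
      using that by (simp add: c_def)
    moreover have "fscale (fscale \<theta> \<theta>) x = (\<Sum>b\<in>onb. fscale (c b) (e b))"
    proof
      fix q
      show "fscale (fscale \<theta> \<theta>) x q = (\<Sum>b\<in>onb. fscale (c b) (e b)) q"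
      proof (cases "q \<in> U")
        case True
        have "fscale (fscale \<theta> \<theta>) x q
           = (\<theta> q * \<theta> q) *\<^sub>R (\<Sum>b\<in>onb. x q (frame \<Phi> q b) *\<^sub>R const_covector A \<Phi> q b)"
          unfolding const_covector_expand[OF t True dual_sections_fibre[OF x]] by (simp add: fscale_def)
        then show ?thesis using True
          by (simp only: sum_fun_apply fscale_def c_def e_def scaleR_sum_right if_True scaleR_scaleR
              real_scaleR_def mult_ac)
      next
        case False
        then have "\<theta> q = 0" using b(6,8) by blast
        then show ?thesis using False by (simp add: sum_fun_apply fscale_def c_def e_def)
      qed
    qed
    ultimately show "\<exists>c. (\<forall>i\<in>onb. c i \<in> smooth_functions A \<and> (x p = 0 \<longrightarrow> c i p = 0)) \<and>
        fscale (fscale \<theta> \<theta>) x = (\<Sum>i\<in>onb. fscale (c i) (e i))"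
      by (intro exI[of _ c]) simp
  qed
qed

lemma tensorial_sections:
  assumes "linear_on (sections A) T"
    "\<And>h x. h \<in> smooth_functions A \<Longrightarrow> x \<in> sections A \<Longrightarrow> T (fscale h x) = fscale h (T x)"
    "x \<in> sections A" "x p = 0"
  shows "T x p = 0"
  by (rule tensorial_at[OF sections_locally_framed subspace_sections fscale_sections assms])

lemma tensorial_dual:
  assumes "linear_on (dual_sections A) T"
    "\<And>h x. h \<in> smooth_functions A \<Longrightarrow> x \<in> dual_sections A \<Longrightarrow> T (fscale h x) = fscale h (T x)"
    "x \<in> dual_sections A" "x p = 0"
  shows "T x p = 0"
  by (rule tensorial_at[OF dual_sections_locally_framed subspace_dual_sections fscale_dual_sections assms])

lemma dual_section_through:
  assumes "\<alpha> \<in> dual_space (fibre A p)"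
  obtains \<xi> where "\<xi> \<in> dual_sections A" "\<xi> p = \<alpha>"
proof -
  obtain U \<Phi> where t: "(U, \<Phi>) \<in> trivs A" and p: "p \<in> U" by (rule triv_at)
  obtain N where N: "p \<in> N" "\<And>w. \<exists>\<xi>\<in>dual_sections A. \<forall>q\<in>N. \<xi> q = const_covector A \<Phi> q w"
    by (rule local_frame[OF t p]) (rule that)
  from N(2) have "\<forall>w. \<exists>\<xi>. \<xi> \<in> dual_sections A \<and> \<xi> p = const_covector A \<Phi> p w" using N(1) by fast
  then obtain e where e: "\<And>w. e w \<in> dual_sections A" "\<And>w. e w p = const_covector A \<Phi> p w" by metis
  show ?thesis
  proof (rule that)
    show "(\<Sum>b\<in>onb. \<alpha> (frame \<Phi> p b) *\<^sub>R e b) \<in> dual_sections A"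
      by (intro subspace_sum[OF subspace_dual_sections] subspace_scale[OF subspace_dual_sections] e)
    show "(\<Sum>b\<in>onb. \<alpha> (frame \<Phi> p b) *\<^sub>R e b) p = \<alpha>"
      using const_covector_expand[OF t p assms]
      by (simp add: sum_fun_apply scaleR_fun_def[of _ "e _"] e)
  qed
qed

end

text \<open>Alternation is assumed for adjacent arguments only. If the head is one of the two equal
  entries, it is exchanged with its neighbour, which is then contracted away; the equal entries
  survive in a shorter list.\<close>

lemma cochain_repeat_0:
  assumes V: "subspace V" and F: "cochain V W p F" and s: "set as \<subseteq> V"
    and ij: "i < j" "j < length as" "as ! i = as ! j"
  shows "F as = 0"
  using F s ij
proof (induction "length as" arbitrary: as F p i j)
  case (Suc n)
  note F = Suc.prems(1)
  obtain a bs where as: "as = a # bs" using Suc.hyps(2) by (cases as) auto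
  obtain j' where j: "j = Suc j'" using Suc.prems(3) by (cases j) auto
  have a: "a \<in> V" and bs: "set bs \<subseteq> V" and n: "n = length bs" using Suc.prems(2) Suc.hyps(2) as by auto
  show ?case
  proof (cases i)
    case (Suc i')
    have "contract a F bs = 0"
      by (rule Suc.hyps(1)[OF n cochain_contract[OF F a] bs, of i' j']) (use Suc.prems Suc j as in auto)
    then show ?thesis by (simp add: contract_def as)
  next
    case 0
    then have aj: "bs ! j' = a" "j' < length bs" using Suc.prems j as by auto
    then obtain b cs where b: "bs = b # cs" by (cases bs) auto
    then have bV: "b \<in> V" and cs: "set cs \<subseteq> V" using bs by auto
    have acs: "set (a # cs) \<subseteq> V" "n = length (a # cs)" using a cs n b by auto
    show ?thesis
    proof (cases j')
      case 0
      then show ?thesis using aj b cochain_alt[OF F a cs] as by simp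
    next
      case (Suc j'')
      have "contract b F (a # cs) = 0"
        by (rule Suc.hyps(1)[OF acs(2) cochain_contract[OF F bV] acs(1), of 0 "Suc j''"])
          (use aj b Suc in auto)
      then show ?thesis
        using cochain_swap[OF F V a bV cs] b as by (simp add: contract_def)
    qed
  qed
qed simp

text \<open>Antisymmetry carries linearity over functions from the first argument to all others: the
  argument is moved to the front by transpositions and back again.\<close>

lemma cochain_fscale_at:
  assumes V: "subspace V" and Vh: "\<And>x. x \<in> V \<Longrightarrow> fscale h x \<in> V"
    and F: "cochain V W p F"
    and head: "\<And>a as. a \<in> V \<Longrightarrow> set as \<subseteq> V \<Longrightarrow> F (fscale h a # as) = fscale h (F (a # as))"
    and s: "set bs \<subseteq> V" "a \<in> V" "set as \<subseteq> V"
  shows "F (bs @ fscale h a # as) = fscale h (F (bs @ a # as))"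
  using s(1) F head
proof (induction bs arbitrary: F p)
  case (Cons c bs)
  have c: "c \<in> V" and bs: "set bs \<subseteq> V" using Cons.prems(1) by auto
  note F = Cons.prems(2)
  have "contract c F (bs @ fscale h a # as) = fscale h (contract c F (bs @ a # as))"
  proof (rule Cons.IH[OF bs cochain_contract[OF F c]])
    fix b ds assume b: "b \<in> V" "set ds \<subseteq> V"
    have "F (c # fscale h b # ds) = - F (fscale h b # c # ds)"
      by (rule cochain_swap[OF F V c Vh[OF b(1)] b(2)])
    also have "\<dots> = - fscale h (F (b # c # ds))" using Cons.prems(3)[of b "c # ds"] b c by simp
    also have "F (b # c # ds) = - F (c # b # ds)" by (rule cochain_swap[OF F V b(1) c b(2)])
    finally show "contract c F (fscale h b # ds) = fscale h (contract c F (b # ds))"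
      by (simp add: contract_def fscale_def fun_eq_iff)
  qed
  then show ?case by (simp add: contract_def)
qed (use s in simp)

lemma cochain_linear_on:
  assumes "cochain V W p F" "i < length as" "set as \<subseteq> V"
  shows "linear_on V (\<lambda>b. F (as[i := b]))"
proof -
  have "set (take i as) \<subseteq> V" "set (drop (Suc i) as) \<subseteq> V"
    using assms(3) set_take_subset[of i as] set_drop_subset[of "Suc i" as] by blast+
  from cochain_linear_at[OF assms(1) this] show ?thesis by (simp add: upd_conv_take_nth_drop assms(2))
qed

lemma multilinear_on_cochain:
  assumes W: "subspace W" and m: "multilinear_on n V F" and a: "alternating_on n n V F"
    and mem: "range F \<subseteq> W"
  shows "cochain V W n F"
  unfolding cochain_def
proof (intro conjI allI impI)
  fix as show "F as \<in> W" using mem by blast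
  show "F as = 0" if "even (length as) \<noteq> even n"
  proof -
    have "length as \<noteq> n" using that by auto
    then show ?thesis using m unfolding multilinear_on_def by blast
  qed
next
  fix bs as assume s: "set bs \<subseteq> V" "set as \<subseteq> V"
  show "linear_on V (\<lambda>a. F (bs @ a # as))"
  proof (cases "length (bs @ undefined # as) = n")
    case True
    show ?thesis
    \<comment> \<open>Multilinearity is formulated for lists over \<open>V\<close>, so some vector
      of \<open>V\<close> is needed to fill the slot that varies.\<close>
    proof (cases "V = {}")
      case False
      then obtain v where v: "v \<in> V" by blast
      have "length (bs @ v # as) = n \<and> set (bs @ v # as) \<subseteq> V" "length bs < n" using True s v by auto
      then have "linear_on V (\<lambda>b. F ((bs @ v # as)[length bs := b]))"
        using m unfolding multilinear_on_def by blast
      then show ?thesis by simp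
    qed (simp add: linear_on_def)
  next
    case False
    then have "F (bs @ a # as) = 0" for a using m unfolding multilinear_on_def by simp
    then show ?thesis by (simp add: linear_on_def)
  qed
next
  fix bs b as assume s: "set bs \<subseteq> V" "b \<in> V" "set as \<subseteq> V"
  show "F (bs @ b # b # as) = 0"
  proof (cases "length (bs @ b # b # as) = n")
    case True
    have "set (bs @ b # b # as) \<subseteq> V" "length bs < Suc (length bs)" "Suc (length bs) < n"
      "(bs @ b # b # as) ! length bs = (bs @ b # b # as) ! Suc (length bs)"
      using True s by (auto simp: nth_append)
    then show ?thesis using a True unfolding alternating_on_def by blast
  next
    case False
    then show ?thesis using m unfolding multilinear_on_def by blast
  qed
qed

section \<open>Pairings, homomorphisms and function-linear maps\<close>

context smooth_bundle
begin

lemma dual_sections_linear: "\<xi> \<in> dual_sections A \<Longrightarrow> linear_on (fibre A p) (\<xi> p)"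
  using dual_sections_fibre[of \<xi> p] by (simp add: dual_space_def)

lemma pairing_fscale: "\<xi> \<in> dual_sections A \<Longrightarrow> x \<in> sections A \<Longrightarrow> pairing \<xi> (fscale h x) = fscale h (pairing \<xi> x)"
  by (simp add: pairing_def fscale_def fun_eq_iff linear_on_scale[OF dual_sections_linear sections_fibre])

lemma pairing_add_right: "\<xi> \<in> dual_sections A \<Longrightarrow> x \<in> sections A \<Longrightarrow> y \<in> sections A
    \<Longrightarrow> pairing \<xi> (x + y) = pairing \<xi> x + pairing \<xi> y"
proof -
  assume \<xi>: "\<xi> \<in> dual_sections A" and "x \<in> sections A" "y \<in> sections A"
  from linear_on_add[OF dual_sections_linear[OF \<xi>] sections_fibre[OF \<open>x \<in> sections A\<close>] sections_fibre[OF \<open>y \<in> sections A\<close>]]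
  show ?thesis by (simp add: pairing_def fun_eq_iff)
qed

lemma pairing_scale_right: "\<xi> \<in> dual_sections A \<Longrightarrow> x \<in> sections A \<Longrightarrow> pairing \<xi> (c *\<^sub>R x) = c *\<^sub>R pairing \<xi> x"
  using pairing_fscale[of \<xi> x "\<lambda>_. c"] by (simp add: fscale_def scaleR_fun_def)

lemma pairing_diff_right: "\<xi> \<in> dual_sections A \<Longrightarrow> x \<in> sections A \<Longrightarrow> y \<in> sections A
    \<Longrightarrow> pairing \<xi> (x - y) = pairing \<xi> x - pairing \<xi> y"
  using pairing_add_right[of \<xi> "x - y" y] subspace_diff[OF subspace_sections, of x y] by simp

lemma pairing_left:
  "pairing (\<xi> + \<eta>) x = pairing \<xi> x + pairing \<eta> x" "pairing (\<xi> - \<eta>) x = pairing \<xi> x - pairing \<eta> x"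
  "pairing (c *\<^sub>R \<xi>) x = c *\<^sub>R pairing \<xi> x" "pairing (fscale h \<xi>) x = fscale h (pairing \<xi> x)"
  by (simp_all add: pairing_def fun_eq_iff scaleR_fun_def fscale_def)

lemma dual_sections_eqI:
  assumes "\<xi> \<in> dual_sections A" "\<eta> \<in> dual_sections A"
    "\<And>y. y \<in> sections A \<Longrightarrow> pairing \<xi> y = pairing \<eta> y"
  shows "\<xi> = \<eta>"
proof (intro ext)
  fix p v
  show "\<xi> p v = \<eta> p v"
  proof (cases "v \<in> fibre A p")
    case True
    then obtain y where y: "y \<in> sections A" "y p = v" by (rule section_through)
    then show ?thesis using fun_cong[OF assms(3)[OF y(1)], of p] by (simp add: pairing_def)
  next
    case False
    then show ?thesis
      using dual_sections_fibre[OF assms(1), of p] dual_sections_fibre[OF assms(2), of p]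
      by (simp add: dual_space_def)
  qed
qed

lemma sections_eqI:
  assumes "x \<in> sections A" "y \<in> sections A"
    "\<And>\<xi>. \<xi> \<in> dual_sections A \<Longrightarrow> pairing \<xi> x = pairing \<xi> y"
  shows "x = y"
proof
  fix p
  obtain U \<Phi> where t: "(U, \<Phi>) \<in> trivs A" and p: "p \<in> U" by (rule triv_at)
  show "x p = y p"
  proof (rule dual_separates[OF t p sections_fibre[OF assms(1)] sections_fibre[OF assms(2)]])
    fix \<beta> assume "\<beta> \<in> dual_space (fibre A p)"
    then obtain \<xi> where "\<xi> \<in> dual_sections A" "\<xi> p = \<beta>" by (rule dual_section_through)
    then show "\<beta> (x p) = \<beta> (y p)" using fun_cong[OF assms(3)[of \<xi>], of p] by (simp add: pairing_def)
  qed
qed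

text \<open>The value on a vector is the value of \<open>T\<close> on some section through it.
  Tensoriality makes this independent of the section, which gives linearity on fibres; near a point
  one section can be chosen that extends a frame vector, which gives smoothness.\<close>

lemma dual_section_of_functional:
  assumes T: "\<And>x. x \<in> sections A \<Longrightarrow> T x \<in> smooth_functions A" "linear_on (sections A) T"
    "\<And>h x. h \<in> smooth_functions A \<Longrightarrow> x \<in> sections A \<Longrightarrow> T (fscale h x) = fscale h (T x)"
  shows "\<exists>\<eta>. \<eta> \<in> dual_sections A \<and> (\<forall>y\<in>sections A. pairing \<eta> y = T y)"
proof -
  have eq: "T x p = T y p" if "x \<in> sections A" "y \<in> sections A" "x p = y p" for x y p
  proof -
    have "(x - y) p = 0" using that(3) by simp
    from tensorial_sections[OF T(2,3) subspace_diff[OF subspace_sections that(1,2)] this]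
    have "T (x - y) p = 0" .
    then show ?thesis using linear_on_diff[OF T(2) subspace_sections that(1,2)] by simp
  qed
  define ex where "ex = (\<lambda>p v. SOME x. x \<in> sections A \<and> x p = v)"
  have ex: "ex p v \<in> sections A" "ex p v p = v" if "v \<in> fibre A p" for p v
  proof -
    have "\<exists>x. x \<in> sections A \<and> x p = v" using section_through[OF that] by blast
    from someI_ex[OF this] show "ex p v \<in> sections A" "ex p v p = v" by (simp_all add: ex_def)
  qed
  define \<eta> where "\<eta> = (\<lambda>p v. if v \<in> fibre A p then T (ex p v) p else 0)"
  have \<eta>: "\<eta> p (y p) = T y p" if "y \<in> sections A" for y p
    using eq[OF ex(1) that ex(2)] sections_fibre[OF that] by (simp add: \<eta>_def)
  have "\<eta> \<in> dual_sections A"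
  proof (rule dual_sectionsI)
    fix p
    have "linear_on (fibre A p) (\<eta> p)"
    proof (rule linear_onI_lincomb[OF _ subspace_fibre])
      fix v w c assume vw: "v \<in> fibre A p" "w \<in> fibre A p"
      obtain x where x: "x \<in> sections A" "x p = v" using vw(1) by (rule section_through)
      obtain y where y: "y \<in> sections A" "y p = w" using vw(2) by (rule section_through)
      have xy: "x + c *\<^sub>R y \<in> sections A" using x y by (simp add: subspace_add subspace_scale subspace_sections)
      show "\<eta> p (v + c *\<^sub>R w) = \<eta> p v + c *\<^sub>R \<eta> p w"
        using \<eta>[OF x(1), of p] \<eta>[OF y(1), of p] \<eta>[OF xy, of p] x y
          linear_on_lincomb[OF T(2) subspace_sections x(1) y(1), of c]
        by (simp add: scaleR_fun_def)
    qed
    then show "\<eta> p \<in> dual_space (fibre A p)" by (simp add: dual_space_def \<eta>_def)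
  next
    fix U \<Phi> w assume t: "(U, \<Phi>) \<in> trivs A"
    show "mfd_smooth_on A U (\<lambda>p. \<eta> p (frame \<Phi> p w))"
    proof (rule mfd_smooth_on_local[OF manifold])
      fix p assume p: "p \<in> U"
      obtain N where N: "open N" "p \<in> N" "N \<subseteq> U" "\<And>w. \<exists>x\<in>sections A. \<forall>q\<in>N. x q = frame \<Phi> q w"
        by (rule local_frame[OF t p]) (rule that)
      from N(4)[of w] obtain x where x: "x \<in> sections A" "\<forall>q\<in>N. x q = frame \<Phi> q w" by (rule bexE)
      have "mfd_smooth_on A N (\<lambda>p. \<eta> p (frame \<Phi> p w))"
        by (rule mfd_smooth_on_cong[OF manifold N(1) _ smooth_functions_on[OF T(1)[OF x(1)]]])
          (simp add: \<eta>[OF x(1), symmetric] x(2)[rule_format])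
      then show "\<exists>N. open N \<and> p \<in> N \<and> mfd_smooth_on A (U \<inter> N) (\<lambda>p. \<eta> p (frame \<Phi> p w))"
        using N(1-3) by (intro exI[of _ N]) (simp add: Int_absorb1)
    qed
  qed
  then show ?thesis using \<eta> by (intro exI[of _ \<eta>]) (simp add: pairing_def fun_eq_iff)
qed

lemma hom_sections_fibrewise:
  assumes "P \<in> hom_sections A k"
  shows hom_sections_multilinear: "multilinear_on k (dual_space (fibre A p)) (P p)"
    and hom_sections_alternating: "alternating_on k k (dual_space (fibre A p)) (P p)"
    and hom_sections_mem: "P p as \<in> fibre A p"
    and hom_sections_length: "length as \<noteq> k \<Longrightarrow> P p as = 0"
    and hom_sections_cochain: "cochain (dual_space (fibre A p)) (fibre A p) k (P p)"
proof -
  show m: "multilinear_on k (dual_space (fibre A p)) (P p)"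
    and a: "alternating_on k k (dual_space (fibre A p)) (P p)" and "P p as \<in> fibre A p"
    using assms by (auto simp: hom_sections_def)
  show "length as \<noteq> k \<Longrightarrow> P p as = 0"
    using m unfolding multilinear_on_def by blast
  show "cochain (dual_space (fibre A p)) (fibre A p) k (P p)"
    by (rule multilinear_on_cochain[OF subspace_fibre m a]) (use assms in \<open>simp add: hom_sections_def\<close>)
qed

lemma hom_sections_smooth:
  assumes "P \<in> hom_sections A k" "(U, \<Phi>) \<in> trivs A" "length ws = k"
  shows "mfd_smooth_on A U (\<lambda>p. \<Phi> p (P p (map (const_covector A \<Phi> p) ws)))"
proof -
  have "\<forall>(U, \<Phi>)\<in>trivs A. \<forall>ws. length ws = k \<longrightarrow>
        mfd_smooth_on A U (\<lambda>p. \<Phi> p (P p (map (const_covector A \<Phi> p) ws)))"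
    using assms(1) by (simp add: hom_sections_def)
  from bspec[OF this assms(2)] show ?thesis using assms(3) by simp
qed

lemma set_map_dual: "set \<alpha>s \<subseteq> dual_sections A \<Longrightarrow> set (map (\<lambda>\<alpha>. \<alpha> p) \<alpha>s) \<subseteq> dual_space (fibre A p)"
  using dual_sections_fibre by auto

lemma eval_at_sections:
  assumes P: "P \<in> hom_sections A k" and s: "set \<alpha>s \<subseteq> dual_sections A"
  shows "eval_at P \<alpha>s \<in> sections A"
proof (cases "length \<alpha>s = k")
  case False
  then have "eval_at P \<alpha>s = 0" using hom_sections_length[OF P] by (simp add: eval_at_def fun_eq_iff)
  then show ?thesis by (simp add: subspace_0[OF subspace_sections])
next
  case True
  show ?thesis
  proof (rule sectionsI)
    show "eval_at P \<alpha>s p \<in> fibre A p" for p by (simp add: eval_at_def hom_sections_mem[OF P])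
    fix U \<Phi> assume t: "(U, \<Phi>) \<in> trivs A"
    note M = manifold triv_open[OF t]
    have "mfd_smooth_on A U (\<lambda>p. \<Phi> p (P p (map (\<lambda>\<alpha>. \<alpha> p) \<alpha>s @ map (const_covector A \<Phi> p) ws)))"
      if "length \<alpha>s + length ws = k" for ws
      using s that
    proof (induction \<alpha>s arbitrary: ws rule: rev_induct)
      case Nil
      then show ?case using hom_sections_smooth[OF P t] by simp
    next
      case (snoc \<beta> \<alpha>s)
      have \<beta>: "\<beta> \<in> dual_sections A" and s: "set \<alpha>s \<subseteq> dual_sections A" using snoc.prems(1) by auto
      have "mfd_smooth_on A U (\<lambda>p. \<Sum>b\<in>onb. \<beta> p (frame \<Phi> p b) *\<^sub>R
         \<Phi> p (P p (map (\<lambda>\<alpha>. \<alpha> p) \<alpha>s @ map (const_covector A \<Phi> p) (b # ws))))"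
        by (intro mfd_smooth_on_sum[OF M] mfd_smooth_on_scaleR[OF M] dual_sections_smooth[OF \<beta> t] snoc.IH[OF s])
          (use snoc.prems(2) in simp)
      then show ?case
      proof (rule mfd_smooth_on_cong[OF M, rotated])
        fix p assume p: "p \<in> U"
        let ?V = "dual_space (fibre A p)"
        let ?F = "\<lambda>c. P p (map (\<lambda>\<alpha>. \<alpha> p) \<alpha>s @ c # map (const_covector A \<Phi> p) ws)"
        have "set (map (const_covector A \<Phi> p) ws) \<subseteq> ?V" using const_covector_mem[OF t p] by auto
        from cochain_linear_at[OF hom_sections_cochain[OF P] set_map_dual[OF s] this]
        have lin: "linear_on ?V ?F" .
        have cm: "const_covector A \<Phi> p b \<in> ?V" for b by (rule const_covector_mem[OF t p])
        have "?F (\<beta> p) = ?F (\<Sum>b\<in>onb. \<beta> p (frame \<Phi> p b) *\<^sub>R const_covector A \<Phi> p b)"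
          by (simp add: const_covector_expand[OF t p dual_sections_fibre[OF \<beta>]])
        also have "\<dots> = (\<Sum>b\<in>onb. ?F (\<beta> p (frame \<Phi> p b) *\<^sub>R const_covector A \<Phi> p b))"
          by (rule linear_on_sum[OF lin subspace_dual_space subspace_scale[OF subspace_dual_space cm]])
        also have "\<dots> = (\<Sum>b\<in>onb. \<beta> p (frame \<Phi> p b) *\<^sub>R ?F (const_covector A \<Phi> p b))"
          by (rule sum.cong[OF refl], rule linear_on_scale[OF lin cm])
        finally have *: "?F (\<beta> p) = (\<Sum>b\<in>onb. \<beta> p (frame \<Phi> p b) *\<^sub>R ?F (const_covector A \<Phi> p b))" .
        have "\<Phi> p (?F (\<beta> p)) = (\<Sum>b\<in>onb. \<Phi> p (\<beta> p (frame \<Phi> p b) *\<^sub>R ?F (const_covector A \<Phi> p b)))"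
          unfolding * by (rule linear_on_sum[OF triv_linear[OF t p] subspace_fibre
              subspace_scale[OF subspace_fibre hom_sections_mem[OF P]]])
        also have "\<dots> = (\<Sum>b\<in>onb. \<beta> p (frame \<Phi> p b) *\<^sub>R \<Phi> p (?F (const_covector A \<Phi> p b)))"
          by (rule sum.cong[OF refl], rule linear_on_scale[OF triv_linear[OF t p] hom_sections_mem[OF P]])
        finally show "(\<Sum>b\<in>onb. \<beta> p (frame \<Phi> p b) *\<^sub>R
           \<Phi> p (P p (map (\<lambda>\<alpha>. \<alpha> p) \<alpha>s @ map (const_covector A \<Phi> p) (b # ws))))
          = \<Phi> p (P p (map (\<lambda>\<alpha>. \<alpha> p) (\<alpha>s @ [\<beta>]) @ map (const_covector A \<Phi> p) ws))" by simp
      qed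
    qed
    from this[of "[]"] show "mfd_smooth_on A U (\<lambda>p. \<Phi> p (eval_at P \<alpha>s p))" using True by (simp add: eval_at_def)
  qed
qed

lemma cochain_eval_at:
  assumes P: "P \<in> hom_sections A k"
  shows "cochain (dual_sections A) (sections A) k (eval_at P)"
  unfolding cochain_def
proof (intro conjI allI impI)
  fix \<alpha>s assume s: "set \<alpha>s \<subseteq> dual_sections A"
  show "eval_at P \<alpha>s \<in> sections A" by (rule eval_at_sections[OF P s])
  show "eval_at P \<alpha>s = 0" if "even (length \<alpha>s) \<noteq> even k"
  proof -
    have "length \<alpha>s \<noteq> k" using that by auto
    then show ?thesis using hom_sections_length[OF P] by (simp add: eval_at_def fun_eq_iff)
  qed
next
  fix \<beta>s \<alpha>s assume s: "set \<beta>s \<subseteq> dual_sections A" "set \<alpha>s \<subseteq> dual_sections A"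
  show "linear_on (dual_sections A) (\<lambda>\<gamma>. eval_at P (\<beta>s @ \<gamma> # \<alpha>s))"
  proof (rule linear_onI_lincomb[OF _ subspace_dual_sections])
    fix \<gamma> \<delta> c assume g: "\<gamma> \<in> dual_sections A" "\<delta> \<in> dual_sections A"
    show "eval_at P (\<beta>s @ (\<gamma> + c *\<^sub>R \<delta>) # \<alpha>s) = eval_at P (\<beta>s @ \<gamma> # \<alpha>s) + c *\<^sub>R eval_at P (\<beta>s @ \<delta> # \<alpha>s)"
    proof
      fix p
      from linear_on_lincomb[OF cochain_linear_at[OF hom_sections_cochain[OF P] set_map_dual[OF s(1)] set_map_dual[OF s(2)]]
          subspace_dual_space dual_sections_fibre[OF g(1)] dual_sections_fibre[OF g(2)], of p c]
      show "eval_at P (\<beta>s @ (\<gamma> + c *\<^sub>R \<delta>) # \<alpha>s) p = (eval_at P (\<beta>s @ \<gamma> # \<alpha>s) + c *\<^sub>R eval_at P (\<beta>s @ \<delta> # \<alpha>s)) p"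
        by (simp add: eval_at_def scaleR_fun_def)
    qed
  qed
next
  fix \<beta>s \<gamma> \<alpha>s assume s: "set \<beta>s \<subseteq> dual_sections A" "\<gamma> \<in> dual_sections A" "set \<alpha>s \<subseteq> dual_sections A"
  show "eval_at P (\<beta>s @ \<gamma> # \<gamma> # \<alpha>s) = 0"
    using cochain_alt_at[OF hom_sections_cochain[OF P] set_map_dual[OF s(1)] dual_sections_fibre[OF s(2)] set_map_dual[OF s(3)]]
    by (simp add: eval_at_def fun_eq_iff)
qed

lemma eval_at_fscale:
  assumes P: "P \<in> hom_sections A k" and s: "\<gamma> \<in> dual_sections A" "set \<alpha>s \<subseteq> dual_sections A"
  shows "eval_at P (fscale h \<gamma> # \<alpha>s) = fscale h (eval_at P (\<gamma> # \<alpha>s))"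
proof
  fix p
  from linear_on_scale[OF cochain_linear[OF hom_sections_cochain[OF P] set_map_dual[OF s(2)]] dual_sections_fibre[OF s(1)], of p "h p"]
  show "eval_at P (fscale h \<gamma> # \<alpha>s) p = fscale h (eval_at P (\<gamma> # \<alpha>s)) p"
    by (simp add: eval_at_def fscale_def)
qed

text \<open>Every list of covectors at a point is the value of a list of dual sections; on all other
  lists both maps are 0 by convention.\<close>

lemma hom_sections_eqI:
  assumes P: "P \<in> hom_sections A k" and Q: "Q \<in> hom_sections A k"
    and eq: "\<And>\<alpha>s. set \<alpha>s \<subseteq> dual_sections A \<Longrightarrow> length \<alpha>s = k \<Longrightarrow> eval_at P \<alpha>s = eval_at Q \<alpha>s"
  shows "P = Q"
proof (intro ext)
  fix p as
  show "P p as = Q p as"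
  proof (cases "length as = k \<and> set as \<subseteq> dual_space (fibre A p)")
    case True
    have "\<exists>\<alpha>s. set \<alpha>s \<subseteq> dual_sections A \<and> map (\<lambda>\<alpha>. \<alpha> p) \<alpha>s = as"
      using conjunct2[OF True]
    proof (induction as)
      case (Cons a as)
      then obtain \<alpha>s where 1: "set \<alpha>s \<subseteq> dual_sections A" "map (\<lambda>\<alpha>. \<alpha> p) \<alpha>s = as" by auto
      have "a \<in> dual_space (fibre A p)" using Cons.prems by simp
      then obtain \<xi> where "\<xi> \<in> dual_sections A" "\<xi> p = a" by (rule dual_section_through)
      then show ?case using 1 by (intro exI[of _ "\<xi> # \<alpha>s"]) simp
    qed simp
    then obtain \<alpha>s where s: "set \<alpha>s \<subseteq> dual_sections A" and as: "map (\<lambda>\<alpha>. \<alpha> p) \<alpha>s = as" by blast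
    have "length \<alpha>s = k" using True as by auto
    from fun_cong[OF eq[OF s this], of p] show ?thesis by (simp add: eval_at_def as)
  next
    case False
    then show ?thesis
      using hom_sections_multilinear[OF P, of p] hom_sections_multilinear[OF Q, of p]
      unfolding multilinear_on_def by (metis (no_types, lifting))
  qed
qed

text \<open>The converse of \<open>cochain_eval_at\<close>: function-linearity turns an operation on
  sections into one on fibres. The cochain knows only the parity of its degree, so \<open>R\<close>
  picks out its component on lists of length \<open>k\<close>.\<close>

lemma hom_section_of_cochain:
  assumes T: "cochain (dual_sections A) (sections A) d T"
    and TC: "\<And>h \<gamma> \<alpha>s. h \<in> smooth_functions A \<Longrightarrow> \<gamma> \<in> dual_sections A \<Longrightarrow> set \<alpha>s \<subseteq> dual_sections A
      \<Longrightarrow> T (fscale h \<gamma> # \<alpha>s) = fscale h (T (\<gamma> # \<alpha>s))"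
  shows "\<exists>R\<in>hom_sections A k. \<forall>\<alpha>s. set \<alpha>s \<subseteq> dual_sections A \<and> length \<alpha>s = k \<longrightarrow> eval_at R \<alpha>s = T \<alpha>s"
proof -
  have TC': "T (\<beta>s @ fscale h \<gamma> # \<alpha>s) = fscale h (T (\<beta>s @ \<gamma> # \<alpha>s))"
    if "h \<in> smooth_functions A" "set \<beta>s \<subseteq> dual_sections A" "\<gamma> \<in> dual_sections A" "set \<alpha>s \<subseteq> dual_sections A"
    for h \<beta>s \<gamma> \<alpha>s
    by (rule cochain_fscale_at[OF subspace_dual_sections fscale_dual_sections[OF that(1)] T TC[OF that(1)] that(2-4)])
  have eq1: "T (\<beta>s @ \<gamma> # \<alpha>s) p = T (\<beta>s @ \<delta> # \<alpha>s) p"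
    if s: "set \<beta>s \<subseteq> dual_sections A" "\<gamma> \<in> dual_sections A" "\<delta> \<in> dual_sections A"
      "set \<alpha>s \<subseteq> dual_sections A" "\<gamma> p = \<delta> p" for \<beta>s \<gamma> \<delta> \<alpha>s p
  proof -
    note lin = cochain_linear_at[OF T s(1) s(4)]
    have "(\<gamma> - \<delta>) p = 0" using s(5) by simp
    from tensorial_dual[OF lin TC'[OF _ s(1) _ s(4)] subspace_diff[OF subspace_dual_sections s(2,3)] this]
    have "(\<lambda>\<gamma>. T (\<beta>s @ \<gamma> # \<alpha>s)) (\<gamma> - \<delta>) p = 0" .
    then show ?thesis using linear_on_diff[OF lin subspace_dual_sections s(2,3)] by simp
  qed
  \<comment> \<open>The arguments are exchanged one by one from the left; \<open>\<gamma>s\<close>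
    collects those that are already exchanged.\<close>
  have eq: "T (\<gamma>s @ \<alpha>s) p = T (\<gamma>s @ \<beta>s) p"
    if "set \<gamma>s \<subseteq> dual_sections A" "set \<alpha>s \<subseteq> dual_sections A" "set \<beta>s \<subseteq> dual_sections A"
      "map (\<lambda>\<alpha>. \<alpha> p) \<alpha>s = map (\<lambda>\<alpha>. \<alpha> p) \<beta>s" for \<alpha>s \<beta>s \<gamma>s p
    using map_eq_imp_length_eq[OF that(4)] that
  proof (induction \<alpha>s \<beta>s arbitrary: \<gamma>s rule: list_induct2)
    case (Cons a \<alpha>s b \<beta>s)
    have "T (\<gamma>s @ a # \<alpha>s) p = T (\<gamma>s @ b # \<alpha>s) p" using Cons.prems by (intro eq1) auto
    also have "\<dots> = T (\<gamma>s @ b # \<beta>s) p" using Cons.IH[of "\<gamma>s @ [b]"] Cons.prems by simp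
    finally show ?case .
  qed simp
  define ex where "ex = (\<lambda>p v. SOME x. x \<in> dual_sections A \<and> x p = v)"
  have ex: "ex p v \<in> dual_sections A" "ex p v p = v" if "v \<in> dual_space (fibre A p)" for p v
  proof -
    have "\<exists>x. x \<in> dual_sections A \<and> x p = v" using dual_section_through[OF that] by blast
    from someI_ex[OF this] show "ex p v \<in> dual_sections A" "ex p v p = v" by (simp_all add: ex_def)
  qed
  define R where "R = (\<lambda>p as. if length as = k \<and> set as \<subseteq> dual_space (fibre A p) then T (map (ex p) as) p else 0)"
  have exs: "set (map (ex p) as) \<subseteq> dual_sections A" "map (\<lambda>\<alpha>. \<alpha> p) (map (ex p) as) = as"
    if "set as \<subseteq> dual_space (fibre A p)" for p as
    using that ex by (auto simp: map_idI subset_iff)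
  have R: "R p (map (\<lambda>\<alpha>. \<alpha> p) \<alpha>s) = T \<alpha>s p" if s: "set \<alpha>s \<subseteq> dual_sections A" "length \<alpha>s = k" for \<alpha>s p
    using eq[OF _ exs(1)[OF set_map_dual[OF s(1)]] s(1) exs(2)[OF set_map_dual[OF s(1)]], of "[]"]
      set_map_dual[OF s(1), of p] s(2) by (simp add: R_def)
  have "R \<in> hom_sections A k"
    unfolding hom_sections_def
  proof (intro CollectI conjI allI ballI)
    fix p
    let ?V = "dual_space (fibre A p)"
    show "multilinear_on k ?V (R p)"
      unfolding multilinear_on_def
    proof (intro conjI allI impI)
      fix as i assume as: "length as = k \<and> set as \<subseteq> ?V" and i: "i < k"
      \<comment> \<open>The chosen extension of a sum need not be the sum of the chosen extensions.
        Any section through the vector may be used in place of the chosen one, which makes linearity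
        of \<open>T\<close> applicable.\<close>
      have iu: "R p (as[i := v]) = T ((map (ex p) as)[i := \<xi>]) p"
        if "\<xi> \<in> dual_sections A" "\<xi> p = v" for v \<xi>
      proof -
        have "set ((map (ex p) as)[i := \<xi>]) \<subseteq> dual_sections A"
          using that(1) exs(1)[of as p] as by (meson set_update_subsetI)
        from R[OF this, of p] have "R p ((map (\<lambda>\<alpha>. \<alpha> p) (map (ex p) as))[i := \<xi> p]) = T ((map (ex p) as)[i := \<xi>]) p"
          using as by (simp add: map_update)
        then show ?thesis using exs(2)[of as p] as that(2) by simp
      qed
      note lin = cochain_linear_on[OF T, of i "map (ex p) as"]
      show "linear_on ?V (\<lambda>b. R p (as[i := b]))"
      proof (rule linear_onI_lincomb[OF _ subspace_dual_space])
        fix v w c assume "v \<in> ?V" "w \<in> ?V"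
        obtain \<xi> where x: "\<xi> \<in> dual_sections A" "\<xi> p = v" using \<open>v \<in> ?V\<close> by (rule dual_section_through)
        obtain \<eta> where y: "\<eta> \<in> dual_sections A" "\<eta> p = w" using \<open>w \<in> ?V\<close> by (rule dual_section_through)
        have xy: "\<xi> + c *\<^sub>R \<eta> \<in> dual_sections A"
          using x y by (simp add: subspace_add subspace_scale subspace_dual_sections)
        have "linear_on (dual_sections A) (\<lambda>b. T ((map (ex p) as)[i := b]))"
          by (rule lin) (use as i exs(1)[of as p] in simp_all)
        from linear_on_lincomb[OF this subspace_dual_sections x(1) y(1), of c]
        show "R p (as[i := v + c *\<^sub>R w]) = R p (as[i := v]) + c *\<^sub>R R p (as[i := w])"
          using iu[OF x] iu[OF y] iu[OF xy, of "v + c *\<^sub>R w"] x y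
          by (simp add: scaleR_fun_def)
      qed
    next
      fix as assume "\<not> (length as = k \<and> set as \<subseteq> ?V)"
      then show "R p as = 0" by (simp only: R_def if_False)
    qed
    show "alternating_on k k ?V (R p)"
      unfolding alternating_on_def
    proof (intro allI impI)
      fix as i j assume h: "length as = k \<and> set as \<subseteq> ?V \<and> i < j \<and> j < k \<and> as ! i = as ! j"
      have "T (map (ex p) as) = 0"
        by (rule cochain_repeat_0[OF subspace_dual_sections T exs(1), of as p i j]) (use h in auto)
      then show "R p as = 0" using h by (simp add: R_def)
    qed
    show "range (R p) \<subseteq> fibre A p"
      using sections_fibre[OF cochain_mem[OF T exs(1)]] subspace_0[OF subspace_fibre]
      by (auto simp: R_def)
  next
    fix t assume "t \<in> trivs A"
    obtain U \<Phi> where tt: "t = (U, \<Phi>)" by (cases t)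
    then have t: "(U, \<Phi>) \<in> trivs A" using \<open>t \<in> trivs A\<close> by simp
    have "mfd_smooth_on A U (\<lambda>p. \<Phi> p (R p (map (const_covector A \<Phi> p) ws)))" if ws: "length ws = k" for ws
    proof (rule mfd_smooth_on_local[OF manifold])
      fix p assume p: "p \<in> U"
      obtain N where N: "open N" "p \<in> N" "N \<subseteq> U" "\<And>w. \<exists>\<xi>\<in>dual_sections A. \<forall>q\<in>N. \<xi> q = const_covector A \<Phi> q w"
        by (rule local_frame[OF t p]) (rule that)
      from N(4) have "\<forall>w. \<exists>\<xi>. \<xi> \<in> dual_sections A \<and> (\<forall>q\<in>N. \<xi> q = const_covector A \<Phi> q w)" by fast
      then obtain e where e: "\<And>w. e w \<in> dual_sections A" "\<And>w q. q \<in> N \<Longrightarrow> e w q = const_covector A \<Phi> q w" by metis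
      have es: "set (map e ws) \<subseteq> dual_sections A" using e(1) by auto
      have "mfd_smooth_on A N (\<lambda>p. \<Phi> p (R p (map (const_covector A \<Phi> p) ws)))"
      proof (rule mfd_smooth_on_cong[OF manifold N(1) _
            mfd_smooth_on_subset[OF sections_smooth[OF cochain_mem[OF T es] t] N(3)]])
        fix q assume q: "q \<in> N"
        have *: "map (const_covector A \<Phi> q) ws = map (\<lambda>\<alpha>. \<alpha> q) (map e ws)" using e(2)[OF q] by simp
        show "\<Phi> q (T (map e ws) q) = \<Phi> q (R q (map (const_covector A \<Phi> q) ws))"
          unfolding * using R[OF es, of q] ws by simp
      qed
      then show "\<exists>N. open N \<and> p \<in> N \<and> mfd_smooth_on A (U \<inter> N) (\<lambda>p. \<Phi> p (R p (map (const_covector A \<Phi> p) ws)))"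
        using N(1-3) by (intro exI[of _ N]) (simp add: Int_absorb1)
    qed
    then show "case t of (U, \<Phi>) \<Rightarrow> \<forall>ws. length ws = k \<longrightarrow>
        mfd_smooth_on A U (\<lambda>p. \<Phi> p (R p (map (const_covector A \<Phi> p) ws)))" by (simp add: tt)
  qed
  then show ?thesis using R by (intro bexI[of _ R]) (simp_all add: eval_at_def fun_eq_iff)
qed

text \<open>Reflexivity of a finite-dimensional space: the representing vector has the components
  \<open>F (const_covector A \<Phi> p b)\<close> in the frame, and covectors separate
  vectors.\<close>

lemma bidual_vector_spec:
  assumes F: "linear_on (dual_space (fibre A p)) F"
  shows "bidual_vector (fibre A p) F \<in> fibre A p
    \<and> (\<forall>\<beta>\<in>dual_space (fibre A p). \<beta> (bidual_vector (fibre A p) F) = F \<beta>)"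
  unfolding bidual_vector_def
proof (rule theI')
  obtain U \<Phi> where t: "(U, \<Phi>) \<in> trivs A" and p: "p \<in> U" by (rule triv_at)
  let ?V = "dual_space (fibre A p)"
  define v where "v = (\<Sum>b\<in>onb. F (const_covector A \<Phi> p b) *\<^sub>R frame \<Phi> p b)"
  note cm = const_covector_mem[OF t p] and fm = frame_mem[OF t p]
  have v: "v \<in> fibre A p"
    unfolding v_def by (intro subspace_sum[OF subspace_fibre] subspace_scale[OF subspace_fibre] fm)
  have "\<beta> v = F \<beta>" if \<beta>: "\<beta> \<in> ?V" for \<beta>
  proof -
    have lin: "linear_on (fibre A p) \<beta>" using \<beta> by (simp add: dual_space_def)
    have "\<beta> v = (\<Sum>b\<in>onb. \<beta> (F (const_covector A \<Phi> p b) *\<^sub>R frame \<Phi> p b))"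
      unfolding v_def by (rule linear_on_sum[OF lin subspace_fibre subspace_scale[OF subspace_fibre fm]])
    also have "\<dots> = (\<Sum>b\<in>onb. \<beta> (frame \<Phi> p b) *\<^sub>R F (const_covector A \<Phi> p b))"
      by (rule sum.cong[OF refl]) (simp add: linear_on_scale[OF lin fm])
    also have "\<dots> = (\<Sum>b\<in>onb. F (\<beta> (frame \<Phi> p b) *\<^sub>R const_covector A \<Phi> p b))"
      by (rule sum.cong[OF refl], rule linear_on_scale[OF F cm, symmetric])
    also have "\<dots> = F (\<Sum>b\<in>onb. \<beta> (frame \<Phi> p b) *\<^sub>R const_covector A \<Phi> p b)"
      by (rule linear_on_sum[OF F subspace_dual_space subspace_scale[OF subspace_dual_space cm], symmetric])
    finally show ?thesis by (simp add: const_covector_expand[OF t p \<beta>])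
  qed
  then show "\<exists>!v. v \<in> fibre A p \<and> (\<forall>\<beta>\<in>?V. \<beta> v = F \<beta>)"
    using v dual_separates[OF t p] by (intro ex1I[of _ v]) auto
qed

lemma fibre_eqI:
  assumes "v \<in> fibre A p" "v' \<in> fibre A p" "\<And>\<beta>. \<beta> \<in> dual_space (fibre A p) \<Longrightarrow> \<beta> v = \<beta> v'"
  shows "v = v'"
proof -
  obtain U \<Phi> where t: "(U, \<Phi>) \<in> trivs A" and p: "p \<in> U" by (rule triv_at)
  show ?thesis by (rule dual_separates[OF t p assms])
qed

section \<open>Tensors as homomorphisms\<close>

lemma tensor_sections_fibrewise:
  assumes "\<phi> \<in> tensor_sections A k"
  shows tensor_multilinear: "multilinear_on (k + 1) (dual_space (fibre A p)) (\<phi> p)"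
    and tensor_alternating: "alternating_on (k + 1) k (dual_space (fibre A p)) (\<phi> p)"
  using assms by (simp_all add: tensor_sections_def)

lemma tensor_smooth:
  assumes "\<phi> \<in> tensor_sections A k" "(U, \<Phi>) \<in> trivs A" "length ws = k + 1"
  shows "mfd_smooth_on A U (\<lambda>p. \<phi> p (map (const_covector A \<Phi> p) ws))"
proof -
  have "\<forall>(U, \<Phi>)\<in>trivs A. \<forall>ws. length ws = k + 1 \<longrightarrow>
        mfd_smooth_on A U (\<lambda>p. \<phi> p (map (const_covector A \<Phi> p) ws))"
    using assms(1) by (simp add: tensor_sections_def)
  from bspec[OF this assms(2)] show ?thesis using assms(3) by simp
qed

lemma multilinear_onD:
  "multilinear_on n V f \<Longrightarrow> length as = n \<Longrightarrow> set as \<subseteq> V \<Longrightarrow> i < n \<Longrightarrow> linear_on V (\<lambda>b. f (as[i := b]))"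
  and multilinear_on_0: "multilinear_on n V f \<Longrightarrow> \<not> (length as = n \<and> set as \<subseteq> V) \<Longrightarrow> f as = 0"
  unfolding multilinear_on_def by blast+

lemma tensor_linear_last:
  assumes "\<phi> \<in> tensor_sections A k"
  shows "linear_on (dual_space (fibre A p)) (\<lambda>\<beta>. \<phi> p (as @ [\<beta>]))"
proof (cases "length as = k \<and> set as \<subseteq> dual_space (fibre A p)")
  case True
  have "linear_on (dual_space (fibre A p)) (\<lambda>b. \<phi> p ((as @ [0])[k := b]))"
    by (rule multilinear_onD[OF tensor_multilinear[OF assms]])
      (use True in \<open>auto simp: subspace_0[OF subspace_dual_space]\<close>)
  then show ?thesis using True by (simp add: list_update_append)
next
  case False
  have "\<phi> p (as @ [\<beta>]) = 0" for \<beta>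
    by (rule multilinear_on_0[OF tensor_multilinear[OF assms]]) (use False in auto)
  then show ?thesis by (simp add: linear_on_def)
qed

lemma Psi_mem: "\<phi> \<in> tensor_sections A k \<Longrightarrow> Psi A \<phi> p as \<in> fibre A p"
  and Psi_apply: "\<phi> \<in> tensor_sections A k \<Longrightarrow> \<beta> \<in> dual_space (fibre A p)
    \<Longrightarrow> \<beta> (Psi A \<phi> p as) = \<phi> p (as @ [\<beta>])"
  unfolding Psi_def using bidual_vector_spec[OF tensor_linear_last] by blast+

lemma dual_space_linear: "\<beta> \<in> dual_space W \<Longrightarrow> linear_on W \<beta>"
  by (simp add: dual_space_def)

lemma dual_space_0: "\<beta> \<in> dual_space (fibre A p) \<Longrightarrow> \<beta> 0 = 0"
  using linear_on_0[OF dual_space_linear subspace_fibre] .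

text \<open>Every fibrewise property is tested against covectors \<beta>, which turn values of
  \<open>Psi A \<phi>\<close> back into values of \<open>\<phi>\<close> with \<beta>
  appended.\<close>

lemma Psi_hom_sections:
  assumes \<phi>: "\<phi> \<in> tensor_sections A k"
  shows "Psi A \<phi> \<in> hom_sections A k"
  unfolding hom_sections_def
proof (intro CollectI conjI allI ballI)
  fix p
  let ?V = "dual_space (fibre A p)"
  note m = Psi_mem[OF \<phi>] and P = Psi_apply[OF \<phi>]
  show "multilinear_on k ?V (Psi A \<phi> p)"
    unfolding multilinear_on_def
  proof (intro conjI allI impI)
    fix as i assume as: "length as = k \<and> set as \<subseteq> ?V" and i: "i < k"
    show "linear_on ?V (\<lambda>b. Psi A \<phi> p (as[i := b]))"
    proof (rule linear_onI_lincomb[OF _ subspace_dual_space])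
      fix \<gamma> \<delta> c assume g: "\<gamma> \<in> ?V" "\<delta> \<in> ?V"
      show "Psi A \<phi> p (as[i := \<gamma> + c *\<^sub>R \<delta>]) = Psi A \<phi> p (as[i := \<gamma>]) + c *\<^sub>R Psi A \<phi> p (as[i := \<delta>])"
      proof (rule fibre_eqI[OF m])
        fix \<beta> assume \<beta>: "\<beta> \<in> ?V"
        have "linear_on ?V (\<lambda>b. \<phi> p ((as @ [\<beta>])[i := b]))"
          by (rule multilinear_onD[OF tensor_multilinear[OF \<phi>]]) (use as i \<beta> in auto)
        then have "linear_on ?V (\<lambda>b. \<phi> p (as[i := b] @ [\<beta>]))"
          using as i by (simp add: list_update_append)
        from linear_on_lincomb[OF this subspace_dual_space g, of c]
        show "\<beta> (Psi A \<phi> p (as[i := \<gamma> + c *\<^sub>R \<delta>])) = \<beta> (Psi A \<phi> p (as[i := \<gamma>]) + c *\<^sub>R Psi A \<phi> p (as[i := \<delta>]))"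
          using linear_on_lincomb[OF dual_space_linear[OF \<beta>] subspace_fibre m m] by (simp add: P[OF \<beta>])
      qed (intro subspace_add[OF subspace_fibre] subspace_scale[OF subspace_fibre] m)
    qed
  next
    fix as assume "\<not> (length as = k \<and> set as \<subseteq> ?V)"
    then have "\<phi> p (as @ [\<beta>]) = 0" for \<beta>
      by (intro multilinear_on_0[OF tensor_multilinear[OF \<phi>]]) auto
    then show "Psi A \<phi> p as = 0"
      by (intro fibre_eqI[OF m subspace_0[OF subspace_fibre]]) (simp add: P dual_space_0)
  qed
  show "alternating_on k k ?V (Psi A \<phi> p)"
    unfolding alternating_on_def
  proof (intro allI impI)
    fix as i j assume h: "length as = k \<and> set as \<subseteq> ?V \<and> i < j \<and> j < k \<and> as ! i = as ! j"
    have "\<phi> p (as @ [\<beta>]) = 0" if "\<beta> \<in> ?V" for \<beta>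
    proof -
      have "length (as @ [\<beta>]) = k + 1 \<and> set (as @ [\<beta>]) \<subseteq> ?V \<and> i < j \<and> j < k \<and> (as @ [\<beta>]) ! i = (as @ [\<beta>]) ! j"
        using h that by (simp add: nth_append)
      then show ?thesis using tensor_alternating[OF \<phi>, of p] unfolding alternating_on_def by blast
    qed
    then show "Psi A \<phi> p as = 0"
      by (intro fibre_eqI[OF m subspace_0[OF subspace_fibre]]) (simp add: P dual_space_0)
  qed
  show "range (Psi A \<phi> p) \<subseteq> fibre A p" using m by blast
next
  fix t assume "t \<in> trivs A"
  obtain U \<Phi> where tt: "t = (U, \<Phi>)" by (cases t)
  then have t: "(U, \<Phi>) \<in> trivs A" using \<open>t \<in> trivs A\<close> by simp
  note M = manifold triv_open[OF t]
  have "mfd_smooth_on A U (\<lambda>p. \<Phi> p (Psi A \<phi> p (map (const_covector A \<Phi> p) ws)))" if ws: "length ws = k" for ws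
  proof (rule mfd_smooth_on_cong[OF M])
    \<comment> \<open>The components with respect to the orthonormal basis are values of
      \<open>\<phi>\<close> with a constant covector appended.\<close>
    show "mfd_smooth_on A U (\<lambda>p. \<Sum>b\<in>onb. \<phi> p (map (const_covector A \<Phi> p) (ws @ [b])) *\<^sub>R b)"
      by (intro mfd_smooth_on_sum[OF M] mfd_smooth_on_scaleR[OF M] mfd_smooth_on_const tensor_smooth[OF \<phi> t])
        (simp add: ws)
    fix p assume p: "p \<in> U"
    let ?v = "Psi A \<phi> p (map (const_covector A \<Phi> p) ws)"
    have "b \<bullet> \<Phi> p ?v = \<phi> p (map (const_covector A \<Phi> p) (ws @ [b]))" for b
      using Psi_apply[OF \<phi> const_covector_mem[OF t p, of b], of "map (const_covector A \<Phi> p) ws"]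
      by (simp add: const_covector_def[of _ _ _ b] Psi_mem[OF \<phi>])
    then show "(\<Sum>b\<in>onb. \<phi> p (map (const_covector A \<Phi> p) (ws @ [b])) *\<^sub>R b) = \<Phi> p ?v"
      using onb_expand[of "\<Phi> p ?v"] by simp
  qed
  then show "case t of (U, \<Phi>) \<Rightarrow> \<forall>ws. length ws = k \<longrightarrow>
      mfd_smooth_on A U (\<lambda>p. \<Phi> p (Psi A \<phi> p (map (const_covector A \<Phi> p) ws)))" by (simp add: tt)
qed

text \<open>An explicit inverse of \<open>Psi\<close>: the last covector is evaluated on the value
  of \<open>P\<close> at the others. It serves only to prove that \<open>Psi\<close> is bijective,
  as \<open>Upsilon\<close> is the abstract inverse.\<close>

definition tensor_of_hom :: "nat \<Rightarrow> ('m \<Rightarrow> ('v \<Rightarrow> real) list \<Rightarrow> 'v) \<Rightarrow> 'm \<Rightarrow> ('v \<Rightarrow> real) list \<Rightarrow> real" where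
  "tensor_of_hom k P p cs =
     (if length cs = k + 1 \<and> set cs \<subseteq> dual_space (fibre A p) then last cs (P p (butlast cs)) else 0)"

lemma tensor_of_hom_snoc:
  "length as = k \<Longrightarrow> set as \<subseteq> dual_space (fibre A p) \<Longrightarrow> \<beta> \<in> dual_space (fibre A p)
    \<Longrightarrow> tensor_of_hom k P p (as @ [\<beta>]) = \<beta> (P p as)"
  by (simp add: tensor_of_hom_def)

lemma tensor_of_hom_sections:
  assumes P: "P \<in> hom_sections A k"
  shows "tensor_of_hom k P \<in> tensor_sections A k"
  unfolding tensor_sections_def
proof (intro CollectI conjI allI ballI)
  fix p
  let ?V = "dual_space (fibre A p)"
  show "multilinear_on (k + 1) ?V (tensor_of_hom k P p)"
    unfolding multilinear_on_def
  proof (intro conjI allI impI)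
    fix cs i assume cs: "length cs = k + 1 \<and> set cs \<subseteq> ?V" and i: "i < k + 1"
    obtain as \<beta> where c: "cs = as @ [\<beta>]" using cs by (cases cs rule: rev_cases) auto
    then have as: "length as = k" "set as \<subseteq> ?V" and \<beta>: "\<beta> \<in> ?V" using cs by auto
    show "linear_on ?V (\<lambda>b. tensor_of_hom k P p (cs[i := b]))"
    proof (rule linear_onI_lincomb[OF _ subspace_dual_space])
      fix \<gamma> \<delta> r assume g: "\<gamma> \<in> ?V" "\<delta> \<in> ?V"
      have gd: "\<gamma> + r *\<^sub>R \<delta> \<in> ?V" using g by (simp add: subspace_add subspace_scale subspace_dual_space)
      show "tensor_of_hom k P p (cs[i := \<gamma> + r *\<^sub>R \<delta>])
         = tensor_of_hom k P p (cs[i := \<gamma>]) + r *\<^sub>R tensor_of_hom k P p (cs[i := \<delta>])"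
      proof (cases "i = k")
        case True
        then show ?thesis using g gd as
          by (simp add: c list_update_append tensor_of_hom_snoc) (simp add: scaleR_fun_def)
      next
        case False
        then have ik: "i < k" using i by simp
        have u: "tensor_of_hom k P p (cs[i := b]) = \<beta> (P p (as[i := b]))" if "b \<in> ?V" for b
          using ik as \<beta> that set_update_subsetI[OF as(2) that]
          by (simp add: c list_update_append tensor_of_hom_snoc)
        show ?thesis
          unfolding u[OF g(1)] u[OF g(2)] u[OF gd]
            linear_on_lincomb[OF multilinear_onD[OF hom_sections_multilinear[OF P] as ik] subspace_dual_space g]
          by (rule linear_on_lincomb[OF dual_space_linear[OF \<beta>] subspace_fibre
                hom_sections_mem[OF P] hom_sections_mem[OF P]])
      qed
    qed
  next
    fix cs assume "\<not> (length cs = k + 1 \<and> set cs \<subseteq> ?V)"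
    then show "tensor_of_hom k P p cs = 0" by (simp only: tensor_of_hom_def if_False)
  qed
  show "alternating_on (k + 1) k ?V (tensor_of_hom k P p)"
    unfolding alternating_on_def
  proof (intro allI impI)
    fix cs i j assume h: "length cs = k + 1 \<and> set cs \<subseteq> ?V \<and> i < j \<and> j < k \<and> cs ! i = cs ! j"
    obtain as \<beta> where c: "cs = as @ [\<beta>]" using h by (cases cs rule: rev_cases) auto
    have as: "length as = k" "set as \<subseteq> ?V" and \<beta>: "\<beta> \<in> ?V" using h c by auto
    have "i < length as" "j < length as" using h as by auto
    then have "cs ! i = as ! i" "cs ! j = as ! j" by (simp_all add: c nth_append)
    then have "as ! i = as ! j" using h by metis
    then have "P p as = 0" using hom_sections_alternating[OF P, of p] h as unfolding alternating_on_def by blast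
    then show "tensor_of_hom k P p cs = 0" by (simp add: c tensor_of_hom_snoc[OF as \<beta>] dual_space_0[OF \<beta>])
  qed
next
  fix t assume "t \<in> trivs A"
  obtain U \<Phi> where tt: "t = (U, \<Phi>)" by (cases t)
  then have t: "(U, \<Phi>) \<in> trivs A" using \<open>t \<in> trivs A\<close> by simp
  note M = manifold triv_open[OF t]
  have "mfd_smooth_on A U (\<lambda>p. tensor_of_hom k P p (map (const_covector A \<Phi> p) ws))" if ws: "length ws = k + 1" for ws
  proof -
    obtain us w where u: "ws = us @ [w]" using ws by (cases ws rule: rev_cases) auto
    then have k: "length us = k" using ws by simp
    show ?thesis
    proof (rule mfd_smooth_on_cong[OF M _ mfd_smooth_on_coord[OF M(2) hom_sections_smooth[OF P t k], of w]])
      fix p assume p: "p \<in> U"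
      have "set (map (const_covector A \<Phi> p) us) \<subseteq> dual_space (fibre A p)"
        using const_covector_mem[OF t p] by auto
      from tensor_of_hom_snoc[OF _ this const_covector_mem[OF t p, of w], of k P]
      show "w \<bullet> \<Phi> p (P p (map (const_covector A \<Phi> p) us)) = tensor_of_hom k P p (map (const_covector A \<Phi> p) ws)"
        using k by (simp add: u const_covector_def[of _ _ _ w] hom_sections_mem[OF P])
    qed
  qed
  then show "case t of (U, \<Phi>) \<Rightarrow> \<forall>ws. length ws = k + 1 \<longrightarrow>
      mfd_smooth_on A U (\<lambda>p. tensor_of_hom k P p (map (const_covector A \<Phi> p) ws))" by (simp add: tt)
qed

lemma Psi_bij: "bij_betw (Psi A) (tensor_sections A k) (hom_sections A k)"
proof (rule bij_betw_byWitness[where f' = "tensor_of_hom k"])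
  show "\<forall>\<phi>\<in>tensor_sections A k. tensor_of_hom k (Psi A \<phi>) = \<phi>"
  proof (intro ballI ext)
    fix \<phi> p cs assume \<phi>: "\<phi> \<in> tensor_sections A k"
    show "tensor_of_hom k (Psi A \<phi>) p cs = \<phi> p cs"
    proof (cases "length cs = k + 1 \<and> set cs \<subseteq> dual_space (fibre A p)")
      case True
      then obtain as \<beta> where c: "cs = as @ [\<beta>]" by (cases cs rule: rev_cases) auto
      then show ?thesis using True by (simp add: tensor_of_hom_snoc Psi_apply[OF \<phi>])
    next
      case False
      from multilinear_on_0[OF tensor_multilinear[OF \<phi>] this]
      show ?thesis using False by (simp only: tensor_of_hom_def if_False)
    qed
  qed
  show "\<forall>P\<in>hom_sections A k. Psi A (tensor_of_hom k P) = P"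
  proof (intro ballI ext)
    fix P p as assume P: "P \<in> hom_sections A k"
    note T = tensor_of_hom_sections[OF P]
    show "Psi A (tensor_of_hom k P) p as = P p as"
    proof (cases "length as = k \<and> set as \<subseteq> dual_space (fibre A p)")
      case True
      then show ?thesis
        by (intro fibre_eqI[OF Psi_mem[OF T] hom_sections_mem[OF P]])
          (simp add: Psi_apply[OF T] tensor_of_hom_snoc)
    next
      case False
      then show ?thesis
        using multilinear_on_0[OF hom_sections_multilinear[OF P] False]
          multilinear_on_0[OF hom_sections_multilinear[OF Psi_hom_sections[OF T]] False] by simp
    qed
  qed
qed (use Psi_hom_sections tensor_of_hom_sections in auto)

lemma Upsilon_mem: "R \<in> hom_sections A k \<Longrightarrow> Upsilon A k R \<in> tensor_sections A k"
  and Psi_Upsilon: "R \<in> hom_sections A k \<Longrightarrow> Psi A (Upsilon A k R) = R"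
  using Psi_bij[of k] unfolding Upsilon_def bij_betw_def
  by (metis inv_into_into, metis f_inv_into_f)

lemma Psi_inject:
  "\<phi> \<in> tensor_sections A k \<Longrightarrow> \<psi> \<in> tensor_sections A k \<Longrightarrow> Psi A \<phi> = Psi A \<psi> \<Longrightarrow> \<phi> = \<psi>"
  using Psi_bij[of k] by (auto simp: bij_betw_def inj_on_def)

lemma subspace_tensor_sections: "subspace (tensor_sections A k)"
proof -
  have add_scale: "(\<lambda>p as. \<phi> p as + c * \<psi> p as) \<in> tensor_sections A k"
    if \<phi>: "\<phi> \<in> tensor_sections A k" and \<psi>: "\<psi> \<in> tensor_sections A k" for \<phi> \<psi> and c :: real
    unfolding tensor_sections_def
  proof (intro CollectI conjI allI ballI)
    fix p
    let ?V = "dual_space (fibre A p)"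
    note m = tensor_multilinear[OF \<phi>, of p] tensor_multilinear[OF \<psi>, of p]
    show "multilinear_on (k + 1) ?V (\<lambda>as. \<phi> p as + c * \<psi> p as)"
      unfolding multilinear_on_def
    proof (intro conjI allI impI)
      fix as i assume as: "length as = k + 1 \<and> set as \<subseteq> ?V" and i: "i < k + 1"
      show "linear_on ?V (\<lambda>b. \<phi> p (as[i := b]) + c * \<psi> p (as[i := b]))"
        using multilinear_onD[OF m(1) conjunct1[OF as] conjunct2[OF as] i]
          multilinear_onD[OF m(2) conjunct1[OF as] conjunct2[OF as] i]
        by (simp add: linear_on_def algebra_simps)
    next
      fix as assume h: "\<not> (length as = k + 1 \<and> set as \<subseteq> ?V)"
      show "\<phi> p as + c * \<psi> p as = 0" using multilinear_on_0[OF m(1) h] multilinear_on_0[OF m(2) h] by simp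
    qed
    show "alternating_on (k + 1) k ?V (\<lambda>as. \<phi> p as + c * \<psi> p as)"
      using tensor_alternating[OF \<phi>, of p] tensor_alternating[OF \<psi>, of p]
      unfolding alternating_on_def by (metis (no_types, lifting) add.right_neutral mult_zero_right)
  next
    fix t assume "t \<in> trivs A"
    obtain U \<Phi> where tt: "t = (U, \<Phi>)" by (cases t)
    then have t: "(U, \<Phi>) \<in> trivs A" using \<open>t \<in> trivs A\<close> by simp
    note M = manifold triv_open[OF t]
    have "mfd_smooth_on A U (\<lambda>p. \<phi> p (map (const_covector A \<Phi> p) ws) + c * \<psi> p (map (const_covector A \<Phi> p) ws))"
      if ws: "length ws = k + 1" for ws
      by (rule mfd_smooth_on_add[OF M tensor_smooth[OF \<phi> t ws]
          mfd_smooth_on_bounded_linear[OF M bounded_linear_mult_right tensor_smooth[OF \<psi> t ws]]])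
    then show "case t of (U, \<Phi>) \<Rightarrow> \<forall>ws. length ws = k + 1 \<longrightarrow>
      mfd_smooth_on A U (\<lambda>p. \<phi> p (map (const_covector A \<Phi> p) ws) + c * \<psi> p (map (const_covector A \<Phi> p) ws))"
      by (simp add: tt)
  qed
  have 0: "(\<lambda>p as. 0) \<in> tensor_sections A k"
    by (auto simp: tensor_sections_def multilinear_on_def alternating_on_def linear_on_def mfd_smooth_on_const)
  show ?thesis
  proof (rule subspaceI)
    show "0 \<in> tensor_sections A k" using 0 by (simp add: zero_fun_def)
    show "x + y \<in> tensor_sections A k" if "x \<in> tensor_sections A k" "y \<in> tensor_sections A k" for x y
      using add_scale[OF that, of 1] by (simp add: plus_fun_def)
    show "c *\<^sub>R x \<in> tensor_sections A k" if "x \<in> tensor_sections A k" for c x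
      using add_scale[OF 0 that, of c] by (simp add: scaleR_fun_def)
  qed
qed

lemma Psi_lincomb:
  assumes \<phi>: "\<phi> \<in> tensor_sections A k" and \<psi>: "\<psi> \<in> tensor_sections A k"
  shows "Psi A (\<phi> + c *\<^sub>R \<psi>) p as = Psi A \<phi> p as + c *\<^sub>R Psi A \<psi> p as"
proof -
  have s: "\<phi> + c *\<^sub>R \<psi> \<in> tensor_sections A k"
    using \<phi> \<psi> by (simp add: subspace_add subspace_scale subspace_tensor_sections)
  show ?thesis
  proof (rule fibre_eqI[OF Psi_mem[OF s]])
    show "Psi A \<phi> p as + c *\<^sub>R Psi A \<psi> p as \<in> fibre A p"
      by (intro subspace_add[OF subspace_fibre] subspace_scale[OF subspace_fibre] Psi_mem[OF \<phi>] Psi_mem[OF \<psi>])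
    fix \<beta> assume \<beta>: "\<beta> \<in> dual_space (fibre A p)"
    show "\<beta> (Psi A (\<phi> + c *\<^sub>R \<psi>) p as) = \<beta> (Psi A \<phi> p as + c *\<^sub>R Psi A \<psi> p as)"
      unfolding linear_on_lincomb[OF dual_space_linear[OF \<beta>] subspace_fibre Psi_mem[OF \<phi>] Psi_mem[OF \<psi>]]
        Psi_apply[OF s \<beta>] Psi_apply[OF \<phi> \<beta>] Psi_apply[OF \<psi> \<beta>] by (simp add: scaleR_fun_def)
  qed
qed

end

section \<open>The bracket of a left-symmetric algebroid\<close>

locale ls_algebroid =
  fixes A :: "('m::{t2_space,second_countable_topology}, 'e::real_inner, 'v::real_vector,
                'f::real_inner, 'z) algebroid_scheme"
  assumes lsa: "left_symmetric_algebroid A"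

sublocale ls_algebroid \<subseteq> smooth_bundle A
  using lsa by unfold_locales (simp add: left_symmetric_algebroid_def)

text \<open>Brings left symmetry into the form that the product with a commutator is the commutator
  of the left multiplications.\<close>

lemma diff_eq_diff_swap: "a - b = c - d \<Longrightarrow> b - d = a - c" for a b c d :: "'a::ab_group_add"
  by (simp add: algebra_simps)

context ls_algebroid
begin

lemma product_mem: "x \<in> sections A \<Longrightarrow> y \<in> sections A \<Longrightarrow> product A x y \<in> sections A"
  and product_right: "x \<in> sections A \<Longrightarrow> linear_on (sections A) (product A x)"
  and product_left: "y \<in> sections A \<Longrightarrow> linear_on (sections A) (\<lambda>x. product A x y)"
  and left_symmetry: "x \<in> sections A \<Longrightarrow> y \<in> sections A \<Longrightarrow> z \<in> sections A \<Longrightarrow>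
        product A x (product A y z) - product A (product A x y) z
          = product A y (product A x z) - product A (product A y x) z"
  and product_fscale_right: "x \<in> sections A \<Longrightarrow> y \<in> sections A \<Longrightarrow> h \<in> smooth_functions A \<Longrightarrow>
        product A x (fscale h y) = fscale h (product A x y) + fscale (anchor_act A x h) y"
  and product_fscale_left: "x \<in> sections A \<Longrightarrow> y \<in> sections A \<Longrightarrow> h \<in> smooth_functions A \<Longrightarrow>
        product A (fscale h x) y = fscale h (product A x y)"
  using lsa unfolding left_symmetric_algebroid_def by blast+

section \<open>The anchor and the dual representation\<close>

lemma anchor_linear: "linear_on (fibre A p) (anchor A p)"
  and anchor_tangent: "v \<in> fibre A p \<Longrightarrow> anchor A p v \<in> tangent_space A p"
  and anchor_vector_field: "x \<in> sections A \<Longrightarrow> (\<lambda>p. anchor A p (x p)) \<in> vector_fields A"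
  using lsa unfolding left_symmetric_algebroid_def by blast+

lemma anchor_act_smooth: "x \<in> sections A \<Longrightarrow> h \<in> smooth_functions A \<Longrightarrow> anchor_act A x h \<in> smooth_functions A"
  using anchor_vector_field[of x] by (simp add: vector_fields_def anchor_act_def)

lemma anchor_act_linear:
  assumes "x \<in> sections A"
  shows "linear_on (smooth_functions A) (anchor_act A x)"
proof -
  have "linear_on (smooth_functions A) (anchor A p (x p))" for p
    using anchor_tangent[OF sections_fibre[OF assms], of p] by (simp add: tangent_space_def)
  then show ?thesis by (simp add: linear_on_def anchor_act_def fun_eq_iff scaleR_fun_def)
qed

lemma anchor_act_mult:
  assumes "x \<in> sections A" "h \<in> smooth_functions A" "k \<in> smooth_functions A"
  shows "anchor_act A x (fscale h k) = fscale h (anchor_act A x k) + fscale (anchor_act A x h) k"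
proof
  fix p
  have "anchor A p (x p) (\<lambda>q. h q * k q) = h p * anchor A p (x p) k + k p * anchor A p (x p) h"
    using anchor_tangent[OF sections_fibre[OF assms(1)], of p] assms(2,3) by (simp add: tangent_space_def)
  then show "anchor_act A x (fscale h k) p = (fscale h (anchor_act A x k) + fscale (anchor_act A x h) k) p"
    by (simp add: anchor_act_def fscale_def mult.commute)
qed

lemma anchor_act_lincomb_left:
  assumes "x \<in> sections A" "y \<in> sections A"
  shows "anchor_act A (x + c *\<^sub>R y) h = anchor_act A x h + c *\<^sub>R anchor_act A y h"
proof
  fix p
  from linear_on_lincomb[OF anchor_linear subspace_fibre sections_fibre[OF assms(1)] sections_fibre[OF assms(2)], of p c]
  have "anchor A p (x p + c *\<^sub>R y p) h = (anchor A p (x p) + c *\<^sub>R anchor A p (y p)) h" by simp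
  then show "anchor_act A (x + c *\<^sub>R y) h p = (anchor_act A x h + c *\<^sub>R anchor_act A y h) p"
    by (simp add: anchor_act_def scaleR_fun_def)
qed

lemma anchor_act_fscale:
  assumes "x \<in> sections A"
  shows "anchor_act A (fscale k x) h = fscale k (anchor_act A x h)"
  by (simp add: fun_eq_iff anchor_act_def fscale_def scaleR_fun_def
      linear_on_scale[OF anchor_linear sections_fibre[OF assms]])

text \<open>The functional is linear over functions because the derivative of \<open>h\<close> along
  the anchor appears in both of its summands, once from the derivation rule and once from the
  product, and cancels in the difference. Non-degeneracy of the pairing gives uniqueness.\<close>

lemma L_rep_spec:
  assumes x: "x \<in> sections A" and \<xi>: "\<xi> \<in> dual_sections A"
  shows "L_rep A x \<xi> \<in> dual_sections A \<and>
    (\<forall>y\<in>sections A. pairing (L_rep A x \<xi>) y = anchor_act A x (pairing \<xi> y) - pairing \<xi> (product A x y))"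
proof -
  let ?T = "\<lambda>y. anchor_act A x (pairing \<xi> y) - pairing \<xi> (product A x y)"
  have "\<exists>\<eta>. \<eta> \<in> dual_sections A \<and> (\<forall>y\<in>sections A. pairing \<eta> y = ?T y)"
  proof (rule dual_section_of_functional)
    fix y assume y: "y \<in> sections A"
    show "?T y \<in> smooth_functions A"
      by (intro subspace_diff[OF subspace_smooth_functions[OF manifold]] anchor_act_smooth[OF x]
          pairing_smooth[OF \<xi>] product_mem[OF x] y)
    fix h assume h: "h \<in> smooth_functions A"
    have "pairing \<xi> (product A x (fscale h y))
       = fscale h (pairing \<xi> (product A x y)) + fscale (anchor_act A x h) (pairing \<xi> y)"
      by (simp add: product_fscale_right[OF x y h] pairing_add_right[OF \<xi>] fscale_sections
          anchor_act_smooth x y h product_mem pairing_fscale[OF \<xi>])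
    then show "?T (fscale h y) = fscale h (?T y)"
      by (simp add: pairing_fscale[OF \<xi> y] anchor_act_mult[OF x h pairing_smooth[OF \<xi> y]])
        (simp add: fscale_def fun_eq_iff algebra_simps)
  next
    show "linear_on (sections A) ?T"
    proof (rule linear_onI_lincomb[OF _ subspace_sections])
      fix y z c assume yz: "y \<in> sections A" "z \<in> sections A"
      have p: "pairing \<xi> (u + c *\<^sub>R v) = pairing \<xi> u + c *\<^sub>R pairing \<xi> v"
        if "u \<in> sections A" "v \<in> sections A" for u v
        using that by (simp add: pairing_add_right[OF \<xi>] pairing_scale_right[OF \<xi>] subspace_scale[OF subspace_sections])
      show "?T (y + c *\<^sub>R z) = ?T y + c *\<^sub>R ?T z"
        unfolding p[OF yz] linear_on_lincomb[OF product_right[OF x] subspace_sections yz]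
          p[OF product_mem[OF x yz(1)] product_mem[OF x yz(2)]]
          linear_on_lincomb[OF anchor_act_linear[OF x] subspace_smooth_functions[OF manifold]
            pairing_smooth[OF \<xi> yz(1)] pairing_smooth[OF \<xi> yz(2)]]
        by (simp add: scaleR_diff_right)
    qed
  qed
  then obtain \<eta> where \<eta>: "\<eta> \<in> dual_sections A" "\<forall>y\<in>sections A. pairing \<eta> y = ?T y" by (elim exE conjE)
  have "\<exists>!\<eta>. \<eta> \<in> dual_sections A \<and> (\<forall>y\<in>sections A. pairing \<eta> y = ?T y)"
  proof (rule ex1I)
    show "\<eta> \<in> dual_sections A \<and> (\<forall>y\<in>sections A. pairing \<eta> y = ?T y)" using \<eta> by (rule conjI)
    fix \<zeta> assume z: "\<zeta> \<in> dual_sections A \<and> (\<forall>y\<in>sections A. pairing \<zeta> y = ?T y)"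
    show "\<zeta> = \<eta>"
      by (rule dual_sections_eqI[OF conjunct1[OF z] \<eta>(1)])
        (simp only: \<eta>(2)[rule_format] conjunct2[OF z, rule_format])
  qed
  from theI'[OF this] show ?thesis unfolding L_rep_def .
qed

lemma L_rep_mem: "x \<in> sections A \<Longrightarrow> \<xi> \<in> dual_sections A \<Longrightarrow> L_rep A x \<xi> \<in> dual_sections A"
  and pairing_L_rep: "x \<in> sections A \<Longrightarrow> \<xi> \<in> dual_sections A \<Longrightarrow> y \<in> sections A \<Longrightarrow>
    pairing (L_rep A x \<xi>) y = anchor_act A x (pairing \<xi> y) - pairing \<xi> (product A x y)"
  using L_rep_spec by simp_all

lemma commutator_mem: "x \<in> sections A \<Longrightarrow> y \<in> sections A \<Longrightarrow> commutator A x y \<in> sections A"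
  unfolding commutator_def by (intro subspace_diff[OF subspace_sections] product_mem)

lemma commutator_bilinear: "bilinear_into (sections A) (sections A) (sections A) (commutator A)"
  unfolding bilinear_into_def
proof (intro conjI ballI)
  fix x assume x: "x \<in> sections A"
  show "linear_on (sections A) (commutator A x)" "linear_on (sections A) (\<lambda>y. commutator A y x)"
    using product_right[OF x] product_left[OF x]
    by (simp_all add: commutator_def linear_on_def scaleR_diff_right del: fun_diff_def minus_apply)
qed (rule commutator_mem)

lemma L_rep_bilinear: "bilinear_into (sections A) (dual_sections A) (dual_sections A) (L_rep A)"
  unfolding bilinear_into_def
proof (intro conjI ballI)
  note ps = subspace_smooth_functions[OF manifold]
  fix x assume x: "x \<in> sections A"
  show "linear_on (dual_sections A) (L_rep A x)"
  proof (rule linear_onI_lincomb[OF _ subspace_dual_sections])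
    fix \<xi> \<eta> c assume e: "\<xi> \<in> dual_sections A" "\<eta> \<in> dual_sections A"
    have s: "\<xi> + c *\<^sub>R \<eta> \<in> dual_sections A"
      using e by (simp add: subspace_add subspace_scale subspace_dual_sections)
    show "L_rep A x (\<xi> + c *\<^sub>R \<eta>) = L_rep A x \<xi> + c *\<^sub>R L_rep A x \<eta>"
    proof (rule dual_sections_eqI[OF L_rep_mem[OF x s]])
      show "L_rep A x \<xi> + c *\<^sub>R L_rep A x \<eta> \<in> dual_sections A"
        using e x by (simp add: subspace_add subspace_scale subspace_dual_sections L_rep_mem)
      fix y assume y: "y \<in> sections A"
      show "pairing (L_rep A x (\<xi> + c *\<^sub>R \<eta>)) y = pairing (L_rep A x \<xi> + c *\<^sub>R L_rep A x \<eta>) y"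
        unfolding pairing_L_rep[OF x s y] pairing_left pairing_L_rep[OF x e(1) y] pairing_L_rep[OF x e(2) y]
          linear_on_lincomb[OF anchor_act_linear[OF x] ps pairing_smooth[OF e(1) y] pairing_smooth[OF e(2) y]]
        by (simp add: scaleR_diff_right)
    qed
  qed
next
  fix \<xi> assume \<xi>: "\<xi> \<in> dual_sections A"
  show "linear_on (sections A) (\<lambda>x. L_rep A x \<xi>)"
  proof (rule linear_onI_lincomb[OF _ subspace_sections])
    fix x x' c assume x: "x \<in> sections A" "x' \<in> sections A"
    have s: "x + c *\<^sub>R x' \<in> sections A" using x by (simp add: subspace_add subspace_scale subspace_sections)
    show "L_rep A (x + c *\<^sub>R x') \<xi> = L_rep A x \<xi> + c *\<^sub>R L_rep A x' \<xi>"
    proof (rule dual_sections_eqI[OF L_rep_mem[OF s \<xi>]])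
      show "L_rep A x \<xi> + c *\<^sub>R L_rep A x' \<xi> \<in> dual_sections A"
        using \<xi> x by (simp add: subspace_add subspace_scale subspace_dual_sections L_rep_mem)
      fix y assume y: "y \<in> sections A"
      have "pairing \<xi> (product A x y + c *\<^sub>R product A x' y)
         = pairing \<xi> (product A x y) + c *\<^sub>R pairing \<xi> (product A x' y)"
        by (simp add: pairing_add_right[OF \<xi>] pairing_scale_right[OF \<xi>] product_mem x y subspace_scale[OF subspace_sections])
      then show "pairing (L_rep A (x + c *\<^sub>R x') \<xi>) y = pairing (L_rep A x \<xi> + c *\<^sub>R L_rep A x' \<xi>) y"
        unfolding pairing_L_rep[OF s \<xi> y] pairing_left pairing_L_rep[OF x(1) \<xi> y] pairing_L_rep[OF x(2) \<xi> y]
          linear_on_lincomb[OF product_left[OF y] subspace_sections x] anchor_act_lincomb_left[OF x]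
        by (simp add: scaleR_diff_right)
    qed
  qed
qed (rule L_rep_mem)

lemma L_rep_fscale_left:
  assumes x: "x \<in> sections A" and \<xi>: "\<xi> \<in> dual_sections A" and h: "h \<in> smooth_functions A"
  shows "L_rep A (fscale h x) \<xi> = fscale h (L_rep A x \<xi>)"
proof (rule dual_sections_eqI[OF L_rep_mem[OF fscale_sections[OF h x] \<xi>] fscale_dual_sections[OF h L_rep_mem[OF x \<xi>]]])
  fix y assume y: "y \<in> sections A"
  show "pairing (L_rep A (fscale h x) \<xi>) y = pairing (fscale h (L_rep A x \<xi>)) y"
    unfolding pairing_L_rep[OF fscale_sections[OF h x] \<xi> y] pairing_left pairing_L_rep[OF x \<xi> y]
      product_fscale_left[OF x y h] pairing_fscale[OF \<xi> product_mem[OF x y]] anchor_act_fscale[OF x]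
    by (simp add: fscale_def fun_eq_iff algebra_simps)
qed

text \<open>The last summand, a derivative of the coefficient, is the obstruction to tensoriality
  that the bracket has to overcome.\<close>

lemma L_rep_fscale_right:
  assumes x: "x \<in> sections A" and \<xi>: "\<xi> \<in> dual_sections A" and h: "h \<in> smooth_functions A"
  shows "L_rep A x (fscale h \<xi>) = fscale h (L_rep A x \<xi>) + fscale (anchor_act A x h) \<xi>"
proof (rule dual_sections_eqI[OF L_rep_mem[OF x fscale_dual_sections[OF h \<xi>]]])
  show "fscale h (L_rep A x \<xi>) + fscale (anchor_act A x h) \<xi> \<in> dual_sections A"
    by (intro subspace_add[OF subspace_dual_sections] fscale_dual_sections h \<xi> L_rep_mem[OF x] anchor_act_smooth[OF x])
  fix y assume y: "y \<in> sections A"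
  show "pairing (L_rep A x (fscale h \<xi>)) y = pairing (fscale h (L_rep A x \<xi>) + fscale (anchor_act A x h) \<xi>) y"
    unfolding pairing_L_rep[OF x fscale_dual_sections[OF h \<xi>] y] pairing_left pairing_L_rep[OF x \<xi> y]
      anchor_act_mult[OF x h pairing_smooth[OF \<xi> y]]
    by (simp add: fscale_def fun_eq_iff algebra_simps)
qed

text \<open>
  Left symmetry for \<open>x\<close>, \<open>y\<close> and \<open>h z\<close> makes the anchor compatible with brackets wherever
  some section \<open>z\<close> does not vanish.
\<close>

lemma anchor_act_commutator:
  assumes x: "x \<in> sections A" and y: "y \<in> sections A" and h: "h \<in> smooth_functions A"
    and v: "v \<in> fibre A p" "v \<noteq> 0"
  shows "anchor_act A (commutator A x y) h p
    = anchor_act A x (anchor_act A y h) p - anchor_act A y (anchor_act A x h) p"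
proof -
  obtain z where z: "z \<in> sections A" "z p = v" using v(1) by (rule section_through)
  note hz = fscale_sections[OF h z(1)] and xy = product_mem[OF x y] and yx = product_mem[OF y x]
  \<comment> \<open>The terms with a single derivative of \<open>h\<close> are symmetric in
    \<open>u\<close> and \<open>w\<close> as a pair, so they drop out of the difference and only the
    second derivatives of \<open>h\<close> are left with \<open>z\<close>.\<close>
  have twice: "product A u (product A w (fscale h z))
     = fscale h (product A u (product A w z)) + fscale (anchor_act A u h) (product A w z)
      + (fscale (anchor_act A w h) (product A u z) + fscale (anchor_act A u (anchor_act A w h)) z)"
    if u: "u \<in> sections A" and w: "w \<in> sections A" for u w
  proof -
    note wh = anchor_act_smooth[OF w h]
    have "product A u (product A w (fscale h z))
       = product A u (fscale h (product A w z)) + product A u (fscale (anchor_act A w h) z)"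
      unfolding product_fscale_right[OF w z(1) h]
      by (rule linear_on_add[OF product_right[OF u]])
        (simp_all add: fscale_sections h wh product_mem w z(1))
    then show ?thesis
      unfolding product_fscale_right[OF u product_mem[OF w z(1)] h] product_fscale_right[OF u z(1) wh] .
  qed
  have diff: "product A (commutator A x y) w = product A (product A x y) w - product A (product A y x) w"
    if w: "w \<in> sections A" for w
    unfolding commutator_def by (rule linear_on_diff[OF product_left[OF w] subspace_sections xy yx])
  note c = commutator_mem[OF x y]
  have "product A (commutator A x y) (fscale h z)
     = product A x (product A y (fscale h z)) - product A y (product A x (fscale h z))"
    unfolding diff[OF hz] by (rule diff_eq_diff_swap[OF left_symmetry[OF x y hz]])
  moreover have "product A (commutator A x y) z = product A x (product A y z) - product A y (product A x z)"
    unfolding diff[OF z(1)] by (rule diff_eq_diff_swap[OF left_symmetry[OF x y z(1)]])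
  ultimately have "(fscale h (product A x (product A y z) - product A y (product A x z))
        + fscale (anchor_act A (commutator A x y) h) z) p
     = (product A x (product A y (fscale h z)) - product A y (product A x (fscale h z))) p"
    using product_fscale_right[OF c z(1) h] by simp
  then have "anchor_act A (commutator A x y) h p *\<^sub>R v
     = anchor_act A x (anchor_act A y h) p *\<^sub>R v - anchor_act A y (anchor_act A x h) p *\<^sub>R v"
    unfolding twice[OF x y] twice[OF y x] by (simp add: fscale_def z(2) algebra_simps)
  then have "(anchor_act A (commutator A x y) h p
     - (anchor_act A x (anchor_act A y h) p - anchor_act A y (anchor_act A x h) p)) *\<^sub>R v = 0"
    by (simp add: algebra_simps)
  then show ?thesis using v(2) by simp
qed

text \<open>Checked pointwise after pairing with a section \<open>z\<close>. Where \<open>z\<close>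
  vanishes, both sides are pairings with the zero vector. Elsewhere \<open>z p\<close> is the
  non-zero vector that \<open>anchor_act_commutator\<close> requires, and the remaining terms match
  by left symmetry.\<close>

lemma L_rep_commutator:
  assumes x: "x \<in> sections A" and y: "y \<in> sections A" and \<xi>: "\<xi> \<in> dual_sections A"
  shows "L_rep A (commutator A x y) \<xi> = L_rep A x (L_rep A y \<xi>) - L_rep A y (L_rep A x \<xi>)"
proof (rule dual_sections_eqI)
  note c = commutator_mem[OF x y] and xy = product_mem[OF x y] and yx = product_mem[OF y x]
  note Lx = L_rep_mem[OF x \<xi>] and Ly = L_rep_mem[OF y \<xi>]
  note LL = L_rep_mem[OF x Ly] L_rep_mem[OF y Lx]
  show l: "L_rep A (commutator A x y) \<xi> \<in> dual_sections A" by (rule L_rep_mem[OF c \<xi>])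
  show r: "L_rep A x (L_rep A y \<xi>) - L_rep A y (L_rep A x \<xi>) \<in> dual_sections A"
    by (intro subspace_diff[OF subspace_dual_sections] LL)
  fix z assume z: "z \<in> sections A"
  show "pairing (L_rep A (commutator A x y) \<xi>) z = pairing (L_rep A x (L_rep A y \<xi>) - L_rep A y (L_rep A x \<xi>)) z"
  proof
    fix p
    show "pairing (L_rep A (commutator A x y) \<xi>) z p
       = pairing (L_rep A x (L_rep A y \<xi>) - L_rep A y (L_rep A x \<xi>)) z p"
    proof (cases "z p = 0")
      case True
      then show ?thesis
        using linear_on_0[OF dual_sections_linear[OF l] subspace_fibre]
          linear_on_0[OF dual_sections_linear[OF r] subspace_fibre] by (simp only: pairing_def)
    next
      case False
      note sf = subspace_smooth_functions[OF manifold]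
      have two: "pairing (L_rep A u (L_rep A w \<xi>)) z
         = anchor_act A u (anchor_act A w (pairing \<xi> z)) - anchor_act A u (pairing \<xi> (product A w z))
          - (anchor_act A w (pairing \<xi> (product A u z)) - pairing \<xi> (product A w (product A u z)))"
        if u: "u \<in> sections A" and w: "w \<in> sections A" for u w
        unfolding pairing_L_rep[OF u L_rep_mem[OF w \<xi>] z] pairing_L_rep[OF w \<xi> z]
          pairing_L_rep[OF w \<xi> product_mem[OF u z]]
        by (subst linear_on_diff[OF anchor_act_linear[OF u] sf])
          (simp_all add: anchor_act_smooth pairing_smooth \<xi> u w z product_mem)
      have pc: "product A (commutator A x y) z = product A x (product A y z) - product A y (product A x z)"
      proof -
        have "product A (commutator A x y) z = product A (product A x y) z - product A (product A y x) z"
          unfolding commutator_def by (rule linear_on_diff[OF product_left[OF z] subspace_sections xy yx])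
        then show ?thesis unfolding diff_eq_diff_swap[OF left_symmetry[OF x y z]] .
      qed
      have "pairing (L_rep A (commutator A x y) \<xi>) z p
        = anchor_act A (commutator A x y) (pairing \<xi> z) p
          - (pairing \<xi> (product A x (product A y z)) p - pairing \<xi> (product A y (product A x z)) p)"
        unfolding pairing_L_rep[OF c \<xi> z] pc
        by (simp add: pairing_diff_right[OF \<xi>] product_mem x y z)
      also have "anchor_act A (commutator A x y) (pairing \<xi> z) p
        = anchor_act A x (anchor_act A y (pairing \<xi> z)) p - anchor_act A y (anchor_act A x (pairing \<xi> z)) p"
        by (rule anchor_act_commutator[OF x y pairing_smooth[OF \<xi> z] sections_fibre[OF z] False])
      finally show ?thesis
        unfolding pairing_left two[OF x y] two[OF y x] by simp
    qed
  qed
qed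

text \<open>Lie admissibility: the Jacobi expression is an alternating sum of associators, and these
  are symmetric in the first two arguments.\<close>

lemma commutator_jacobi:
  assumes x: "x \<in> sections A" and y: "y \<in> sections A" and z: "z \<in> sections A"
  shows "commutator A (commutator A x y) z
    = commutator A x (commutator A y z) - commutator A y (commutator A x z)"
proof -
  note m = product_mem
  have r: "product A u (commutator A v w) = product A u (product A v w) - product A u (product A w v)"
    if "u \<in> sections A" "v \<in> sections A" "w \<in> sections A" for u v w
    unfolding commutator_def
    by (rule linear_on_diff[OF product_right[OF that(1)] subspace_sections m[OF that(2,3)] m[OF that(3,2)]])
  have l: "product A (commutator A v w) u = product A (product A v w) u - product A (product A w v) u"
    if "u \<in> sections A" "v \<in> sections A" "w \<in> sections A" for u v w
    unfolding commutator_def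
    by (rule linear_on_diff[OF product_left[OF that(1)] subspace_sections m[OF that(2,3)] m[OF that(3,2)]])
  \<comment> \<open>Left symmetry, oriented as a rewrite rule. It is used for each unordered pair of
    leading factors in one direction only, since its right-hand side has the same shape.\<close>
  have s: "product A u (product A v w) = product A v (product A u w) - product A (product A v u) w + product A (product A u v) w"
    if "u \<in> sections A" "v \<in> sections A" "w \<in> sections A" for u v w
    using left_symmetry[OF that] by (simp add: algebra_simps)
  show ?thesis
    unfolding commutator_def[of A "commutator A x y" z] commutator_def[of A x "commutator A y z"]
      commutator_def[of A y "commutator A x z"]
      r[OF z x y] r[OF x y z] r[OF y x z] l[OF z x y] l[OF x y z] l[OF y x z]
      s[OF x y z] s[OF x z y] s[OF y z x]
    by (simp only: diff_conv_add_uminus minus_add_distrib minus_minus ac_simps) (simp add: algebra_simps)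
qed

sublocale lie_representation "sections A" "dual_sections A" "commutator A" "L_rep A"
  by unfold_locales
    (rule subspace_sections subspace_dual_sections commutator_bilinear L_rep_bilinear commutator_jacobi
      L_rep_commutator | simp add: commutator_def)+

end

section \<open>Linearity of the bracket over smooth functions\<close>

lemma fscale_add_right: "fscale h (x + y) = fscale h x + fscale h y"
  and fscale_diff_right: "fscale h (x - y) = fscale h x - fscale h y"
  and fscale_scaleR: "fscale h (c *\<^sub>R x) = c *\<^sub>R fscale h x"
  by (simp_all add: fscale_def fun_eq_iff scaleR_fun_def scaleR_add_right scaleR_diff_right)

lemma shuffle_sum_fscale: "shuffle_sum as (\<lambda>x y. fscale h (G x y)) = fscale h (shuffle_sum as G)"
  by (induction as arbitrary: G) (simp_all add: fscale_add_right fscale_scaleR[symmetric])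

context ls_algebroid
begin

text \<open>The first argument is enough, because \<open>cochain_fscale_at\<close> transfers the
  property to the others by antisymmetry.\<close>

definition smooth_linear :: "(('m \<Rightarrow> 'v \<Rightarrow> real) list \<Rightarrow> 'm \<Rightarrow> 'v) \<Rightarrow> bool" where
  "smooth_linear F \<longleftrightarrow> (\<forall>h\<in>smooth_functions A. \<forall>\<gamma>\<in>dual_sections A. \<forall>\<alpha>s. set \<alpha>s \<subseteq> dual_sections A \<longrightarrow>
     F (fscale h \<gamma> # \<alpha>s) = fscale h (F (\<gamma> # \<alpha>s)))"

lemma smooth_linearD:
  "smooth_linear F \<Longrightarrow> h \<in> smooth_functions A \<Longrightarrow> \<gamma> \<in> dual_sections A \<Longrightarrow> set \<alpha>s \<subseteq> dual_sections A
    \<Longrightarrow> F (fscale h \<gamma> # \<alpha>s) = fscale h (F (\<gamma> # \<alpha>s))"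
  by (simp add: smooth_linear_def)

lemma commutator_fscale:
  assumes "x \<in> sections A" "y \<in> sections A" "h \<in> smooth_functions A"
  shows commutator_fscale_right:
      "commutator A x (fscale h y) = fscale h (commutator A x y) + fscale (anchor_act A x h) y"
    and commutator_fscale_left:
      "commutator A (fscale h x) y = fscale h (commutator A x y) - fscale (anchor_act A y h) x"
  by (simp_all only: commutator_def product_fscale_right product_fscale_left assms fscale_diff_right)
    (simp_all add: algebra_simps)

text \<open>For a fixed function \<open>h\<close>, this pairing gathers all derivative terms; having
  it bilinear makes them products of cochains to which \<open>wedge_swap\<close> applies.\<close>

lemma anchor_bilinear:
  assumes h: "h \<in> smooth_functions A"
  shows "bilinear_into (sections A) (sections A) (sections A) (\<lambda>x y. fscale (anchor_act A x h) y)"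
  unfolding bilinear_into_def
proof (intro conjI ballI)
  fix x assume x: "x \<in> sections A"
  show "linear_on (sections A) (fscale (anchor_act A x h))"
    by (simp add: linear_on_def fscale_add_right fscale_scaleR)
  show "linear_on (sections A) (\<lambda>y. fscale (anchor_act A y h) x)"
    by (rule linear_onI_lincomb[OF _ subspace_sections])
      (simp add: anchor_act_lincomb_left, simp add: fscale_def fun_eq_iff scaleR_fun_def algebra_simps)
qed (intro fscale_sections anchor_act_smooth h)

text \<open>The argument that carries \<open>h\<close> goes either to \<open>F\<close>, where
  \<open>h\<close> comes out freely, or to the coordinates, where \<open>L\<close> differentiates
  it. Only the second case leaves a derivative, with the sign for passing \<open>F\<close>.\<close>

lemma rho_fscale:
  assumes F: "cochain (dual_sections A) (sections A) f F" and Fh: "smooth_linear F"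
    and h: "h \<in> smooth_functions A" and \<gamma>: "\<gamma> \<in> dual_sections A" and s: "set \<alpha>s \<subseteq> dual_sections A"
  shows "rho F (fscale h \<gamma> # \<alpha>s)
    = fscale h (rho F (\<gamma> # \<alpha>s)) + (- 1) ^ f *\<^sub>R fscale (anchor_act A (F \<alpha>s) h) \<gamma>"
proof -
  note id = cochain_id[OF subspace_dual_sections] and L0 = linear_on_0[OF bilinear_into_right[OF L_rep_bilinear] subspace_dual_sections]
  have tail: "wedge (L_rep A) F (contract \<delta> id_cochain) \<alpha>s = L_rep A (F \<alpha>s) \<delta>" if "\<delta> \<in> dual_sections A" for \<delta>
  proof -
    have "wedge (L_rep A) F (contract \<delta> id_cochain) \<alpha>s
       = shuffle_sum \<alpha>s (\<lambda>x y. if y = [] then L_rep A (F x) \<delta> else 0)"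
      unfolding wedge_def
    proof (rule shuffle_sum_cong)
      fix x y assume "set x \<subseteq> set \<alpha>s"
      then have "F x \<in> sections A" using s by (intro cochain_mem[OF F]) auto
      then show "L_rep A (F x) (contract \<delta> id_cochain y) = (if y = [] then L_rep A (F x) \<delta> else 0)"
        using L0 by (cases y) (simp_all add: contract_def)
    qed
    then show ?thesis by (simp add: shuffle_sum_all_left)
  qed
  have "wedge (L_rep A) (contract (fscale h \<gamma>) F) id_cochain \<alpha>s
     = shuffle_sum \<alpha>s (\<lambda>x y. fscale h (L_rep A (contract \<gamma> F x) (id_cochain y)))"
    unfolding wedge_def
  proof (rule shuffle_sum_cong)
    fix x y assume "set x \<subseteq> set \<alpha>s" "set y \<subseteq> set \<alpha>s"
    then have xy: "set x \<subseteq> dual_sections A" "set y \<subseteq> dual_sections A" using s by auto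
    have m: "F (\<gamma> # x) \<in> sections A" by (rule cochain_mem[OF F]) (use \<gamma> xy in simp)
    show "L_rep A (contract (fscale h \<gamma>) F x) (id_cochain y) = fscale h (L_rep A (contract \<gamma> F x) (id_cochain y))"
      unfolding contract_def smooth_linearD[OF Fh h \<gamma> xy(1)]
      by (rule L_rep_fscale_left[OF m cochain_mem[OF id xy(2)] h])
  qed
  also have "\<dots> = fscale h (wedge (L_rep A) (contract \<gamma> F) id_cochain \<alpha>s)"
    by (simp add: shuffle_sum_fscale wedge_def)
  finally have head: "wedge (L_rep A) (contract (fscale h \<gamma>) F) id_cochain \<alpha>s
     = fscale h (wedge (L_rep A) (contract \<gamma> F) id_cochain \<alpha>s)" .
  note C = wedge_Cons[OF F L_rep_bilinear subspace_sections id s]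
  show ?thesis
    unfolding rho_def C[OF fscale_dual_sections[OF h \<gamma>]] C[OF \<gamma>] head tail[OF fscale_dual_sections[OF h \<gamma>]]
      tail[OF \<gamma>] L_rep_fscale_right[OF cochain_mem[OF F s] \<gamma> h]
    by (simp add: fscale_add_right fscale_scaleR scaleR_add_right)
qed

text \<open>The derivative term of \<open>rho F\<close> is a multiple of \<open>\<gamma>\<close>.
  Inserted into \<open>G\<close>, the factor comes out and \<open>\<gamma>\<close> is left as a
  contraction.\<close>

lemma ins_rho_fscale:
  assumes F: "cochain (dual_sections A) (sections A) f F" and Fh: "smooth_linear F"
    and G: "cochain (dual_sections A) (sections A) g G" and Gh: "smooth_linear G"
    and h: "h \<in> smooth_functions A" and \<gamma>: "\<gamma> \<in> dual_sections A" and s: "set \<alpha>s \<subseteq> dual_sections A"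
  shows "ins (rho F) G (fscale h \<gamma> # \<alpha>s) = fscale h (ins (rho F) G (\<gamma> # \<alpha>s))
    + (- 1) ^ f *\<^sub>R wedge (\<lambda>x y. fscale (anchor_act A x h) y) F (contract \<gamma> G) \<alpha>s"
proof -
  note R = cochain_rho[OF F] and h\<gamma> = fscale_dual_sections[OF h \<gamma>]
  have "ins (rho F) (contract (fscale h \<gamma>) G) \<alpha>s
     = shuffle_sum \<alpha>s (\<lambda>x y. fscale h (contract \<gamma> G (rho F x # y)))"
    unfolding ins_def
  proof (rule shuffle_sum_cong)
    fix x y assume "set x \<subseteq> set \<alpha>s" "set y \<subseteq> set \<alpha>s"
    then have "set (rho F x # y) \<subseteq> dual_sections A" using s cochain_mem[OF R, of x] by auto
    then show "contract (fscale h \<gamma>) G (rho F x # y) = fscale h (contract \<gamma> G (rho F x # y))"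
      unfolding contract_def by (rule smooth_linearD[OF Gh h \<gamma>])
  qed
  also have "\<dots> = fscale h (ins (rho F) (contract \<gamma> G) \<alpha>s)"
    by (simp add: shuffle_sum_fscale ins_def)
  finally have 1: "ins (rho F) (contract (fscale h \<gamma>) G) \<alpha>s = fscale h (ins (rho F) (contract \<gamma> G) \<alpha>s)" .
  have "ins (contract (fscale h \<gamma>) (rho F)) G \<alpha>s
     = shuffle_sum \<alpha>s (\<lambda>x y. fscale h (G (contract \<gamma> (rho F) x # y))
        + (- 1) ^ f *\<^sub>R fscale (anchor_act A (F x) h) (contract \<gamma> G y))"
    unfolding ins_def
  proof (rule shuffle_sum_cong)
    fix x y assume "set x \<subseteq> set \<alpha>s" "set y \<subseteq> set \<alpha>s"
    then have xy: "set x \<subseteq> dual_sections A" "set y \<subseteq> dual_sections A" using s by auto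
    have m: "rho F (\<gamma> # x) \<in> dual_sections A" by (rule cochain_mem[OF R]) (use \<gamma> xy in simp)
    have a: "anchor_act A (F x) h \<in> smooth_functions A" by (rule anchor_act_smooth[OF cochain_mem[OF F xy(1)] h])
    show "G (contract (fscale h \<gamma>) (rho F) x # y) = fscale h (G (contract \<gamma> (rho F) x # y))
        + (- 1) ^ f *\<^sub>R fscale (anchor_act A (F x) h) (contract \<gamma> G y)"
      unfolding contract_def rho_fscale[OF F Fh h \<gamma> xy(1)]
        linear_on_lincomb[OF cochain_linear[OF G xy(2)] subspace_dual_sections
          fscale_dual_sections[OF h m] fscale_dual_sections[OF a \<gamma>]]
        smooth_linearD[OF Gh h m xy(2)] smooth_linearD[OF Gh a \<gamma> xy(2)] ..
  qed
  also have "\<dots> = fscale h (ins (contract \<gamma> (rho F)) G \<alpha>s)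
     + (- 1) ^ f *\<^sub>R wedge (\<lambda>x y. fscale (anchor_act A x h) y) F (contract \<gamma> G) \<alpha>s"
    by (simp add: shuffle_sum_add shuffle_sum_scale shuffle_sum_fscale wedge_def ins_def)
  finally have 2: "ins (contract (fscale h \<gamma>) (rho F)) G \<alpha>s = fscale h (ins (contract \<gamma> (rho F)) G \<alpha>s)
     + (- 1) ^ f *\<^sub>R wedge (\<lambda>x y. fscale (anchor_act A x h) y) F (contract \<gamma> G) \<alpha>s" .
  show ?thesis
    unfolding ins_Cons[OF R G subspace_dual_sections s h\<gamma>] ins_Cons[OF R G subspace_dual_sections s \<gamma>] 1 2
    by (simp add: fscale_diff_right fscale_scaleR fscale_add_right)
qed

text \<open>The commutator differentiates \<open>h\<close> whichever of its two entries contains it.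
  One derivative term has \<open>F\<close> and \<open>G\<close> in the wrong order and is turned
  round, so that both have the shape of the terms in \<open>ins_rho_fscale\<close>.\<close>

lemma wedge_commutator_fscale:
  assumes F: "cochain (dual_sections A) (sections A) f F" and Fh: "smooth_linear F"
    and G: "cochain (dual_sections A) (sections A) g G" and Gh: "smooth_linear G"
    and h: "h \<in> smooth_functions A" and \<gamma>: "\<gamma> \<in> dual_sections A" and s: "set \<alpha>s \<subseteq> dual_sections A"
  shows "wedge (commutator A) F G (fscale h \<gamma> # \<alpha>s) = fscale h (wedge (commutator A) F G (\<gamma> # \<alpha>s))
    - (- 1) ^ (Suc f * g) *\<^sub>R wedge (\<lambda>x y. fscale (anchor_act A x h) y) G (contract \<gamma> F) \<alpha>s
    + (- 1) ^ f *\<^sub>R wedge (\<lambda>x y. fscale (anchor_act A x h) y) F (contract \<gamma> G) \<alpha>s"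
proof -
  note h\<gamma> = fscale_dual_sections[OF h \<gamma>]
  let ?B = "\<lambda>x y. fscale (anchor_act A x h) y"
  have B: "bilinear_into (sections A) (sections A) (sections A) (\<lambda>x y. ?B y x)"
    using anchor_bilinear[OF h] by (simp add: bilinear_into_def)
  have "wedge (commutator A) (contract (fscale h \<gamma>) F) G \<alpha>s
     = shuffle_sum \<alpha>s (\<lambda>x y. fscale h (commutator A (contract \<gamma> F x) (G y)) + (- 1) *\<^sub>R ?B (G y) (contract \<gamma> F x))"
    unfolding wedge_def
  proof (rule shuffle_sum_cong)
    fix x y assume "set x \<subseteq> set \<alpha>s" "set y \<subseteq> set \<alpha>s"
    then have xy: "set x \<subseteq> dual_sections A" "set y \<subseteq> dual_sections A" using s by auto
    have m: "F (\<gamma> # x) \<in> sections A" by (rule cochain_mem[OF F]) (use \<gamma> xy in simp)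
    show "commutator A (contract (fscale h \<gamma>) F x) (G y)
       = fscale h (commutator A (contract \<gamma> F x) (G y)) + (- 1) *\<^sub>R ?B (G y) (contract \<gamma> F x)"
      unfolding contract_def smooth_linearD[OF Fh h \<gamma> xy(1)]
      by (simp add: commutator_fscale_left[OF m cochain_mem[OF G xy(2)] h])
  qed
  also have "\<dots> = fscale h (wedge (commutator A) (contract \<gamma> F) G \<alpha>s)
     + (- 1) *\<^sub>R wedge (\<lambda>x y. ?B y x) (contract \<gamma> F) G \<alpha>s"
    unfolding shuffle_sum_add shuffle_sum_scale shuffle_sum_fscale wedge_def ..
  also have "wedge (\<lambda>x y. ?B y x) (contract \<gamma> F) G \<alpha>s = (- 1) ^ (Suc f * g) *\<^sub>R wedge ?B G (contract \<gamma> F) \<alpha>s"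
    by (rule wedge_swap[OF B subspace_sections subspace_sections cochain_contract[OF F \<gamma>] G s])
  finally have 1: "wedge (commutator A) (contract (fscale h \<gamma>) F) G \<alpha>s
     = fscale h (wedge (commutator A) (contract \<gamma> F) G \<alpha>s) - (- 1) ^ (Suc f * g) *\<^sub>R wedge ?B G (contract \<gamma> F) \<alpha>s"
    by (simp only: scaleR_minus_left scaleR_one add_uminus_conv_diff)
  have "wedge (commutator A) F (contract (fscale h \<gamma>) G) \<alpha>s
     = shuffle_sum \<alpha>s (\<lambda>x y. fscale h (commutator A (F x) (contract \<gamma> G y)) + ?B (F x) (contract \<gamma> G y))"
    unfolding wedge_def
  proof (rule shuffle_sum_cong)
    fix x y assume "set x \<subseteq> set \<alpha>s" "set y \<subseteq> set \<alpha>s"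
    then have xy: "set x \<subseteq> dual_sections A" "set y \<subseteq> dual_sections A" using s by auto
    have m: "G (\<gamma> # y) \<in> sections A" by (rule cochain_mem[OF G]) (use \<gamma> xy in simp)
    show "commutator A (F x) (contract (fscale h \<gamma>) G y)
       = fscale h (commutator A (F x) (contract \<gamma> G y)) + ?B (F x) (contract \<gamma> G y)"
      unfolding contract_def smooth_linearD[OF Gh h \<gamma> xy(2)]
      by (rule commutator_fscale_right[OF cochain_mem[OF F xy(1)] m h])
  qed
  also have "\<dots> = fscale h (wedge (commutator A) F (contract \<gamma> G) \<alpha>s) + wedge ?B F (contract \<gamma> G) \<alpha>s"
    unfolding shuffle_sum_add shuffle_sum_fscale wedge_def ..
  finally have 2: "wedge (commutator A) F (contract (fscale h \<gamma>) G) \<alpha>s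
     = fscale h (wedge (commutator A) F (contract \<gamma> G) \<alpha>s) + wedge ?B F (contract \<gamma> G) \<alpha>s" .
  show ?thesis
    unfolding wedge_Cons[OF F commutator_bilinear subspace_sections G s h\<gamma>]
      wedge_Cons[OF F commutator_bilinear subspace_sections G s \<gamma>] 1 2
    by (simp add: fscale_add_right fscale_scaleR algebra_simps)
qed

text \<open>The derivatives of \<open>h\<close> along the anchor cancel between the three summands of the bracket.\<close>

lemma bracket_smooth_linear:
  assumes F: "cochain (dual_sections A) (sections A) f F" and Fh: "smooth_linear F"
    and G: "cochain (dual_sections A) (sections A) g G" and Gh: "smooth_linear G"
  shows "smooth_linear (bracket f g F G)"
  unfolding smooth_linear_def
proof (intro ballI allI impI)
  fix h \<gamma> \<alpha>s
  assume h: "h \<in> smooth_functions A" and \<gamma>: "\<gamma> \<in> dual_sections A" and s: "set \<alpha>s \<subseteq> dual_sections A"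
  show "bracket f g F G (fscale h \<gamma> # \<alpha>s) = fscale h (bracket f g F G (\<gamma> # \<alpha>s))"
    unfolding bracket_def ins_rho_fscale[OF F Fh G Gh h \<gamma> s] ins_rho_fscale[OF G Gh F Fh h \<gamma> s]
      wedge_commutator_fscale[OF F Fh G Gh h \<gamma> s] fscale_diff_right fscale_scaleR
    by (cases "even f"; cases "even g") (simp_all add: minus_one_power_iff algebra_simps)
qed

lemma eval_at_smooth_linear: "P \<in> hom_sections A k \<Longrightarrow> smooth_linear (eval_at P)"
  unfolding smooth_linear_def using eval_at_fscale by blast

lemma eval_at_length: "P \<in> hom_sections A k \<Longrightarrow> length \<alpha>s \<noteq> k \<Longrightarrow> eval_at P \<alpha>s = 0"
  using hom_sections_length[of P k] by (simp add: eval_at_def fun_eq_iff)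

section \<open>Comparison with the sums over unshuffles\<close>

context
  fixes n m P Q
  assumes P: "P \<in> hom_sections A n" and Q: "Q \<in> hom_sections A m"
begin

private lemma cP: "cochain (dual_sections A) (sections A) n (eval_at P)"
  by (rule cochain_eval_at[OF P])

private lemma cQ: "cochain (dual_sections A) (sections A) m (eval_at Q)"
  by (rule cochain_eval_at[OF Q])

text \<open>Restores the lengths: bundle maps vanish on lists of the wrong length and the
  coordinates on all but singletons, so the unrestricted sum reduces to blocks of lengths
  \<open>m\<close>, 1 and \<open>n - 1\<close>. The last condition is written with
  \<open>Suc\<close> in order to be false for \<open>n = 0\<close>.\<close>

lemma ins_rho_eval_at:
  assumes s: "set \<alpha>s \<subseteq> dual_sections A"
  shows "ins (rho (eval_at Q)) (eval_at P) \<alpha>s = shuffle_sum \<alpha>s (\<lambda>u w. shuffle_sum u (\<lambda>x v.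
    if length x = m \<and> length v = 1 \<and> Suc (length w) = n
    then eval_at P (L_rep A (eval_at Q x) (hd v) # w) else 0))"
  unfolding ins_def
proof (rule shuffle_sum_cong)
  fix u w assume "set u \<subseteq> set \<alpha>s" "set w \<subseteq> set \<alpha>s"
  then have uw: "set u \<subseteq> dual_sections A" "set w \<subseteq> dual_sections A" using s by auto
  note lin = cochain_linear[OF cP uw(2)]
  have Lm: "L_rep A (eval_at Q x) (id_cochain v) \<in> dual_sections A"
    if "set x \<subseteq> dual_sections A" "set v \<subseteq> dual_sections A" for x v
    by (rule L_rep_mem[OF cochain_mem[OF cQ that(1)] cochain_mem[OF cochain_id[OF subspace_dual_sections] that(2)]])
  have "eval_at P (rho (eval_at Q) u # w)
     = shuffle_sum u (\<lambda>x v. eval_at P (L_rep A (eval_at Q x) (id_cochain v) # w))"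
    unfolding rho_def wedge_def
    by (rule shuffle_sum_linear[OF subspace_dual_sections lin], rule Lm) (use uw in auto)
  also have "\<dots> = shuffle_sum u (\<lambda>x v. if length x = m \<and> length v = 1 \<and> Suc (length w) = n
    then eval_at P (L_rep A (eval_at Q x) (hd v) # w) else 0)"
  proof (rule shuffle_sum_cong)
    fix x v assume "set x \<subseteq> set u" "set v \<subseteq> set u"
    then have xv: "set x \<subseteq> dual_sections A" "set v \<subseteq> dual_sections A" using uw by auto
    note Qx = cochain_mem[OF cQ xv(1)] and iv = cochain_mem[OF cochain_id[OF subspace_dual_sections] xv(2)]
    consider "length x = m" "length v = 1" "Suc (length w) = n" | "length x \<noteq> m" | "length v \<noteq> 1" | "Suc (length w) \<noteq> n"
      by blast
    then show "eval_at P (L_rep A (eval_at Q x) (id_cochain v) # w)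
       = (if length x = m \<and> length v = 1 \<and> Suc (length w) = n
          then eval_at P (L_rep A (eval_at Q x) (hd v) # w) else 0)"
    proof cases
      case 1
      then obtain c where "v = [c]" by (cases v) auto
      then show ?thesis using 1 by simp
    next
      case 2
      then have "L_rep A (eval_at Q x) (id_cochain v) = 0"
        using linear_on_0[OF bilinear_into_left[OF L_rep_bilinear iv] subspace_sections] eval_at_length[OF Q] by simp
      then show ?thesis using 2 linear_on_0[OF lin subspace_dual_sections] by simp
    next
      case 3
      then have "id_cochain v = 0" by (cases v rule: remdups_adj.cases) auto
      then have "L_rep A (eval_at Q x) (id_cochain v) = 0"
        using linear_on_0[OF bilinear_into_right[OF L_rep_bilinear Qx] subspace_dual_sections] by simp
      then show ?thesis using 3 linear_on_0[OF lin subspace_dual_sections] by simp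
    next
      case 4
      then show ?thesis using eval_at_length[OF P] by simp
    qed
  qed
  finally show "eval_at P (rho (eval_at Q) u # w)
     = shuffle_sum u (\<lambda>x v. if length x = m \<and> length v = 1 \<and> Suc (length w) = n
        then eval_at P (L_rep A (eval_at Q x) (hd v) # w) else 0)" .
qed

lemma insertion_sum_eq:
  assumes s: "set \<alpha>s \<subseteq> dual_sections A" and l: "length \<alpha>s = n + m"
  shows "insertion_sum A n m P Q \<alpha>s = ins (rho (eval_at Q)) (eval_at P) \<alpha>s"
proof (cases n)
  case 0
  \<comment> \<open>For \<open>n = 0\<close> no \<open>w\<close> satisfies the condition on its
    length, in accordance with the convention for a block of length -1.\<close>
  then show ?thesis unfolding ins_rho_eval_at[OF s] by (simp add: insertion_sum_def shuffle_sum_0)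
next
  case (Suc n')
  have "insertion_sum A n m P Q \<alpha>s
     = unshuffle_sum m 1 n' (\<lambda>x v w. eval_at P (L_rep A (eval_at Q x) (hd v) # w)) \<alpha>s"
    by (simp add: insertion_sum_def unshuffle_sum_def Suc)
  also have "\<dots> = ins (rho (eval_at Q)) (eval_at P) \<alpha>s"
    unfolding ins_rho_eval_at[OF s] by (subst unshuffle_sum_eq_shuffle_sum) (use l Suc in simp_all)
  finally show ?thesis .
qed

lemma wedge_commutator_eval_at:
  assumes s: "set \<alpha>s \<subseteq> dual_sections A"
  shows "wedge (commutator A) (eval_at P) (eval_at Q) \<alpha>s = shuffle_sum \<alpha>s (\<lambda>x v.
    if length x = n \<and> length v = m then commutator A (eval_at P x) (eval_at Q v) else 0)"
  unfolding wedge_def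
proof (rule shuffle_sum_cong)
  fix x v assume "set x \<subseteq> set \<alpha>s" "set v \<subseteq> set \<alpha>s"
  then have xv: "set x \<subseteq> dual_sections A" "set v \<subseteq> dual_sections A" using s by auto
  show "commutator A (eval_at P x) (eval_at Q v)
     = (if length x = n \<and> length v = m then commutator A (eval_at P x) (eval_at Q v) else 0)"
    using linear_on_0[OF bilinear_into_left[OF commutator_bilinear cochain_mem[OF cQ xv(2)]] subspace_sections]
      linear_on_0[OF bilinear_into_right[OF commutator_bilinear cochain_mem[OF cP xv(1)]] subspace_sections]
      eval_at_length[OF P, of x] eval_at_length[OF Q, of v] by auto
qed

end

text \<open>The arguments of \<open>bracket\<close> appear in the opposite order, since the first
  sum inserts values of \<open>Q\<close> into \<open>P\<close> and so differentiates
  \<open>P\<close> along \<open>Q\<close>. Turning the commutator product round gives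
  \<open>- (- 1) ^ (n * m)\<close>, which combines with the sign in the formula to the coefficient
  -1 in \<open>bracket\<close>.\<close>

lemma bracket_formula_eq:
  assumes P: "P \<in> hom_sections A n" and Q: "Q \<in> hom_sections A m"
    and s: "set \<alpha>s \<subseteq> dual_sections A" and l: "length \<alpha>s = n + m"
  shows "bracket_formula A n m P Q \<alpha>s = bracket m n (eval_at Q) (eval_at P) \<alpha>s"
proof -
  have "(\<Sum>\<sigma>\<in>unshuffles [n, m]. real_of_int (sign \<sigma>) *\<^sub>R
            commutator A (eval_at P (map (\<lambda>i. \<alpha>s ! \<sigma> i) [0..<n])) (eval_at Q (map (\<lambda>i. \<alpha>s ! \<sigma> i) [n..<m + n])))
     = unshuffle_sum n m 0 (\<lambda>x v w. commutator A (eval_at P x) (eval_at Q v)) \<alpha>s"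
    by (simp add: unshuffle_sum_def unshuffles_2 add.commute)
  also have "\<dots> = wedge (commutator A) (eval_at P) (eval_at Q) \<alpha>s"
    unfolding wedge_commutator_eval_at[OF P Q s] by (rule unshuffle_sum_2[OF l])
  also have "\<dots> = - ((- 1) ^ (n * m) *\<^sub>R wedge (commutator A) (eval_at Q) (eval_at P) \<alpha>s)"
    by (rule wedge_br_swap[OF cochain_eval_at[OF P] cochain_eval_at[OF Q] s])
  finally show ?thesis
    unfolding bracket_formula_def insertion_sum_eq[OF P Q s l] bracket_def
    using insertion_sum_eq[OF Q P s] l by (simp add: minus_one_power_iff mult.commute add.commute)
qed

text \<open>As a cochain the bracket is only known to vanish on lists of the wrong parity. With the
  exact length, tensors and cochains can be compared on every list, as nested brackets
  demand.\<close>

lemma bracket_length: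
  assumes P: "P \<in> hom_sections A n" and Q: "Q \<in> hom_sections A m"
    and s: "set \<alpha>s \<subseteq> dual_sections A" and l: "length \<alpha>s \<noteq> n + m"
  shows "bracket m n (eval_at Q) (eval_at P) \<alpha>s = 0"
proof -
  have i: "ins (rho (eval_at Q)) (eval_at P) \<alpha>s = 0"
    if P: "P \<in> hom_sections A n" and Q: "Q \<in> hom_sections A m" and l: "length \<alpha>s \<noteq> n + m" for P Q n m
  proof -
    have "ins (rho (eval_at Q)) (eval_at P) \<alpha>s = shuffle_sum \<alpha>s (\<lambda>u w. 0)"
      unfolding ins_rho_eval_at[OF P Q s]
    proof (rule shuffle_sum_cong)
      fix u w :: "('m \<Rightarrow> 'v \<Rightarrow> real) list" assume uw: "length u + length w = length \<alpha>s"
      have "shuffle_sum u (\<lambda>x v. if length x = m \<and> length v = 1 \<and> Suc (length w) = n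
         then eval_at P (L_rep A (eval_at Q x) (hd v) # w) else 0) = shuffle_sum u (\<lambda>x v. 0)"
        by (rule shuffle_sum_cong) (use uw l in auto)
      then show "shuffle_sum u (\<lambda>x v. if length x = m \<and> length v = 1 \<and> Suc (length w) = n
         then eval_at P (L_rep A (eval_at Q x) (hd v) # w) else 0) = 0" by (simp only: shuffle_sum_0)
    qed
    then show ?thesis by (simp only: shuffle_sum_0)
  qed
  have "wedge (commutator A) (eval_at Q) (eval_at P) \<alpha>s = shuffle_sum \<alpha>s (\<lambda>x v. 0)"
    unfolding wedge_commutator_eval_at[OF Q P s] by (rule shuffle_sum_cong) (use l in auto)
  then show ?thesis
    using i[OF P Q l] i[OF Q P] l by (simp add: bracket_def shuffle_sum_0 add.commute)
qed

section \<open>The bracket on tensor sections\<close>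

lemma hom_bracket_spec:
  assumes P: "P \<in> hom_sections A n" and Q: "Q \<in> hom_sections A m"
  shows "hom_bracket A n m P Q \<in> hom_sections A (n + m) \<and>
    (\<forall>\<alpha>s. set \<alpha>s \<subseteq> dual_sections A \<and> length \<alpha>s = n + m \<longrightarrow>
      eval_at (hom_bracket A n m P Q) \<alpha>s = bracket_formula A n m P Q \<alpha>s)"
proof -
  note c = cochain_bracket[OF cochain_eval_at[OF Q] cochain_eval_at[OF P]]
  note cl = bracket_smooth_linear[OF cochain_eval_at[OF Q] eval_at_smooth_linear[OF Q]
      cochain_eval_at[OF P] eval_at_smooth_linear[OF P]]
  have "\<exists>R\<in>hom_sections A (n + m). \<forall>\<alpha>s. set \<alpha>s \<subseteq> dual_sections A \<and> length \<alpha>s = n + m \<longrightarrow>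
      eval_at R \<alpha>s = bracket m n (eval_at Q) (eval_at P) \<alpha>s"
    by (rule hom_section_of_cochain[OF c smooth_linearD[OF cl]])
  then obtain R where R: "R \<in> hom_sections A (n + m)" "\<And>\<alpha>s. set \<alpha>s \<subseteq> dual_sections A \<Longrightarrow> length \<alpha>s = n + m \<Longrightarrow>
      eval_at R \<alpha>s = bracket_formula A n m P Q \<alpha>s"
    using bracket_formula_eq[OF P Q] by auto
  have "\<exists>!R. R \<in> hom_sections A (n + m) \<and>
    (\<forall>\<alpha>s. set \<alpha>s \<subseteq> dual_sections A \<and> length \<alpha>s = n + m \<longrightarrow> eval_at R \<alpha>s = bracket_formula A n m P Q \<alpha>s)"
  proof (rule ex1I)
    show "R \<in> hom_sections A (n + m) \<and>
      (\<forall>\<alpha>s. set \<alpha>s \<subseteq> dual_sections A \<and> length \<alpha>s = n + m \<longrightarrow> eval_at R \<alpha>s = bracket_formula A n m P Q \<alpha>s)"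
      using R by blast
    fix R' assume R': "R' \<in> hom_sections A (n + m) \<and>
      (\<forall>\<alpha>s. set \<alpha>s \<subseteq> dual_sections A \<and> length \<alpha>s = n + m \<longrightarrow> eval_at R' \<alpha>s = bracket_formula A n m P Q \<alpha>s)"
    show "R' = R"
      by (rule hom_sections_eqI[OF conjunct1[OF R'] R(1)]) (use R' R(2) in simp)
  qed
  from theI'[OF this] show ?thesis unfolding hom_bracket_def .
qed

lemma KV_bracket_mem:
  assumes "\<phi> \<in> tensor_sections A k" "\<psi> \<in> tensor_sections A l"
  shows "KV_bracket A k l \<phi> \<psi> \<in> tensor_sections A (k + l)"
  unfolding KV_bracket_def
  by (rule Upsilon_mem, rule conjunct1, rule hom_bracket_spec; rule Psi_hom_sections; rule assms)

text \<open>The transfer principle for the graded Lie algebra axioms: tensors are determined by the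
  values of their homomorphisms on sections, and on these the bracket is the abstract one in
  opposite order.\<close>

lemma eval_Psi_KV_bracket:
  assumes \<phi>: "\<phi> \<in> tensor_sections A k" and \<psi>: "\<psi> \<in> tensor_sections A l" and s: "set \<alpha>s \<subseteq> dual_sections A"
  shows "eval_at (Psi A (KV_bracket A k l \<phi> \<psi>)) \<alpha>s = bracket l k (eval_at (Psi A \<psi>)) (eval_at (Psi A \<phi>)) \<alpha>s"
proof -
  note P = Psi_hom_sections[OF \<phi>] and Q = Psi_hom_sections[OF \<psi>]
  note h = hom_bracket_spec[OF P Q]
  have "Psi A (KV_bracket A k l \<phi> \<psi>) = hom_bracket A k l (Psi A \<phi>) (Psi A \<psi>)"
    unfolding KV_bracket_def by (rule Psi_Upsilon[OF conjunct1[OF h]])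
  then show ?thesis
    using h s bracket_formula_eq[OF P Q s] bracket_length[OF P Q s] eval_at_length[OF conjunct1[OF h], of \<alpha>s]
    by (cases "length \<alpha>s = k + l") auto
qed

lemma tensor_sections_eqI:
  assumes "\<phi> \<in> tensor_sections A k" "\<psi> \<in> tensor_sections A k"
    "\<And>\<alpha>s. set \<alpha>s \<subseteq> dual_sections A \<Longrightarrow> eval_at (Psi A \<phi>) \<alpha>s = eval_at (Psi A \<psi>) \<alpha>s"
  shows "\<phi> = \<psi>"
  by (rule Psi_inject[OF assms(1,2)], rule hom_sections_eqI[OF Psi_hom_sections[OF assms(1)] Psi_hom_sections[OF assms(2)]])
    (rule assms(3))

lemma eval_Psi_lincomb:
  assumes "\<phi> \<in> tensor_sections A k" "\<psi> \<in> tensor_sections A k"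
  shows "eval_at (Psi A (\<phi> + c *\<^sub>R \<psi>)) \<alpha>s = eval_at (Psi A \<phi>) \<alpha>s + c *\<^sub>R eval_at (Psi A \<psi>) \<alpha>s"
  unfolding eval_at_def Psi_lincomb[OF assms] by (simp add: fun_eq_iff scaleR_fun_def)

lemma cochain_eval_Psi: "\<phi> \<in> tensor_sections A k \<Longrightarrow> cochain (dual_sections A) (sections A) k (eval_at (Psi A \<phi>))"
  by (rule cochain_eval_at[OF Psi_hom_sections])

text \<open>Needed to substitute \<open>eval_Psi_KV_bracket\<close> inside a bracket, because that
  equation holds only on lists of dual sections.\<close>

lemma bracket_cong:
  assumes F: "cochain (dual_sections A) (sections A) f F" and G: "cochain (dual_sections A) (sections A) g G"
    and F': "\<And>x. set x \<subseteq> dual_sections A \<Longrightarrow> F' x = F x"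
    and G': "\<And>x. set x \<subseteq> dual_sections A \<Longrightarrow> G' x = G x" and s: "set \<alpha>s \<subseteq> dual_sections A"
  shows "bracket f g F' G' \<alpha>s = bracket f g F G \<alpha>s"
proof -
  have rF: "rho F' x = rho F x" if "set x \<subseteq> dual_sections A" for x
    unfolding rho_def by (rule wedge_cong[OF F' refl that])
  have rG: "rho G' x = rho G x" if "set x \<subseteq> dual_sections A" for x
    unfolding rho_def by (rule wedge_cong[OF G' refl that])
  have 1: "ins (rho F) G \<alpha>s = ins (rho F') G' \<alpha>s"
    by (rule ins_cong[OF rF[symmetric] cochain_mem[OF cochain_rho[OF F]] G'[symmetric] s])
  have 2: "ins (rho G) F \<alpha>s = ins (rho G') F' \<alpha>s"
    by (rule ins_cong[OF rG[symmetric] cochain_mem[OF cochain_rho[OF G]] F'[symmetric] s])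
  have 3: "wedge (commutator A) F G \<alpha>s = wedge (commutator A) F' G' \<alpha>s"
    by (rule wedge_cong[OF F'[symmetric] G'[symmetric] s])
  show ?thesis by (simp add: bracket_def 1 2 3)
qed

lemma KV_bracket_skew:
  assumes x: "x \<in> tensor_sections A k" and y: "y \<in> tensor_sections A l"
  shows "KV_bracket A k l x y = - ((- 1) ^ (k * l) *\<^sub>R KV_bracket A l k y x)"
proof (rule tensor_sections_eqI[OF KV_bracket_mem[OF x y]])
  have yx: "KV_bracket A l k y x \<in> tensor_sections A (k + l)"
    using KV_bracket_mem[OF y x] by (simp add: add.commute)
  \<comment> \<open>Written as a linear combination with the zero tensor, so that
    \<open>eval_Psi_lincomb\<close> applies.\<close>
  have neg: "0 + (- ((- 1) ^ (k * l))) *\<^sub>R KV_bracket A l k y x = - ((- 1) ^ (k * l) *\<^sub>R KV_bracket A l k y x)"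
    by simp
  show "- ((- 1) ^ (k * l) *\<^sub>R KV_bracket A l k y x) \<in> tensor_sections A (k + l)"
    by (intro subspace_neg[OF subspace_tensor_sections] subspace_scale[OF subspace_tensor_sections] yx)
  fix \<alpha>s assume s: "set \<alpha>s \<subseteq> dual_sections A"
  note z = subspace_0[OF subspace_tensor_sections, of "k + l"]
  have 0: "eval_at (Psi A 0) \<alpha>s = 0"
    using eval_Psi_lincomb[OF z z, of "- 1" \<alpha>s] by simp
  have "eval_at (Psi A (- ((- 1) ^ (k * l) *\<^sub>R KV_bracket A l k y x))) \<alpha>s
     = - ((- 1) ^ (k * l)) *\<^sub>R eval_at (Psi A (KV_bracket A l k y x)) \<alpha>s"
    unfolding neg[symmetric] eval_Psi_lincomb[OF z yx] 0 by simp
  then show "eval_at (Psi A (KV_bracket A k l x y)) \<alpha>s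
     = eval_at (Psi A (- ((- 1) ^ (k * l) *\<^sub>R KV_bracket A l k y x))) \<alpha>s"
    unfolding eval_Psi_KV_bracket[OF x y s] eval_Psi_KV_bracket[OF y x s]
    using bracket_skew[OF cochain_eval_Psi[OF y] cochain_eval_Psi[OF x] s] by (simp add: mult.commute)
qed

lemma KV_bracket_linear_left:
  assumes y: "y \<in> tensor_sections A l"
  shows "linear_on (tensor_sections A k) (\<lambda>x. KV_bracket A k l x y)"
proof (rule linear_onI_lincomb[OF _ subspace_tensor_sections])
  fix x z c assume x: "x \<in> tensor_sections A k" and z: "z \<in> tensor_sections A k"
  have xz: "x + c *\<^sub>R z \<in> tensor_sections A k"
    by (intro subspace_add[OF subspace_tensor_sections] subspace_scale[OF subspace_tensor_sections] x z)
  note Kx = KV_bracket_mem[OF x y] and Kz = KV_bracket_mem[OF z y]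
  show "KV_bracket A k l (x + c *\<^sub>R z) y = KV_bracket A k l x y + c *\<^sub>R KV_bracket A k l z y"
  proof (rule tensor_sections_eqI[OF KV_bracket_mem[OF xz y]])
    show "KV_bracket A k l x y + c *\<^sub>R KV_bracket A k l z y \<in> tensor_sections A (k + l)"
      by (intro subspace_add[OF subspace_tensor_sections] subspace_scale[OF subspace_tensor_sections] Kx Kz)
    fix \<alpha>s assume s: "set \<alpha>s \<subseteq> dual_sections A"
    show "eval_at (Psi A (KV_bracket A k l (x + c *\<^sub>R z) y)) \<alpha>s
      = eval_at (Psi A (KV_bracket A k l x y + c *\<^sub>R KV_bracket A k l z y)) \<alpha>s"
      unfolding eval_Psi_lincomb[OF Kx Kz] eval_Psi_KV_bracket[OF xz y s] eval_Psi_KV_bracket[OF x y s]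
        eval_Psi_KV_bracket[OF z y s]
      by (rule bracket_lincomb_right[OF cochain_eval_Psi[OF y] cochain_eval_Psi[OF x] cochain_eval_Psi[OF z]
            eval_Psi_lincomb[OF x z] s])
  qed
qed

lemma KV_bracket_linear_right:
  assumes x: "x \<in> tensor_sections A k"
  shows "linear_on (tensor_sections A l) (\<lambda>y. KV_bracket A k l x y)"
proof -
  have "linear_on (tensor_sections A l) (\<lambda>y. - ((- 1) ^ (k * l) *\<^sub>R KV_bracket A l k y x))"
    using KV_bracket_linear_left[OF x, of l] by (simp add: linear_on_def scaleR_add_right)
  then show ?thesis
    by (subst linear_on_cong[OF _ subspace_tensor_sections]) (rule KV_bracket_skew[OF x])
qed

text \<open>Reversing the order at both levels exchanges nesting on the left with nesting on the
  right. The identity is thus the one of \<open>bracket\<close> for \<open>z\<close>,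
  \<open>y\<close>, \<open>x\<close>, with the two terms that have \<open>y\<close> in the middle or
  outside accounted for by signs.\<close>

lemma KV_bracket_jacobi:
  assumes x: "x \<in> tensor_sections A k" and y: "y \<in> tensor_sections A l" and z: "z \<in> tensor_sections A j"
  shows "KV_bracket A k (l + j) x (KV_bracket A l j y z)
    = KV_bracket A (k + l) j (KV_bracket A k l x y) z
      + (- 1) ^ (k * l) *\<^sub>R KV_bracket A l (k + j) y (KV_bracket A k j x z)"
proof -
  note m = KV_bracket_mem and c = cochain_eval_Psi
  note K1 = m[OF x m[OF y z]]
  have K2: "KV_bracket A (k + l) j (KV_bracket A k l x y) z \<in> tensor_sections A (k + (l + j))"
    using m[OF m[OF x y] z] by (simp add: add.assoc)
  have K3: "KV_bracket A l (k + j) y (KV_bracket A k j x z) \<in> tensor_sections A (k + (l + j))"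
    using m[OF y m[OF x z]] by (simp add: add.left_commute)
  show ?thesis
  proof (rule tensor_sections_eqI[OF K1])
    show "KV_bracket A (k + l) j (KV_bracket A k l x y) z
      + (- 1) ^ (k * l) *\<^sub>R KV_bracket A l (k + j) y (KV_bracket A k j x z) \<in> tensor_sections A (k + (l + j))"
      by (intro subspace_add[OF subspace_tensor_sections] subspace_scale[OF subspace_tensor_sections] K2 K3)
    fix \<alpha>s assume s: "set \<alpha>s \<subseteq> dual_sections A"
    let ?x = "eval_at (Psi A x)" and ?y = "eval_at (Psi A y)" and ?z = "eval_at (Psi A z)"
    have inner: "bracket (d + e) g (eval_at (Psi A (KV_bracket A e d u v))) (eval_at (Psi A w)) \<alpha>s
       = bracket (d + e) g (bracket d e (eval_at (Psi A v)) (eval_at (Psi A u))) (eval_at (Psi A w)) \<alpha>s"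
      if "u \<in> tensor_sections A e" "v \<in> tensor_sections A d" "w \<in> tensor_sections A g" for d e g u v w
      by (rule bracket_cong[OF cochain_bracket[OF c[OF that(2)] c[OF that(1)]] c[OF that(3)]
            eval_Psi_KV_bracket[OF that(1,2)] refl s])
    have inner': "bracket g (d + e) (eval_at (Psi A w)) (eval_at (Psi A (KV_bracket A e d u v))) \<alpha>s
       = bracket g (d + e) (eval_at (Psi A w)) (bracket d e (eval_at (Psi A v)) (eval_at (Psi A u))) \<alpha>s"
      if "u \<in> tensor_sections A e" "v \<in> tensor_sections A d" "w \<in> tensor_sections A g" for d e g u v w
      by (rule bracket_cong[OF c[OF that(3)] cochain_bracket[OF c[OF that(2)] c[OF that(1)]]
            refl eval_Psi_KV_bracket[OF that(1,2)] s])
    have e1: "eval_at (Psi A (KV_bracket A k (l + j) x (KV_bracket A l j y z))) \<alpha>s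
       = bracket (j + l) k (bracket j l ?z ?y) ?x \<alpha>s"
      unfolding eval_Psi_KV_bracket[OF x m[OF y z] s] using inner[OF y z x] by (simp add: add.commute)
    have e2: "eval_at (Psi A (KV_bracket A (k + l) j (KV_bracket A k l x y) z)) \<alpha>s
       = bracket j (l + k) ?z (bracket l k ?y ?x) \<alpha>s"
      unfolding eval_Psi_KV_bracket[OF m[OF x y] z s] using inner'[OF x y z] by (simp add: add.commute)
    have e3: "eval_at (Psi A (KV_bracket A l (k + j) y (KV_bracket A k j x z))) \<alpha>s
       = bracket (j + k) l (bracket j k ?z ?x) ?y \<alpha>s"
      unfolding eval_Psi_KV_bracket[OF y m[OF x z] s] using inner[OF x z y] by (simp add: add.commute)
    \<comment> \<open>The reversal leaves the third double bracket nested on the left; the Jacobi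
      identity has it nested on the right.\<close>
    have e4: "bracket (j + k) l (bracket j k ?z ?x) ?y \<alpha>s
       = - ((- 1) ^ ((j + k) * l) *\<^sub>R bracket l (j + k) ?y (bracket j k ?z ?x) \<alpha>s)"
      by (rule bracket_skew[OF cochain_bracket[OF c[OF z] c[OF x]] c[OF y] s])
    show "eval_at (Psi A (KV_bracket A k (l + j) x (KV_bracket A l j y z))) \<alpha>s
      = eval_at (Psi A (KV_bracket A (k + l) j (KV_bracket A k l x y) z
        + (- 1) ^ (k * l) *\<^sub>R KV_bracket A l (k + j) y (KV_bracket A k j x z))) \<alpha>s"
      unfolding eval_Psi_lincomb[OF K2 K3] e1 e2 e3 e4
        bracket_jacobi[OF c[OF z] c[OF y] c[OF x] s]
      by (cases "even k"; cases "even l"; cases "even j") (simp_all add: minus_one_power_iff)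
  qed
qed

lemma graded_Lie_algebra_KV: "graded_Lie_algebra (\<lambda>k. C_KV A (k + 1)) (KV_bracket A)"
  unfolding graded_Lie_algebra_def C_KV_def add_diff_cancel_right'
  by (intro conjI allI ballI subspace_tensor_sections KV_bracket_mem KV_bracket_linear_right
      KV_bracket_linear_left KV_bracket_skew KV_bracket_jacobi)

section \<open>Koszul--Vinberg structures as Maurer--Cartan elements\<close>

lemma pairing_eval_Psi:
  assumes \<phi>: "\<phi> \<in> tensor_sections A k" and \<beta>: "\<beta> \<in> dual_sections A"
  shows "pairing \<beta> (eval_at (Psi A \<phi>) \<alpha>s) = eval_at \<phi> (\<alpha>s @ [\<beta>])"
  by (simp add: fun_eq_iff pairing_def eval_at_def Psi_apply[OF \<phi> dual_sections_fibre[OF \<beta>]])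

lemma Sym2_D:
  assumes "H \<in> Sym2 A"
  shows "H \<in> tensor_sections A 1"
    and "\<alpha> \<in> dual_sections A \<Longrightarrow> \<beta> \<in> dual_sections A \<Longrightarrow> eval_at H [\<alpha>, \<beta>] = eval_at H [\<beta>, \<alpha>]"
  using assms dual_sections_fibre by (simp_all add: Sym2_def eval_at_def fun_eq_iff)

text \<open>In degree 1 the sign \<open>(- 1) ^ (1 * 1)\<close> makes the two insertion terms of
  \<open>bracket\<close> add up instead of cancelling, and the two shuffles of the commutator term
  contribute equally by skew symmetry. This is the origin of the factor 2.\<close>

lemma KV_bracket_HH:
  assumes H: "H \<in> Sym2 A"
    and a: "\<alpha>1 \<in> dual_sections A" "\<alpha>2 \<in> dual_sections A" "\<alpha>3 \<in> dual_sections A"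
  shows "eval_at (KV_bracket A 1 1 H H) [\<alpha>1, \<alpha>2, \<alpha>3] = 2 *\<^sub>R HH_bracket A H \<alpha>1 \<alpha>2 \<alpha>3"
proof -
  note T = Sym2_D(1)[OF H] and P = Psi_hom_sections[OF Sym2_D(1)[OF H]]
  let ?e = "eval_at (Psi A H)"
  have sharp: "?e [\<alpha>] = sharp A H \<alpha>" for \<alpha> by (simp add: eval_at_def sharp_def Psi_def)
  have mem: "sharp A H \<alpha> \<in> sections A" if "\<alpha> \<in> dual_sections A" for \<alpha>
    using eval_at_sections[OF P, of "[\<alpha>]"] that by (simp add: sharp)
  have sym: "pairing \<beta> (sharp A H \<alpha>) = pairing \<alpha> (sharp A H \<beta>)"
    if "\<alpha> \<in> dual_sections A" "\<beta> \<in> dual_sections A" for \<alpha> \<beta>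
    using pairing_eval_Psi[OF T that(2), of "[\<alpha>]"] pairing_eval_Psi[OF T that(1), of "[\<beta>]"]
      Sym2_D(2)[OF H that] by (simp add: sharp)
  have e0: "length \<alpha>s \<noteq> 1 \<Longrightarrow> ?e \<alpha>s = 0" for \<alpha>s by (rule eval_at_length[OF P])
  have L0: "x \<in> sections A \<Longrightarrow> L_rep A x 0 = 0" "\<xi> \<in> dual_sections A \<Longrightarrow> L_rep A 0 \<xi> = 0" for x \<xi>
    using linear_on_0[OF bilinear_into_right[OF L_rep_bilinear] subspace_dual_sections]
      linear_on_0[OF bilinear_into_left[OF L_rep_bilinear] subspace_sections] by blast+
  have c0: "x \<in> sections A \<Longrightarrow> commutator A x 0 = 0" "x \<in> sections A \<Longrightarrow> commutator A 0 x = 0" for x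
    using linear_on_0[OF bilinear_into_right[OF commutator_bilinear] subspace_sections]
      linear_on_0[OF bilinear_into_left[OF commutator_bilinear] subspace_sections] by blast+
  have z: "0 \<in> sections A" "0 \<in> dual_sections A"
    by (rule subspace_0[OF subspace_sections], rule subspace_0[OF subspace_dual_sections])
  let ?L = "\<lambda>\<alpha> \<beta>. L_rep A (sharp A H \<alpha>) \<beta>"
  note Lm = L_rep_mem[OF mem[OF a(1)] a(2)] L_rep_mem[OF mem[OF a(2)] a(1)]
  \<comment> \<open>Only the two splittings into singletons survive.\<close>
  have rho: "rho ?e [\<alpha>1, \<alpha>2] = ?L \<alpha>1 \<alpha>2 - ?L \<alpha>2 \<alpha>1"
    by (simp add: rho_def wedge_def e0 L0 z sharp)
  have "ins (rho ?e) ?e [\<alpha>1, \<alpha>2] = ?e [?L \<alpha>1 \<alpha>2 - ?L \<alpha>2 \<alpha>1]"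
    by (simp add: ins_def e0 rho)
  also have "\<dots> = sharp A H (?L \<alpha>1 \<alpha>2) - sharp A H (?L \<alpha>2 \<alpha>1)"
    using linear_on_diff[OF cochain_linear[OF cochain_eval_at[OF P], of "[]"] subspace_dual_sections Lm]
    by (simp add: sharp)
  finally have ins: "ins (rho ?e) ?e [\<alpha>1, \<alpha>2] = sharp A H (?L \<alpha>1 \<alpha>2) - sharp A H (?L \<alpha>2 \<alpha>1)" .
  let ?c = "commutator A (sharp A H \<alpha>1) (sharp A H \<alpha>2)"
  have "commutator A (sharp A H \<alpha>2) (sharp A H \<alpha>1) = - ?c" by (simp add: commutator_def)
  then have wedge: "wedge (commutator A) ?e ?e [\<alpha>1, \<alpha>2] = 2 *\<^sub>R ?c"
    by (simp add: wedge_def e0 c0 z sharp scaleR_2)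
  let ?S = "sharp A H (?L \<alpha>1 \<alpha>2) - sharp A H (?L \<alpha>2 \<alpha>1)"
  note S = subspace_diff[OF subspace_sections mem[OF Lm(1)] mem[OF Lm(2)]]
    and C = commutator_mem[OF mem[OF a(1)] mem[OF a(2)]]
  have "eval_at (KV_bracket A 1 1 H H) [\<alpha>1, \<alpha>2, \<alpha>3]
     = pairing \<alpha>3 (eval_at (Psi A (KV_bracket A 1 1 H H)) [\<alpha>1, \<alpha>2])"
    using pairing_eval_Psi[OF KV_bracket_mem[OF T T] a(3), of "[\<alpha>1, \<alpha>2]"] by simp
  also have "eval_at (Psi A (KV_bracket A 1 1 H H)) [\<alpha>1, \<alpha>2] = 2 *\<^sub>R (?S - ?c)"
    by (subst eval_Psi_KV_bracket[OF T T]) (use a in \<open>simp_all add: bracket_def ins wedge scaleR_2 algebra_simps\<close>)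
  also have "pairing \<alpha>3 (2 *\<^sub>R (?S - ?c)) = 2 *\<^sub>R (pairing \<alpha>3 (sharp A H (?L \<alpha>1 \<alpha>2))
      - pairing \<alpha>3 (sharp A H (?L \<alpha>2 \<alpha>1)) - pairing \<alpha>3 ?c)"
    unfolding pairing_scale_right[OF a(3) subspace_diff[OF subspace_sections S C]]
      pairing_diff_right[OF a(3) S C] pairing_diff_right[OF a(3) mem[OF Lm(1)] mem[OF Lm(2)]] ..
  \<comment> \<open>After the first exchange the definition of \<open>L_rep\<close> applies; a
    second one brings the function that is differentiated into the form used in
    \<open>HH_bracket\<close>.\<close>
  also have "pairing \<alpha>3 (sharp A H (?L \<alpha>1 \<alpha>2)) = anchor_act A (sharp A H \<alpha>1) (pairing \<alpha>3 (sharp A H \<alpha>2))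
      - pairing \<alpha>2 (product A (sharp A H \<alpha>1) (sharp A H \<alpha>3))"
    unfolding sym[OF Lm(1) a(3)] pairing_L_rep[OF mem[OF a(1)] a(2) mem[OF a(3)]] sym[OF a(3) a(2)] ..
  also have "pairing \<alpha>3 (sharp A H (?L \<alpha>2 \<alpha>1)) = anchor_act A (sharp A H \<alpha>2) (pairing \<alpha>3 (sharp A H \<alpha>1))
      - pairing \<alpha>1 (product A (sharp A H \<alpha>2) (sharp A H \<alpha>3))"
    unfolding sym[OF Lm(2) a(3)] pairing_L_rep[OF mem[OF a(2)] a(1) mem[OF a(3)]] sym[OF a(3) a(1)] ..
  finally show ?thesis unfolding HH_bracket_def by (simp add: fun_eq_iff scaleR_fun_def algebra_simps)
qed

text \<open>A value of the bracket on two covectors is determined by its pairings with a third one,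
  and these are computed by \<open>KV_bracket_HH\<close>; on lists of other lengths there is nothing
  to compare.\<close>

lemma KV_structure_iff_MC:
  assumes H: "H \<in> Sym2 A"
  shows "Koszul_Vinberg_structure A H \<longleftrightarrow> Maurer_Cartan (\<lambda>k. C_KV A (k + 1)) (KV_bracket A) H"
proof -
  note T = Sym2_D(1)[OF H]
  note K = KV_bracket_mem[OF T T] and z = subspace_0[OF subspace_tensor_sections, of "1 + 1"]
  have "KV_bracket A 1 1 H H = 0"
    if HH: "\<And>\<alpha>1 \<alpha>2 \<alpha>3. \<alpha>1 \<in> dual_sections A \<Longrightarrow> \<alpha>2 \<in> dual_sections A \<Longrightarrow> \<alpha>3 \<in> dual_sections A
      \<Longrightarrow> HH_bracket A H \<alpha>1 \<alpha>2 \<alpha>3 = 0"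
  proof (rule tensor_sections_eqI[OF K z])
    fix \<alpha>s assume s: "set \<alpha>s \<subseteq> dual_sections A"
    show "eval_at (Psi A (KV_bracket A 1 1 H H)) \<alpha>s = eval_at (Psi A 0) \<alpha>s"
    proof (cases "length \<alpha>s = 1 + 1")
      case False
      then show ?thesis
        using eval_at_length[OF Psi_hom_sections[OF K]] eval_at_length[OF Psi_hom_sections[OF z]] by metis
    next
      case True
      then obtain \<alpha>1 \<alpha>2 where as: "\<alpha>s = [\<alpha>1, \<alpha>2]" by (auto simp: length_Suc_conv)
      show ?thesis
      proof (rule sections_eqI[OF eval_at_sections[OF Psi_hom_sections[OF K] s] eval_at_sections[OF Psi_hom_sections[OF z] s]])
        fix \<xi> assume \<xi>: "\<xi> \<in> dual_sections A"
        have "eval_at (KV_bracket A 1 1 H H) [\<alpha>1, \<alpha>2, \<xi>] = 0"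
          using KV_bracket_HH[OF H _ _ \<xi>, of \<alpha>1 \<alpha>2] HH[of \<alpha>1 \<alpha>2 \<xi>] s \<xi> by (simp add: as)
        then show "pairing \<xi> (eval_at (Psi A (KV_bracket A 1 1 H H)) \<alpha>s) = pairing \<xi> (eval_at (Psi A 0) \<alpha>s)"
          unfolding pairing_eval_Psi[OF K \<xi>] pairing_eval_Psi[OF z \<xi>] by (simp add: as eval_at_def fun_eq_iff)
      qed
    qed
  qed
  moreover have "HH_bracket A H \<alpha>1 \<alpha>2 \<alpha>3 = 0"
    if "KV_bracket A 1 1 H H = 0" "\<alpha>1 \<in> dual_sections A" "\<alpha>2 \<in> dual_sections A" "\<alpha>3 \<in> dual_sections A" for \<alpha>1 \<alpha>2 \<alpha>3
    using KV_bracket_HH[OF H that(2-4)] that(1) by (simp add: eval_at_def fun_eq_iff scaleR_fun_def)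
  ultimately show ?thesis
    unfolding Koszul_Vinberg_structure_def Maurer_Cartan_def C_KV_def using H T by auto
qed

end

text \<open>Bijectivity of \<open>Psi\<close> and the characterization of \<open>hom_bracket\<close>
  belong to the conclusion because \<open>Upsilon\<close> and \<open>hom_bracket\<close> are defined
  by an abstract inverse and a definite description: only with them does the formula for the bracket
  determine its values.\<close>

theorem theorem6p7:
  fixes A :: "('m::{t2_space,second_countable_topology}, 'e::real_inner, 'v::real_vector,
                'f::real_inner) algebroid"
  assumes "left_symmetric_algebroid A"
  shows "(\<forall>k. bij_betw (Psi A) (tensor_sections A k) (hom_sections A k)) \<and>
    graded_Lie_algebra (\<lambda>k. C_KV A (k + 1)) (KV_bracket A) \<and>
    (\<forall>k l. \<forall>\<phi>\<in>tensor_sections A k. \<forall>\<psi>\<in>tensor_sections A l.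
       KV_bracket A k l \<phi> \<psi> = Upsilon A (k + l) (hom_bracket A k l (Psi A \<phi>) (Psi A \<psi>)) \<and>
       hom_bracket A k l (Psi A \<phi>) (Psi A \<psi>) \<in> hom_sections A (k + l) \<and>
       (\<forall>\<alpha>s. set \<alpha>s \<subseteq> dual_sections A \<and> length \<alpha>s = k + l \<longrightarrow>
          eval_at (hom_bracket A k l (Psi A \<phi>) (Psi A \<psi>)) \<alpha>s
            = bracket_formula A k l (Psi A \<phi>) (Psi A \<psi>) \<alpha>s)) \<and>
    (\<forall>H\<in>Sym2 A.
       Koszul_Vinberg_structure A H
         \<longleftrightarrow> Maurer_Cartan (\<lambda>k. C_KV A (k + 1)) (KV_bracket A) H) \<and>
    (\<forall>H\<in>Sym2 A. \<forall>\<alpha>1\<in>dual_sections A. \<forall>\<alpha>2\<in>dual_sections A. \<forall>\<alpha>3\<in>dual_sections A.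
       eval_at (KV_bracket A 1 1 H H) [\<alpha>1, \<alpha>2, \<alpha>3] = 2 *\<^sub>R HH_bracket A H \<alpha>1 \<alpha>2 \<alpha>3)"
proof -
  interpret ls_algebroid A by unfold_locales (rule assms)
  have "hom_bracket A k l (Psi A \<phi>) (Psi A \<psi>) \<in> hom_sections A (k + l) \<and>
       (\<forall>\<alpha>s. set \<alpha>s \<subseteq> dual_sections A \<and> length \<alpha>s = k + l \<longrightarrow>
          eval_at (hom_bracket A k l (Psi A \<phi>) (Psi A \<psi>)) \<alpha>s
            = bracket_formula A k l (Psi A \<phi>) (Psi A \<psi>) \<alpha>s)"
    if "\<phi> \<in> tensor_sections A k" "\<psi> \<in> tensor_sections A l" for k l \<phi> \<psi>
    by (rule hom_bracket_spec[OF Psi_hom_sections[OF that(1)] Psi_hom_sections[OF that(2)]])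
  note h = this
  show ?thesis
    by (intro conjI[OF allI[OF Psi_bij] conjI[OF graded_Lie_algebra_KV]] conjI allI ballI
        KV_bracket_def h KV_structure_iff_MC KV_bracket_HH)
qed

end
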